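(* Let $r\ge 2$ be an integer, let $U\subset\mathbb{R}^d$ be open, and let $\frac{dx}{dt}=f(x)$ be a dynamical system with $f:U\to\mathbb{R}^d$ of class $C^r$. Let $\mathbf{a}\in\mathbb{R}^d$ be a nonzero vector. Let $\mathbf{p}:[0,T)\to U$ be a hyperbolic periodic solution of $\frac{dx}{dt}=f(x)$ of period $T>0$. Then for every $\eta>0$ there exist an open neighborhood $\mathcal{N}$ of $f$ in the $C^{r-1}$ topology and an open and dense subset $\mathcal{G}$ of $\mathcal{N}$ such that every $g\in\mathcal{G}$ has the following property: there exist a hyperbolic periodic solution $\mathbf{p}'$ of $\frac{dx}{dt}=g(x)$, of some period $T'>0$, with $d_r(\mathbf{p},\mathbf{p}')<\eta$, and a delay $\tau'>0$ such that the delay map $$t\mapsto\bigl(\mathbf{a}\cdot\mathbf{p}'(t),\ \mathbf{a}\cdot\mathbf{p}'(t-\tau'),\ \mathbf{a}\cdot\mathbf{p}'(t-2\tau')\bigr)$$ is an embedding of the circle $[0,T')$ in $\mathbb{R}^3$.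
   Context: Periodic solutions: a periodic solution of period $T$ is regarded as a function on the circle $[0,T)$, i.e. $[0,T]$ with $0$ and $T$ identified, or equivalently as a $T$-periodic function on $\mathbb{R}$ (so $t-\tau'$ is taken modulo the period). It is nonconstant, and $T$ is its minimal period, so $\mathbf{p}$ is injective on the circle $[0,T)$ (a periodic orbit does not self-intersect). It is hyperbolic if $1$ is a simple Floquet multiplier and it has no other Floquet multiplier of modulus $1$. Topology on vector fields: neighborhoods, openness and density refer to the space of $C^{r-1}$ vector fields $U\to\mathbb{R}^d$ with the $C^{r-1}$ topology (uniform convergence on compact subsets of $U$ of derivatives of order $\le r-1$). Distance between periodic orbits: for $C^r$ periodic orbits $\mathbf{p}$ of period $T$ and $\mathbf{p}'$ of period $T'$, $$d_r(\mathbf{p},\mathbf{p}')=\sup_{k=0,\dots,r}\ \sup_{0\le s<1}\|\mathbf{p}^{(k)}(sT)-\mathbf{p}'^{(k)}(sT')\|+|T-T'|,$$ where $\|\cdot\|$ is the Euclidean norm and $\mathbf{p}^{(k)}$ is the $k$-th derivative. Embedding of the circle: an injective map with everywhere nonzero derivative that is a homeomorphism onto its image (the last condition is automatic by compactness). *)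

theory Defs
  imports
    "HOL-Analysis.Analysis"
    "HOL-Computational_Algebra.Polynomial"
    "HOL-Library.Real_Mod"
begin

section \<open>Functions of class $C^k$ and the $C^k$ topology\<close>

fun iter_partial :: "'a list \<Rightarrow> ('a::euclidean_space \<Rightarrow> 'b::real_normed_vector) \<Rightarrow> 'a \<Rightarrow> 'b" where
  "iter_partial [] f = f"
| "iter_partial (v # vs) f = (\<lambda>x. frechet_derivative (iter_partial vs f) (at x) v)"

text \<open>Directions are taken in the standard basis, so the lists of length \<open>m\<close> enumerate the partial
  derivatives of order \<open>m\<close>. The domain \<open>U\<close> is meant to be open.\<close>

definition Ck_on :: "nat \<Rightarrow> 'a::euclidean_space set \<Rightarrow> ('a \<Rightarrow> 'b::real_normed_vector) \<Rightarrow> bool" where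
  "Ck_on k U f \<longleftrightarrow>
     (\<forall>vs. set vs \<subseteq> Basis \<and> length vs < k \<longrightarrow> (\<forall>x\<in>U. iter_partial vs f differentiable (at x))) \<and>
     (\<forall>vs. set vs \<subseteq> Basis \<and> length vs \<le> k \<longrightarrow> continuous_on U (iter_partial vs f))"

text \<open>Maps defined on \<open>U\<close> only are represented by total functions with the fixed value
  \<^const>\<open>undefined\<close> outside \<open>U\<close>.\<close>

definition Ck_fields :: "nat \<Rightarrow> 'a::euclidean_space set \<Rightarrow> ('a \<Rightarrow> 'a) set" where
  "Ck_fields k U = {f \<in> extensional U. Ck_on k U f}"

definition Ck_nbhd ::
  "nat \<Rightarrow> 'a::euclidean_space set \<Rightarrow> ('a \<Rightarrow> 'a) \<Rightarrow> 'a set \<Rightarrow> real \<Rightarrow> ('a \<Rightarrow> 'a) set" where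
  "Ck_nbhd k U f K \<epsilon> = {g \<in> Ck_fields k U.
     \<forall>vs. set vs \<subseteq> Basis \<and> length vs \<le> k \<longrightarrow>
       (\<forall>x\<in>K. norm (iter_partial vs g x - iter_partial vs f x) < \<epsilon>)}"

definition Ck_topology :: "nat \<Rightarrow> 'a::euclidean_space set \<Rightarrow> ('a \<Rightarrow> 'a) topology" where
  "Ck_topology k U = topology (\<lambda>S. S \<subseteq> Ck_fields k U \<and>
     (\<forall>f\<in>S. \<exists>K \<epsilon>. compact K \<and> K \<subseteq> U \<and> \<epsilon> > 0 \<and> Ck_nbhd k U f K \<epsilon> \<subseteq> S))"

lemma openin_Ck_topology:
  "openin (Ck_topology k U) S \<longleftrightarrow> S \<subseteq> Ck_fields k U \<and>
     (\<forall>f\<in>S. \<exists>K \<epsilon>. compact K \<and> K \<subseteq> U \<and> \<epsilon> > 0 \<and> Ck_nbhd k U f K \<epsilon> \<subseteq> S)"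
proof -
  define P where "P S \<longleftrightarrow> S \<subseteq> Ck_fields k U \<and>
     (\<forall>f\<in>S. \<exists>K \<epsilon>. compact K \<and> K \<subseteq> U \<and> \<epsilon> > 0 \<and> Ck_nbhd k U f K \<epsilon> \<subseteq> S)" for S
  have "P (S \<inter> S')" if S: "P S" and S': "P S'" for S S'
    unfolding P_def
  proof (intro conjI ballI)
    show "S \<inter> S' \<subseteq> Ck_fields k U"
      using S by (auto simp: P_def)
  next
    fix f assume f: "f \<in> S \<inter> S'"
    obtain K \<epsilon> where K: "compact K" "K \<subseteq> U" "\<epsilon> > 0" "Ck_nbhd k U f K \<epsilon> \<subseteq> S"
      using S f unfolding P_def by blast
    obtain K' \<epsilon>' where K': "compact K'" "K' \<subseteq> U" "\<epsilon>' > 0" "Ck_nbhd k U f K' \<epsilon>' \<subseteq> S'"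
      using S' f unfolding P_def by blast
    have "Ck_nbhd k U f (K \<union> K') (min \<epsilon> \<epsilon>') \<subseteq> Ck_nbhd k U f K \<epsilon> \<inter> Ck_nbhd k U f K' \<epsilon>'"
      unfolding Ck_nbhd_def by (intro subsetI IntI CollectI conjI allI impI ballI) simp_all
    then have "Ck_nbhd k U f (K \<union> K') (min \<epsilon> \<epsilon>') \<subseteq> S \<inter> S'"
      using K(4) K'(4) by blast
    moreover have "compact (K \<union> K')" "K \<union> K' \<subseteq> U" "min \<epsilon> \<epsilon>' > 0"
      using K K' by auto
    ultimately show "\<exists>K \<epsilon>. compact K \<and> K \<subseteq> U \<and> \<epsilon> > 0 \<and> Ck_nbhd k U f K \<epsilon> \<subseteq> S \<inter> S'"
      by blast
  qed
  moreover have "P (\<Union>\<S>)" if \<S>: "\<forall>S\<in>\<S>. P S" for \<S>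
    unfolding P_def
  proof (intro conjI ballI)
    show "\<Union>\<S> \<subseteq> Ck_fields k U"
      using \<S> by (auto simp: P_def)
  next
    fix f assume "f \<in> \<Union>\<S>"
    then obtain S where S: "S \<in> \<S>" "f \<in> S" by blast
    with \<S> have "P S" by blast
    with S(2) obtain K \<epsilon> where "compact K" "K \<subseteq> U" "\<epsilon> > 0" "Ck_nbhd k U f K \<epsilon> \<subseteq> S"
      unfolding P_def by blast
    with S(1) show "\<exists>K \<epsilon>. compact K \<and> K \<subseteq> U \<and> \<epsilon> > 0 \<and> Ck_nbhd k U f K \<epsilon> \<subseteq> \<Union>\<S>"
      by (intro exI[of _ K] exI[of _ \<epsilon>]) auto
  qed
  ultimately have "istopology P"
    unfolding istopology_def by simp
  then have "openin (topology P) = P"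
    by (rule topology_inverse')
  moreover have "Ck_topology k U = topology P"
    unfolding Ck_topology_def P_def ..
  ultimately show ?thesis
    by (simp add: P_def)
qed

lemma topspace_Ck_topology: "topspace (Ck_topology k U) = Ck_fields k U"
proof -
  have "openin (Ck_topology k U) (Ck_fields k U)"
    unfolding openin_Ck_topology
  proof (intro conjI ballI)
    fix f
    have "compact {} \<and> {} \<subseteq> U \<and> (1::real) > 0 \<and> Ck_nbhd k U f {} 1 \<subseteq> Ck_fields k U"
      by (simp add: Ck_nbhd_def)
    then show "\<exists>K \<epsilon>. compact K \<and> K \<subseteq> U \<and> \<epsilon> > 0 \<and> Ck_nbhd k U f K \<epsilon> \<subseteq> Ck_fields k U"
      by blast
  qed simp
  moreover have "topspace (Ck_topology k U) \<subseteq> Ck_fields k U"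
    using openin_topspace[of "Ck_topology k U"] unfolding openin_Ck_topology by blast
  ultimately show ?thesis
    using openin_subset by blast
qed


section \<open>Hyperbolic periodic solutions\<close>

text \<open>A periodic solution is a map on the whole real line; its period \<open>T\<close> is the minimal one.\<close>

definition periodic_solution ::
  "'a::euclidean_space set \<Rightarrow> ('a \<Rightarrow> 'a) \<Rightarrow> real \<Rightarrow> (real \<Rightarrow> 'a) \<Rightarrow> bool" where
  "periodic_solution U f T p \<longleftrightarrow>
     T > 0 \<and>
     (\<forall>t. p t \<in> U) \<and>
     (\<forall>t. (p has_vector_derivative f (p t)) (at t)) \<and>
     (\<forall>t. p (t + T) = p t) \<and>
     \<not> p constant_on UNIV \<and>
     (\<forall>S. 0 < S \<and> S < T \<longrightarrow> \<not> (\<forall>t. p (t + S) = p t))"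

text \<open>The monodromy matrix is the value at \<open>T\<close> of the principal fundamental matrix of the
  variational equation along \<open>p\<close>.\<close>

definition monodromy_matrix ::
  "(real^'n \<Rightarrow> real^'n) \<Rightarrow> real \<Rightarrow> (real \<Rightarrow> real^'n) \<Rightarrow> real^'n^'n \<Rightarrow> bool" where
  "monodromy_matrix f T p M \<longleftrightarrow>
     (\<exists>\<Phi>. \<Phi> 0 = mat 1 \<and>
       (\<forall>t. (\<Phi> has_vector_derivative (jacobian f (at (p t)) ** \<Phi> t)) (at t)) \<and>
       M = \<Phi> T)"

definition complex_charpoly :: "real^'n^'n \<Rightarrow> complex poly" where
  "complex_charpoly M =
     det (\<chi> i j. (if i = j then [:0, 1:] else 0) - [:complex_of_real (M $ i $ j):])"

text \<open>The Floquet multipliers are the complex eigenvalues of the monodromy matrix, with algebraic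
  multiplicity.\<close>

definition hyperbolic_periodic_solution ::
  "(real^'n) set \<Rightarrow> (real^'n \<Rightarrow> real^'n) \<Rightarrow> real \<Rightarrow> (real \<Rightarrow> real^'n) \<Rightarrow> bool" where
  "hyperbolic_periodic_solution U f T p \<longleftrightarrow>
     periodic_solution U f T p \<and>
     (\<exists>M. monodromy_matrix f T p M \<and>
       order 1 (complex_charpoly M) = 1 \<and>
       (\<forall>\<mu>. poly (complex_charpoly M) \<mu> = 0 \<and> norm \<mu> = 1 \<longrightarrow> \<mu> = 1))"


section \<open>Distance between periodic orbits\<close>

definition higher_vector_deriv ::
  "nat \<Rightarrow> (real \<Rightarrow> 'a::real_normed_vector) \<Rightarrow> real \<Rightarrow> 'a" where
  "higher_vector_deriv k p = ((\<lambda>q t. vector_derivative q (at t)) ^^ k) p"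

definition periodic_orbit_dist ::
  "nat \<Rightarrow> (real \<Rightarrow> 'a::real_normed_vector) \<Rightarrow> real \<Rightarrow> (real \<Rightarrow> 'a) \<Rightarrow> real \<Rightarrow> real" where
  "periodic_orbit_dist r p T p' T' =
     (SUP k\<in>{0..r}. SUP s\<in>{0..<1}.
        norm (higher_vector_deriv k p (s * T) - higher_vector_deriv k p' (s * T')))
     + \<bar>T - T'\<bar>"


section \<open>Embeddings of the circle and the delay map\<close>

text \<open>The circle with underlying set \<open>{0..<T}\<close>, carrying the quotient topology induced by
  reduction modulo \<open>T\<close> on the reals.\<close>

definition circle_topology :: "real \<Rightarrow> real topology" where
  "circle_topology T = topology (\<lambda>V. V \<subseteq> {0..<T} \<and> open {t. t rmod T \<in> V})"

lemma openin_circle_topology: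
  "openin (circle_topology T) V \<longleftrightarrow> V \<subseteq> {0..<T} \<and> open {t. t rmod T \<in> V}"
proof -
  have "istopology (\<lambda>V. V \<subseteq> {0..<T} \<and> open {t. t rmod T \<in> V})"
    unfolding istopology_def
  proof (intro conjI allI impI)
    fix V W :: "real set"
    assume "V \<subseteq> {0..<T} \<and> open {t. t rmod T \<in> V}" "W \<subseteq> {0..<T} \<and> open {t. t rmod T \<in> W}"
    then show "V \<inter> W \<subseteq> {0..<T}" "open {t. t rmod T \<in> V \<inter> W}"
      by (auto simp: Collect_conj_eq open_Int)
  next
    fix \<V> :: "real set set"
    assume *: "\<forall>V\<in>\<V>. V \<subseteq> {0..<T} \<and> open {t. t rmod T \<in> V}"
    then show "\<Union>\<V> \<subseteq> {0..<T}" by blast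
    have "{t. t rmod T \<in> \<Union>\<V>} = (\<Union>V\<in>\<V>. {t. t rmod T \<in> V})" by blast
    then show "open {t. t rmod T \<in> \<Union>\<V>}" using * by auto
  qed
  then show ?thesis
    unfolding circle_topology_def by (simp add: topology_inverse')
qed

lemma topspace_circle_topology:
  assumes "T > 0"
  shows "topspace (circle_topology T) = {0..<T}"
proof -
  have "{t. t rmod T \<in> {0..<T}} = UNIV"
    using assms by (auto simp: rmod_nonneg rmod_less)
  then have "openin (circle_topology T) {0..<T}"
    by (simp add: openin_circle_topology)
  moreover have "topspace (circle_topology T) \<subseteq> {0..<T}"
    using openin_topspace[of "circle_topology T"] unfolding openin_circle_topology by blast
  ultimately show ?thesis
    using openin_subset by blast
qed

text \<open>Maps on the circle are represented by \<open>T\<close>-periodic maps on the real line.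
  Injectivity is part of \<^const>\<open>embedding_map\<close>.\<close>

definition circle_embedding :: "real \<Rightarrow> (real \<Rightarrow> 'a::real_normed_vector) \<Rightarrow> bool" where
  "circle_embedding T F \<longleftrightarrow>
     (\<forall>t. F (t + T) = F t) \<and>
     (\<forall>t. \<exists>D. D \<noteq> 0 \<and> (F has_vector_derivative D) (at t)) \<and>
     embedding_map (circle_topology T) euclidean F"

definition delay_map :: "'a::real_inner \<Rightarrow> (real \<Rightarrow> 'a) \<Rightarrow> real \<Rightarrow> real \<Rightarrow> real^3" where
  "delay_map a p \<tau> t = vector [a \<bullet> p t, a \<bullet> p (t - \<tau>), a \<bullet> p (t - 2 * \<tau>)]"

end

theory Submission
  imports Defs
begin

text \<open>After rescaling time to period one, a periodic solution of a nearby field is a zero of a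
  Newton-type equation whose linear part, the variational equation with the period as an extra
  unknown, is solvable because the multiplier \<open>1\<close> is simple; a contraction argument gives persistence.
  Hyperbolicity is an open condition on the monodromy matrix and the flow direction. Hence the fields
  with a hyperbolic orbit near \<open>p\<close>, and those for which in addition some delay map is an embedding,
  form open sets \<open>\<N>\<close> and \<open>\<G>\<close>.

  For density the field is conjugated by \<open>x \<mapsto> x + b(x) a / (a \<bullet> a)\<close> with \<open>b\<close> a small combination of
  bumps along the orbit, which adds \<open>b\<close> to the observable \<open>a \<bullet> p\<close> without changing the period. With the
  delay \<open>T/5\<close> the double points of the delay map are governed by three independent equations on a
  two-dimensional set of pairs of times, so almost every coefficient vector avoids them. Immersivity is
  achieved first, since it controls injectivity near the diagonal.\<close>

text \<open>A \<open>C^k\<close> field has orbits of class \<open>C^(k+1)\<close>, so with k = r - 1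
  convergence of fields in \<open>C^(r-1)\<close> near the orbit already gives convergence of orbits
  in \<open>C^r\<close>. In the other direction, the conjugated field contains the derivative of the
  conjugacy and loses one order; hence bumps of class \<open>C^(k+1)\<close>. Every stability
  statement (persistence, hyperbolicity, orbit distance, embedding) is phrased as "for all small c"
  along a family jointly continuous in c and the point. Compactness then replaces explicit
  \<open>C^k\<close> estimates, and openness of a set of fields is recovered from sequences. The
  period moves with the field, so orbits are compared on the circle of length one, and delays are
  kept proportional to the period: in rescaled time the shifts are then constants. The double point
  equations all vanish on the diagonal, where no independence can be expected; this forces the
  separate treatment of nearby times. Away from it, three equations beat the two time parameters,
  just as three components of the velocity beat the single time parameter of the immersion
  condition.\<close>

section \<open>Families of $C^k$ maps\<close>

text \<open>\<open>Ck_family m C U h\<close>: all partial derivatives of order at most \<open>m\<close> of the maps \<open>h c\<close> are jointly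
  continuous in the parameter and the point. With a parameter set such as \<open>{0} \<union> {1/n}\<close> this encodes
  convergence in \<open>C\<^sup>m\<close> on compact sets in a form that is closed under composition.\<close>

primrec Ck_family ::
  "nat \<Rightarrow> 'c::topological_space set \<Rightarrow> 'a::euclidean_space set \<Rightarrow> ('c \<Rightarrow> 'a \<Rightarrow> 'b::real_normed_vector) \<Rightarrow> bool"
  where
    "Ck_family 0 C U h \<longleftrightarrow> continuous_on (C \<times> U) (\<lambda>z. h (fst z) (snd z))"
  | "Ck_family (Suc m) C U h \<longleftrightarrow>
       continuous_on (C \<times> U) (\<lambda>z. h (fst z) (snd z)) \<and>
       (\<forall>c\<in>C. \<forall>x\<in>U. h c differentiable (at x)) \<and>
       (\<forall>i\<in>Basis. Ck_family m C U (\<lambda>c x. frechet_derivative (h c) (at x) i))"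

lemma Ck_family_continuous:
  "Ck_family m C U h \<Longrightarrow> continuous_on (C \<times> U) (\<lambda>z. h (fst z) (snd z))"
  by (cases m) auto

lemma Ck_family_continuous_fixed:
  assumes "Ck_family m C U h" "c \<in> C" shows "continuous_on U (h c)"
proof -
  have "continuous_on U (\<lambda>x. (\<lambda>z. h (fst z) (snd z)) (c, x))"
    by (rule continuous_on_compose2[OF Ck_family_continuous[OF assms(1)]])
       (use assms in \<open>auto intro!: continuous_intros\<close>)
  then show ?thesis by simp
qed

lemma Ck_family_SucD: "Ck_family (Suc m) C U h \<Longrightarrow> Ck_family m C U h"
  by (induction m arbitrary: h) auto

lemma Ck_family_mono: "Ck_family n C U h \<Longrightarrow> m \<le> n \<Longrightarrow> Ck_family m C U h"
proof (induction n)
  case (Suc n) then show ?case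
    by (metis Ck_family_SucD le_Suc_eq)
qed simp

lemma Ck_family_subset:
  "Ck_family m C U h \<Longrightarrow> C' \<subseteq> C \<Longrightarrow> U' \<subseteq> U \<Longrightarrow> Ck_family m C' U' h"
proof (induction m arbitrary: h)
  case 0 then show ?case
    by (auto intro: continuous_on_subset)
next
  case (Suc m)
  have "C' \<times> U' \<subseteq> C \<times> U" using Suc.prems by auto
  with Suc.prems have "continuous_on (C' \<times> U') (\<lambda>z. h (fst z) (snd z))"
    by (auto intro: continuous_on_subset)
  moreover have "\<forall>c\<in>C'. \<forall>x\<in>U'. h c differentiable (at x)"
    using Suc.prems by (meson Ck_family.simps(2) subsetD)
  ultimately show ?case using Suc by auto
qed

lemma Ck_family_cong:
  assumes "open U" "\<And>c x. c \<in> C \<Longrightarrow> x \<in> U \<Longrightarrow> h c x = h' c x" "Ck_family m C U h"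
  shows "Ck_family m C U h'"
  using assms(2,3)
proof (induction m arbitrary: h h')
  case 0
  have "continuous_on (C \<times> U) (\<lambda>z. h' (fst z) (snd z))"
    by (rule continuous_on_eq[OF Ck_family_continuous[OF "0.prems"(2)]]) (use "0.prems"(1) in auto)
  then show ?case by simp
next
  case (Suc m)
  have c: "continuous_on (C \<times> U) (\<lambda>z. h' (fst z) (snd z))"
    using Ck_family_continuous[OF Suc.prems(2)]
    by (rule continuous_on_eq) (use Suc.prems(1) in auto)
  have d: "h' c differentiable (at x)" and e: "frechet_derivative (h c) (at x) = frechet_derivative (h' c) (at x)"
    if "c \<in> C" "x \<in> U" for c x
  proof -
    have d: "h c differentiable (at x)" using Suc.prems(2) that by auto
    show "h' c differentiable (at x)"
      using d unfolding differentiable_def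
      using has_derivative_transform_within_open[OF _ assms(1) that(2), of "h c" _ UNIV "h' c"] Suc.prems(1)[OF that(1)]
      by blast
    show "frechet_derivative (h c) (at x) = frechet_derivative (h' c) (at x)"
      by (rule frechet_derivative_transform_within_open[OF d assms(1) that(2)]) (use Suc.prems(1)[OF that(1)] in auto)
  qed
  have "Ck_family m C U (\<lambda>c x. frechet_derivative (h' c) (at x) i)" if "i \<in> Basis" for i
    by (rule Suc.IH[of "\<lambda>c x. frechet_derivative (h c) (at x) i"]) (use Suc.prems(2) that e in auto)
  with c d show ?case by auto
qed

text \<open>Lets a derivative be given by a formula instead of \<open>frechet_derivative\<close>.
  Most closure rules below are inductions on \<open>m\<close> that apply this rule to the usual
  product, quotient or chain formula.\<close>

lemma Ck_family_SucI:
  assumes "open U" "continuous_on (C \<times> U) (\<lambda>z. h (fst z) (snd z))"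
    and d: "\<And>c x. c \<in> C \<Longrightarrow> x \<in> U \<Longrightarrow> (h c has_derivative D c x) (at x)"
    and "\<And>i. i \<in> Basis \<Longrightarrow> Ck_family m C U (\<lambda>c x. D c x i)"
  shows "Ck_family (Suc m) C U h"
proof -
  have "Ck_family m C U (\<lambda>c x. frechet_derivative (h c) (at x) i)" if "i \<in> Basis" for i
    by (rule Ck_family_cong[OF assms(1) _ assms(4)[OF that]]) (use frechet_derivative_at[OF d] in auto)
  with assms(2) d show ?thesis by (auto simp: differentiable_def)
qed

lemma Ck_family_has_derivative:
  "Ck_family (Suc m) C U h \<Longrightarrow> c \<in> C \<Longrightarrow> x \<in> U \<Longrightarrow>
    (h c has_derivative frechet_derivative (h c) (at x)) (at x)"
  by (simp add: frechet_derivative_works)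

text \<open>Only derivatives in the point enter \<open>Ck_family\<close>, so the dependence on the
  parameter may be merely continuous. The coefficients of the bumps enter in this way.\<close>

lemma Ck_family_param:
  "open U \<Longrightarrow> continuous_on C k \<Longrightarrow> Ck_family m C U (\<lambda>c x. k c)"
proof (induction m arbitrary: k)
  case 0 then show ?case
    by (auto intro!: continuous_on_compose2[of C k] continuous_intros)
next
  case (Suc m)
  show ?case
    by (rule Ck_family_SucI[where D="\<lambda>c x y. 0"])
      (use Suc in \<open>auto intro!: continuous_on_compose2[of C k] continuous_intros\<close>)
qed

lemma Ck_family_const: "open U \<Longrightarrow> Ck_family m C U (\<lambda>c x. k)"
  by (rule Ck_family_param) auto

lemma Ck_family_ident: "open U \<Longrightarrow> Ck_family m C U (\<lambda>c x. x)"
proof (cases m)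
  case 0 then show ?thesis by (auto intro!: continuous_intros)
next
  case (Suc n)
  assume "open U" then show ?thesis unfolding Suc
    by (intro Ck_family_SucI[where D="\<lambda>c x y. y"])
       (auto intro!: continuous_intros derivative_eq_intros Ck_family_const)
qed

lemma Ck_family_linear:
  "open U \<Longrightarrow> bounded_linear L \<Longrightarrow> Ck_family m C U h \<Longrightarrow> Ck_family m C U (\<lambda>c x. L (h c x))"
proof (induction m arbitrary: h)
  case 0
  then show ?case by (auto intro: bounded_linear.continuous_on)
next
  case (Suc m)
  show ?case
  proof (rule Ck_family_SucI[where D="\<lambda>c x y. L (frechet_derivative (h c) (at x) y)"])
    show "continuous_on (C \<times> U) (\<lambda>z. L (h (fst z) (snd z)))"
      using Suc.prems by (auto intro: bounded_linear.continuous_on)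
    show "((\<lambda>x. L (h c x)) has_derivative (\<lambda>y. L (frechet_derivative (h c) (at x) y))) (at x)"
      if "c \<in> C" "x \<in> U" for c x
      by (rule bounded_linear.has_derivative[OF Suc.prems(2) Ck_family_has_derivative[OF Suc.prems(3) that]])
  qed (use Suc in auto)
qed

lemma Ck_family_add:
  "open U \<Longrightarrow> Ck_family m C U h \<Longrightarrow> Ck_family m C U k \<Longrightarrow> Ck_family m C U (\<lambda>c x. h c x + k c x)"
proof (induction m arbitrary: h k)
  case 0
  then show ?case by (auto intro!: continuous_intros)
next
  case (Suc m)
  show ?case
  proof (rule Ck_family_SucI[where D="\<lambda>c x y. frechet_derivative (h c) (at x) y + frechet_derivative (k c) (at x) y"])
    show "continuous_on (C \<times> U) (\<lambda>z. h (fst z) (snd z) + k (fst z) (snd z))"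
      using Suc.prems by (auto intro!: continuous_intros)
    show "((\<lambda>x. h c x + k c x) has_derivative (\<lambda>y. frechet_derivative (h c) (at x) y + frechet_derivative (k c) (at x) y)) (at x)"
      if "c \<in> C" "x \<in> U" for c x
      using Suc.prems that by (intro has_derivative_add Ck_family_has_derivative)
  qed (use Suc in auto)
qed

lemma Ck_family_sum:
  "open U \<Longrightarrow> (\<And>i. i \<in> I \<Longrightarrow> Ck_family m C U (h i)) \<Longrightarrow> Ck_family m C U (\<lambda>c x. \<Sum>i\<in>I. h i c x)"
  by (induction I rule: infinite_finite_induct) (auto intro!: Ck_family_const Ck_family_add)

lemma Ck_family_bilinear:
  assumes "open U" "bounded_bilinear P"
  shows "Ck_family m C U h \<Longrightarrow> Ck_family m C U k \<Longrightarrow> Ck_family m C U (\<lambda>c x. P (h c x) (k c x))"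
proof (induction m arbitrary: h k)
  case 0
  then show ?case by (auto intro!: bounded_bilinear.continuous_on[OF assms(2)])
next
  case (Suc m)
  show ?case
  proof (rule Ck_family_SucI[where D="\<lambda>c x y. P (h c x) (frechet_derivative (k c) (at x) y) + P (frechet_derivative (h c) (at x) y) (k c x)"])
    show "continuous_on (C \<times> U) (\<lambda>z. P (h (fst z) (snd z)) (k (fst z) (snd z)))"
      using Suc.prems by (auto intro!: bounded_bilinear.continuous_on[OF assms(2)])
    show "((\<lambda>x. P (h c x) (k c x)) has_derivative (\<lambda>y. P (h c x) (frechet_derivative (k c) (at x) y) + P (frechet_derivative (h c) (at x) y) (k c x))) (at x)"
      if "c \<in> C" "x \<in> U" for c x
      using Suc.prems that by (intro bounded_bilinear.FDERIV[OF assms(2)] Ck_family_has_derivative)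
    show "Ck_family m C U (\<lambda>c x. P (h c x) (frechet_derivative (k c) (at x) i) + P (frechet_derivative (h c) (at x) i) (k c x))"
      if "i \<in> Basis" for i
      using Suc.prems[THEN Ck_family_SucD] Suc.prems that
      by (intro Ck_family_add assms(1) Suc.IH) auto
  qed (use assms in auto)
qed

lemmas Ck_family_scaleR = Ck_family_bilinear[OF _ bounded_bilinear_scaleR]
lemmas Ck_family_mult = Ck_family_bilinear[OF _ bounded_bilinear_mult]
lemmas Ck_family_inner = Ck_family_bilinear[OF _ bounded_bilinear_inner]

lemma Ck_family_diff:
  assumes "open U" "Ck_family m C U h" "Ck_family m C U k"
  shows "Ck_family m C U (\<lambda>c x. h c x - k c x)"
  using Ck_family_add[OF assms(1,2) Ck_family_linear[OF assms(1) bounded_linear_minus[OF bounded_linear_ident] assms(3)]]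
  by simp

lemma Ck_family_inverse:
  fixes h :: "'c::topological_space \<Rightarrow> 'a::euclidean_space \<Rightarrow> real"
  assumes "open U" and nz: "\<And>c x. c \<in> C \<Longrightarrow> x \<in> U \<Longrightarrow> h c x \<noteq> 0"
  shows "Ck_family m C U h \<Longrightarrow> Ck_family m C U (\<lambda>c x. inverse (h c x))"
proof (induction m)
  case 0
  then show ?case using nz by (auto intro!: continuous_intros)
next
  case (Suc m)
  show ?case
  proof (rule Ck_family_SucI[where D="\<lambda>c x y. - (inverse (h c x) * frechet_derivative (h c) (at x) y * inverse (h c x))"])
    show "continuous_on (C \<times> U) (\<lambda>z. inverse (h (fst z) (snd z)))"
      using Suc.prems nz by (auto intro!: continuous_intros)
    show "((\<lambda>x. inverse (h c x)) has_derivative (\<lambda>y. - (inverse (h c x) * frechet_derivative (h c) (at x) y * inverse (h c x)))) (at x)"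
      if "c \<in> C" "x \<in> U" for c x
      using Suc.prems that nz by (intro Deriv.has_derivative_inverse Ck_family_has_derivative)
    show "Ck_family m C U (\<lambda>c x. - (inverse (h c x) * frechet_derivative (h c) (at x) i * inverse (h c x)))"
      if "i \<in> Basis" for i
      using Suc.prems that
      by (intro Ck_family_mult assms(1) Suc.IH Ck_family_linear[OF assms(1) bounded_linear_minus[OF bounded_linear_ident]])
        (auto intro: Ck_family_SucD)
  qed (use assms in auto)
qed

lemma linear_basis_expansion:
  fixes L :: "'a::euclidean_space \<Rightarrow> 'b::real_normed_vector"
  assumes "linear L" shows "L v = (\<Sum>j\<in>Basis. (v \<bullet> j) *\<^sub>R L j)"
proof -
  have "L v = L (\<Sum>j\<in>Basis. (v \<bullet> j) *\<^sub>R j)" by (simp add: euclidean_representation)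
  then show ?thesis by (simp add: linear_sum[OF assms] linear_scale[OF assms])
qed

lemma Ck_family_compose:
  fixes h :: "'c::topological_space \<Rightarrow> 'b::euclidean_space \<Rightarrow> 'd::real_normed_vector"
    and k :: "'c \<Rightarrow> 'a::euclidean_space \<Rightarrow> 'b"
  assumes "open U" "open V" and V: "\<And>c x. c \<in> C \<Longrightarrow> x \<in> U \<Longrightarrow> k c x \<in> V"
  shows "Ck_family m C V h \<Longrightarrow> Ck_family m C U k \<Longrightarrow> Ck_family m C U (\<lambda>c x. h c (k c x))"
proof (induction m arbitrary: h)
  case 0
  have "continuous_on (C \<times> U) (\<lambda>z. (\<lambda>w. h (fst w) (snd w)) (fst z, k (fst z) (snd z)))"
    by (rule continuous_on_compose2[of "C \<times> V"]) (use 0 V in \<open>auto intro!: continuous_intros\<close>)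
  then show ?case by simp
next
  case (Suc m)
  have k: "Ck_family m C U k" using Suc.prems(2) by (rule Ck_family_SucD)
  have exp: "frechet_derivative (h c) (at (k c x)) v = (\<Sum>j\<in>Basis. (v \<bullet> j) *\<^sub>R frechet_derivative (h c) (at (k c x)) j)"
    if "c \<in> C" "x \<in> U" for c x v
    by (rule linear_basis_expansion)
      (use Ck_family_has_derivative[OF Suc.prems(1) that(1) V[OF that]] in \<open>rule has_derivative_linear\<close>)
  show ?case
  proof (rule Ck_family_SucI[where D="\<lambda>c x y. \<Sum>j\<in>Basis. (frechet_derivative (k c) (at x) y \<bullet> j) *\<^sub>R frechet_derivative (h c) (at (k c x)) j"])
    have "continuous_on (C \<times> U) (\<lambda>z. (\<lambda>w. h (fst w) (snd w)) (fst z, k (fst z) (snd z)))"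
      by (rule continuous_on_compose2[of "C \<times> V"])
        (use Ck_family_continuous[OF Suc.prems(1)] Ck_family_continuous[OF Suc.prems(2)] V in \<open>auto intro!: continuous_intros\<close>)
    then show "continuous_on (C \<times> U) (\<lambda>z. h (fst z) (k (fst z) (snd z)))" by simp
    show "((\<lambda>x. h c (k c x)) has_derivative (\<lambda>y. \<Sum>j\<in>Basis. (frechet_derivative (k c) (at x) y \<bullet> j) *\<^sub>R frechet_derivative (h c) (at (k c x)) j)) (at x)"
      if "c \<in> C" "x \<in> U" for c x
      using has_derivative_compose[OF Ck_family_has_derivative[OF Suc.prems(2) that] Ck_family_has_derivative[OF Suc.prems(1) that(1) V[OF that]]]
      by (simp add: exp[OF that, symmetric])
    show "Ck_family m C U (\<lambda>c x. \<Sum>j\<in>Basis. (frechet_derivative (k c) (at x) i \<bullet> j) *\<^sub>R frechet_derivative (h c) (at (k c x)) j)"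
      if "i \<in> Basis" for i
    proof (intro Ck_family_sum Ck_family_scaleR assms(1))
      fix j :: 'b assume j: "j \<in> Basis"
      show "Ck_family m C U (\<lambda>c x. frechet_derivative (k c) (at x) i \<bullet> j)"
        using Suc.prems(2) that by (intro Ck_family_linear[OF assms(1) bounded_linear_inner_left]) auto
      show "Ck_family m C U (\<lambda>c x. frechet_derivative (h c) (at (k c x)) j)"
        by (rule Suc.IH) (use Suc.prems j k in auto)
    qed
  qed (rule assms)
qed

text \<open>\<open>iter_partial\<close> adds new derivatives on the outside, whereas
  \<open>Ck_family\<close> differentiates on the inside first. Splitting lists at their last element
  reconciles the two recursions.\<close>

lemma iter_partial_snoc:
  "iter_partial (vs @ [v]) f = iter_partial vs (\<lambda>x. frechet_derivative f (at x) v)"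
  by (induction vs) auto

lemma Ck_family_iff_iter_partial:
  "Ck_family m C U h \<longleftrightarrow>
     (\<forall>vs. set vs \<subseteq> Basis \<and> length vs < m \<longrightarrow> (\<forall>c\<in>C. \<forall>x\<in>U. iter_partial vs (h c) differentiable (at x))) \<and>
     (\<forall>vs. set vs \<subseteq> Basis \<and> length vs \<le> m \<longrightarrow>
        continuous_on (C \<times> U) (\<lambda>z. iter_partial vs (h (fst z)) (snd z)))"
proof (induction m arbitrary: h)
  case 0 then show ?case by auto
next
  case (Suc m)
  have *: "(\<forall>vs. set vs \<subseteq> Basis \<and> length vs < Suc n \<longrightarrow> P vs) \<longleftrightarrow>
        P [] \<and> (\<forall>i\<in>Basis. \<forall>vs. set vs \<subseteq> Basis \<and> length vs < n \<longrightarrow> P (vs @ [i]))" for P :: "'e::euclidean_space list \<Rightarrow> bool" and n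
  proof (intro iffI allI impI conjI ballI)
    fix vs :: "'e list" assume A: "P [] \<and> (\<forall>i\<in>Basis. \<forall>vs. set vs \<subseteq> Basis \<and> length vs < n \<longrightarrow> P (vs @ [i]))"
      "set vs \<subseteq> Basis \<and> length vs < Suc n"
    then show "P vs" by (cases vs rule: rev_cases) auto
  qed auto
  have **: "(\<forall>vs. set vs \<subseteq> Basis \<and> length vs \<le> Suc n \<longrightarrow> P vs) \<longleftrightarrow>
        P [] \<and> (\<forall>i\<in>Basis. \<forall>vs. set vs \<subseteq> Basis \<and> length vs \<le> n \<longrightarrow> P (vs @ [i]))" for P :: "'e::euclidean_space list \<Rightarrow> bool" and n
    using *[of "Suc n" P] by (simp add: less_Suc_eq_le)
  show ?case
    unfolding * ** Ck_family.simps Suc.IH iter_partial_snoc by auto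
qed

text \<open>A one-point parameter set turns joint continuity into continuity in the point, so that
  results on families apply to a single field.\<close>

lemma Ck_on_iff_Ck_family: "Ck_on m U f \<longleftrightarrow> Ck_family m {c} U (\<lambda>_. f)"
proof -
  have "continuous_on ({c} \<times> U) (\<lambda>z. F (snd z)) \<longleftrightarrow> continuous_on U F" for F :: "'a \<Rightarrow> 'b"
  proof
    assume *: "continuous_on ({c} \<times> U) (\<lambda>z. F (snd z))"
    have "continuous_on U (\<lambda>x. (\<lambda>z. F (snd z)) (c, x))"
      by (rule continuous_on_compose2[OF *]) (auto intro!: continuous_intros)
    then show "continuous_on U F" by simp
  next
    assume "continuous_on U F"
    then show "continuous_on ({c} \<times> U) (\<lambda>z. F (snd z))"
      by (rule continuous_on_compose2) (auto intro!: continuous_intros)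
  qed
  then show ?thesis unfolding Ck_on_def Ck_family_iff_iter_partial by simp
qed

lemma Ck_family_imp_Ck_on:
  assumes "Ck_family m C U h" "c \<in> C" shows "Ck_on m U (h c)"
proof -
  have "Ck_family m {c} U (\<lambda>d. h d)" by (rule Ck_family_subset[OF assms(1)]) (use assms in auto)
  moreover have "continuous_on ({c} \<times> U) (\<lambda>z. iter_partial vs (h (fst z)) (snd z)) \<longleftrightarrow>
      continuous_on ({c} \<times> U) (\<lambda>z. iter_partial vs (h c) (snd z))" for vs
    by (rule continuous_on_cong) auto
  ultimately have "Ck_family m {c} U (\<lambda>_. h c)"
    unfolding Ck_family_iff_iter_partial by simp
  then show ?thesis by (simp add: Ck_on_iff_Ck_family[where c=c])
qed

lemma Ck_family_constant:
  assumes "Ck_on m U f" shows "Ck_family m C U (\<lambda>_. f)"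
proof -
  have "continuous_on (C \<times> U) (\<lambda>z. F (snd z))" if "continuous_on U F" for F :: "'a \<Rightarrow> 'b"
    by (rule continuous_on_compose2[OF that]) (auto intro!: continuous_intros)
  then show ?thesis using assms unfolding Ck_on_def Ck_family_iff_iter_partial by auto
qed

section \<open>Linear differential equations\<close>

lemma has_vector_derivative_imp_continuous_on:
  "(\<And>t. (F has_vector_derivative F' t) (at t)) \<Longrightarrow> continuous_on S F"
  by (intro continuous_at_imp_continuous_on ballI has_vector_derivative_continuous)

lemma continuous_on_bounded_interval:
  fixes F :: "real \<Rightarrow> 'a::real_normed_vector"
  assumes "continuous_on {a..b} F"
  shows "\<exists>B>0. \<forall>s\<in>{a..b}. norm (F s) \<le> B"
proof -
  have "bounded (F ` {a..b})"
    by (intro compact_imp_bounded compact_continuous_image assms) auto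
  then show ?thesis by (auto simp: bounded_pos)
qed

text \<open>The energy \<open>exp (- (2 * L + 1) * t) * (x t \<bullet> x t + e\<^sup>2)\<close> is
  nonincreasing, because 2 (x \<bullet> x') is at most 2 L |x|^2 + 2 |x| e, and 2 |x| e is at most
  |x|^2 + e^2. The squared norm is used since the norm is not differentiable at 0; the constant
  \<open>e\<^sup>2\<close> inside the energy absorbs the inhomogeneity.\<close>

lemma gronwall_energy:
  fixes x x' :: "real \<Rightarrow> 'a::real_inner"
  assumes d: "\<And>t. (x has_vector_derivative x' t) (at t)"
    and le: "\<And>t. 0 \<le> t \<Longrightarrow> t \<le> b \<Longrightarrow> norm (x' t) \<le> L * norm (x t) + e"
    and "0 \<le> b" "L \<ge> 0"
  shows "(norm (x b))\<^sup>2 \<le> ((norm (x 0))\<^sup>2 + e\<^sup>2) * exp ((2 * L + 1) * b)"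
proof -
  let ?E = "\<lambda>t. exp (- (2 * L + 1) * t) * (x t \<bullet> x t + e\<^sup>2)"
  have E: "(?E has_real_derivative
      exp (- (2 * L + 1) * t) * (2 * (x t \<bullet> x' t) - (2 * L + 1) * (x t \<bullet> x t + e\<^sup>2))) (at t)" for t
  proof -
    have "((\<lambda>t. x t \<bullet> x t) has_real_derivative 2 * (x t \<bullet> x' t)) (at t)"
      using bounded_bilinear.has_vector_derivative[OF bounded_bilinear_inner d[of t] d[of t]]
      by (auto simp: has_real_derivative_iff_has_vector_derivative inner_commute)
    note [derivative_intros] = this
    show ?thesis
      by (auto intro!: derivative_eq_intros) (simp add: algebra_simps)
  qed
  have "?E b \<le> ?E 0"
  proof (rule DERIV_nonpos_imp_nonincreasing[OF assms(3)])
    fix t assume t: "0 \<le> t" "t \<le> b"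
    have "x t \<bullet> x' t \<le> norm (x t) * norm (x' t)" by (rule norm_cauchy_schwarz)
    also have "\<dots> \<le> norm (x t) * (L * norm (x t) + e)"
      using le[OF t] by (intro mult_left_mono) auto
    also have "2 * \<dots> \<le> 2 * L * (norm (x t))\<^sup>2 + ((norm (x t))\<^sup>2 + e\<^sup>2)"
      using sum_squares_bound[of "norm (x t)" e] by (simp add: algebra_simps power2_eq_square)
    finally have "2 * (x t \<bullet> x' t) \<le> 2 * L * (norm (x t))\<^sup>2 + ((norm (x t))\<^sup>2 + e\<^sup>2)" by simp
    also have "\<dots> \<le> (2 * L + 1) * (x t \<bullet> x t + e\<^sup>2)"
      using \<open>L \<ge> 0\<close> by (simp add: algebra_simps power2_norm_eq_inner)
    finally have "exp (- (2 * L + 1) * t) * (2 * (x t \<bullet> x' t) - (2 * L + 1) * (x t \<bullet> x t + e\<^sup>2)) \<le> 0"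
      by (simp add: mult_nonneg_nonpos)
    then show "\<exists>y. (?E has_real_derivative y) (at t) \<and> y \<le> 0"
      using E by blast
  qed
  then have "exp ((2 * L + 1) * b) * ?E b \<le> exp ((2 * L + 1) * b) * ?E 0"
    by (intro mult_left_mono) auto
  moreover have "exp ((2 * L + 1) * b) * ?E b = x b \<bullet> x b + e\<^sup>2"
  proof -
    have "exp ((2 * L + 1) * b) * exp (- (2 * L + 1) * b) = 1"
      by (simp add: exp_add[symmetric] algebra_simps)
    then show ?thesis by (simp only: mult.assoc[symmetric]) simp
  qed
  moreover have "exp ((2 * L + 1) * b) * ?E 0 = exp ((2 * L + 1) * b) * (x 0 \<bullet> x 0 + e\<^sup>2)" by simp
  ultimately have "x b \<bullet> x b + e\<^sup>2 \<le> exp ((2 * L + 1) * b) * (x 0 \<bullet> x 0 + e\<^sup>2)" by linarith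
  then have "x b \<bullet> x b \<le> exp ((2 * L + 1) * b) * (x 0 \<bullet> x 0 + e\<^sup>2)"
    using zero_le_power2[of e] by linarith
  then show ?thesis by (simp add: power2_norm_eq_inner mult.commute)
qed

text \<open>Gronwall with e = 0 runs forward in time only; the sign \<sigma> reflects time about
  \<open>a\<close> to cover the past as well.\<close>

lemma gronwall_unique:
  fixes x x' :: "real \<Rightarrow> 'a::real_inner"
  assumes d: "\<And>t. (x has_vector_derivative x' t) (at t)"
    and le: "\<And>t. norm (x' t) \<le> L * norm (x t)" and "L \<ge> 0" and "x a = 0"
  shows "x t = 0"
proof -
  have "x (a + \<sigma> * s) = 0" if s: "s \<ge> 0" "\<sigma> = 1 \<or> \<sigma> = -1" for s \<sigma>
  proof -
    have "(norm (x (a + \<sigma> * s)))\<^sup>2 \<le> ((norm (x (a + \<sigma> * 0)))\<^sup>2 + 0\<^sup>2) * exp ((2 * L + 1) * s)"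
    proof (rule gronwall_energy[where x="\<lambda>s. x (a + \<sigma> * s)" and x'="\<lambda>s. \<sigma> *\<^sub>R x' (a + \<sigma> * s)"])
      fix s
      have "((x \<circ> (\<lambda>s. a + \<sigma> * s)) has_vector_derivative \<sigma> *\<^sub>R x' (a + \<sigma> * s)) (at s)"
        by (rule vector_diff_chain_at) (auto intro!: derivative_eq_intros d)
      then show "((\<lambda>s. x (a + \<sigma> * s)) has_vector_derivative \<sigma> *\<^sub>R x' (a + \<sigma> * s)) (at s)"
        by (simp add: o_def)
      show "norm (\<sigma> *\<^sub>R x' (a + \<sigma> * s)) \<le> L * norm (x (a + \<sigma> * s)) + 0"
        using le[of "a + \<sigma> * s"] s by auto
    qed (use s assms(3) in auto)
    with assms(4) show ?thesis by simp
  qed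
  from this[of "t - a" 1] this[of "a - t" "-1"] show ?thesis
    by (cases "t \<ge> a") auto
qed

lemma antiderivative_real:
  fixes f :: "real \<Rightarrow> 'a::banach"
  assumes "continuous_on UNIV f"
  obtains F where "F 0 = 0" "\<And>t. (F has_vector_derivative f t) (at t)"
proof -
  define F where "F t = (if 0 \<le> t then integral {0..t} f else - integral {t..0} f)" for t
  have int: "f integrable_on {a..b}" for a b
    using assms by (intro integrable_continuous_real) (auto intro: continuous_on_subset)
  \<comment> \<open>Based at -N, both cases of the definition of \<open>F\<close> become one
    formula, to which the fundamental theorem applies also at 0.\<close>
  have eq: "F s = integral {-N..s} f - integral {-N..0} f" if "\<bar>s\<bar> \<le> N" for s N
  proof (cases "0 \<le> s")
    case True
    have "integral {-N..0} f + integral {0..s} f = integral {-N..s} f"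
      by (rule Henstock_Kurzweil_Integration.integral_combine) (use that True int in auto)
    then show ?thesis using True by (simp add: F_def algebra_simps)
  next
    case False
    have "integral {-N..s} f + integral {s..0} f = integral {-N..0} f"
      by (rule Henstock_Kurzweil_Integration.integral_combine) (use that False int in auto)
    then show ?thesis using False by (simp add: F_def algebra_simps)
  qed
  have "(F has_vector_derivative f t) (at t)" for t
  proof -
    let ?N = "\<bar>t\<bar> + 1"
    have "((\<lambda>s. integral {-?N..s} f) has_vector_derivative f t) (at t within {-?N..?N})"
      by (rule integral_has_vector_derivative) (use assms in \<open>auto intro: continuous_on_subset\<close>)
    then have "((\<lambda>s. integral {-?N..s} f - integral {-?N..0} f) has_vector_derivative f t) (at t within {-?N..?N})"
      by (auto intro!: derivative_eq_intros)
    moreover have "F s = integral {-?N..s} f - integral {-?N..0} f" if "s \<in> {-?N..?N}" for s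
      by (rule eq) (use that in auto)
    ultimately have "(F has_vector_derivative f t) (at t within {-?N..?N})"
      by (intro has_vector_derivative_transform[where g=F]) auto
    moreover have "at t within {-?N..?N} = at t"
      by (rule at_within_interior) auto
    ultimately show ?thesis by simp
  qed
  moreover have "F 0 = 0" by (simp add: F_def)
  ultimately show thesis using that by blast
qed

text \<open>Integration against the weight exp (K |t|) gains a factor 1 / K. This makes the Picard
  operator a contraction on the whole line at once, in a weighted supremum norm.\<close>

lemma norm_antiderivative_le_exp:
  fixes F :: "real \<Rightarrow> 'a::real_normed_vector"
  assumes d: "\<And>t. (F has_vector_derivative f t) (at t)" and F0: "F 0 = 0"
    and le: "\<And>t. norm (f t) \<le> M * exp (K * \<bar>t\<bar>)" and K: "K > 0" "M \<ge> 0"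
  shows "norm (F t) \<le> M / K * exp (K * \<bar>t\<bar>)"
proof -
  have "norm (F (\<sigma> * s)) \<le> M / K * exp (K * s)" if s: "s \<ge> 0" "\<sigma> = 1 \<or> \<sigma> = -1" for s \<sigma>
  proof (cases "s = 0")
    case True then show ?thesis using F0 K by simp
  next
    case False
    have "norm (F (\<sigma> * s) - F (\<sigma> * 0)) \<le> M / K * exp (K * s) - M / K * exp (K * 0)"
    proof (rule differentiable_bound_general[where f'="\<lambda>s. \<sigma> *\<^sub>R f (\<sigma> * s)" and \<phi>'="\<lambda>s. M * exp (K * s)"])
      have dd: "((\<lambda>s. F (\<sigma> * s)) has_vector_derivative \<sigma> *\<^sub>R f (\<sigma> * s)) (at s)" for s
      proof -
        have "((F \<circ> (\<lambda>s. \<sigma> * s)) has_vector_derivative \<sigma> *\<^sub>R f (\<sigma> * s)) (at s)"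
          by (rule vector_diff_chain_at) (auto intro!: derivative_eq_intros d)
        then show ?thesis by (simp add: o_def)
      qed
      show "((\<lambda>s. F (\<sigma> * s)) has_vector_derivative \<sigma> *\<^sub>R f (\<sigma> * s)) (at s)" for s by (rule dd)
      show "continuous_on {0..s} (\<lambda>s. F (\<sigma> * s))"
        by (rule has_vector_derivative_imp_continuous_on[OF dd])
      show "((\<lambda>s. M / K * exp (K * s)) has_vector_derivative M * exp (K * r)) (at r)" for r
        unfolding has_real_derivative_iff_has_vector_derivative[symmetric]
        using \<open>K > 0\<close> by (auto intro!: derivative_eq_intros)
      show "norm (\<sigma> *\<^sub>R f (\<sigma> * r)) \<le> M * exp (K * r)" if "0 < r" "r < s" for r
        using le[of "\<sigma> * r"] s that by (auto simp: abs_mult)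
    qed (use s False K in \<open>auto intro!: continuous_intros\<close>)
    also have "\<dots> \<le> M / K * exp (K * s)" using K by simp
    finally show ?thesis using F0 by simp
  qed
  from this[of t 1] this[of "-t" "-1"] show ?thesis
    by (cases "t \<ge> 0") auto
qed

text \<open>Picard iteration for \<open>exp (- K * \<bar>t\<bar>) *\<^sub>R X t\<close>, which is
  sought among the bounded continuous functions. A single fixed point gives the global solution,
  without gluing local ones.\<close>

lemma linear_ode_exists:
  fixes B :: "real \<Rightarrow> 'a::banach \<Rightarrow> 'a"
  assumes lin: "\<And>t. linear (B t)" and bd: "\<And>t x. norm (B t x) \<le> L * norm x" and "L \<ge> 0"
    and cont: "continuous_on UNIV (\<lambda>z. B (fst z) (snd z))"
  obtains X where "X 0 = x0" "\<And>t. (X has_vector_derivative B t (X t)) (at t)"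
proof -
  \<comment> \<open>Any K of at least 2 L would make the contraction factor L / K at most 1/2; the
    added 1 keeps K positive when L = 0.\<close>
  define K where "K = 2 * L + 1"
  have K: "K > 0" "L / K \<le> 1/2" using \<open>L \<ge> 0\<close> by (auto simp: K_def field_simps)
  have c: "continuous_on UNIV (\<lambda>s. B s (exp (K * \<bar>s\<bar>) *\<^sub>R apply_bcontfun Y s))" for Y
  proof -
    have "continuous_on UNIV (\<lambda>s. (\<lambda>z. B (fst z) (snd z)) (s, exp (K * \<bar>s\<bar>) *\<^sub>R apply_bcontfun Y s))"
      by (rule continuous_on_compose2[OF cont]) (auto intro!: continuous_intros)
    then show ?thesis by simp
  qed
  have "\<exists>F. F 0 = 0 \<and> (\<forall>t. (F has_vector_derivative B t (exp (K * \<bar>t\<bar>) *\<^sub>R apply_bcontfun Y t)) (at t))" for Y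
    using antiderivative_real[OF c[of Y]] by metis
  then obtain J where J0: "\<And>Y. J Y 0 = 0"
    and J: "\<And>Y t. (J Y has_vector_derivative B t (exp (K * \<bar>t\<bar>) *\<^sub>R apply_bcontfun Y t)) (at t)"
    by metis
  have Jdiff: "norm (J Y t - J Z t) \<le> 1/2 * norm (Y - Z) * exp (K * \<bar>t\<bar>)" for Y Z t
  proof -
    have "norm (J Y t - J Z t) \<le> (L * norm (Y - Z)) / K * exp (K * \<bar>t\<bar>)"
    proof (rule norm_antiderivative_le_exp[where F="\<lambda>t. J Y t - J Z t"])
      fix s
      show "((\<lambda>t. J Y t - J Z t) has_vector_derivative
         B s (exp (K * \<bar>s\<bar>) *\<^sub>R (Y - Z) s)) (at s)"
        by (auto intro!: derivative_eq_intros J simp: linear_diff[OF lin] scaleR_right_diff_distrib)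
      have "norm (B s (exp (K * \<bar>s\<bar>) *\<^sub>R (Y - Z) s)) \<le> L * (exp (K * \<bar>s\<bar>) * norm ((Y - Z) s))"
        using bd[of s "exp (K * \<bar>s\<bar>) *\<^sub>R (Y - Z) s"] by simp
      also have "\<dots> \<le> L * (exp (K * \<bar>s\<bar>) * norm (Y - Z))"
        using \<open>L \<ge> 0\<close> by (intro mult_left_mono norm_bounded) auto
      finally show "norm (B s (exp (K * \<bar>s\<bar>) *\<^sub>R (Y - Z) s)) \<le> L * norm (Y - Z) * exp (K * \<bar>s\<bar>)"
        by (simp add: ac_simps)
    qed (use J0 K \<open>L \<ge> 0\<close> in auto)
    also have "\<dots> = (L / K) * (norm (Y - Z) * exp (K * \<bar>t\<bar>))" by simp
    also have "\<dots> \<le> 1/2 * (norm (Y - Z) * exp (K * \<bar>t\<bar>))" using K by (intro mult_right_mono) auto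
    finally show ?thesis by simp
  qed
  have JZ: "J 0 t = 0" for t
  proof -
    have "norm (J 0 t) \<le> 0 / K * exp (K * \<bar>t\<bar>)"
      by (rule norm_antiderivative_le_exp[OF J J0]) (use K linear_0[OF lin] in auto)
    then show ?thesis by simp
  qed
  define P where "P Y = Bcontfun (\<lambda>t. exp (- K * \<bar>t\<bar>) *\<^sub>R (x0 + J Y t))" for Y
  have P: "apply_bcontfun (P Y) = (\<lambda>t. exp (- K * \<bar>t\<bar>) *\<^sub>R (x0 + J Y t))" for Y
    unfolding P_def
  proof (rule Bcontfun_inverse, rule bcontfun_normI)
    have "continuous_on UNIV (J Y)"
      by (meson J continuous_at_imp_continuous_on has_vector_derivative_continuous)
    then show "continuous_on UNIV (\<lambda>t. exp (- K * \<bar>t\<bar>) *\<^sub>R (x0 + J Y t))"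
      by (intro continuous_intros)
    fix t
    have "norm (exp (- K * \<bar>t\<bar>) *\<^sub>R (x0 + J Y t)) \<le> exp (- K * \<bar>t\<bar>) * (norm x0 + norm (J Y t))"
      by (simp add: norm_triangle_ineq)
    also have "norm (J Y t) \<le> 1/2 * norm Y * exp (K * \<bar>t\<bar>)"
      using Jdiff[of Y t 0] by (simp add: JZ)
    also have "exp (- K * \<bar>t\<bar>) * (norm x0 + 1/2 * norm Y * exp (K * \<bar>t\<bar>)) =
        exp (- K * \<bar>t\<bar>) * norm x0 + 1/2 * norm Y"
      by (simp add: algebra_simps exp_minus)
    also have "\<dots> \<le> norm x0 + 1/2 * norm Y"
      using K by (simp add: mult_left_le_one_le)
    finally show "norm (exp (- K * \<bar>t\<bar>) *\<^sub>R (x0 + J Y t)) \<le> norm x0 + 1/2 * norm Y" by simp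
  qed
  have "\<exists>!Y. P Y = Y"
  proof (rule banach_fix_type[where c="1/2"])
    show "\<forall>Y Z. dist (P Y) (P Z) \<le> 1/2 * dist Y Z"
    proof (intro allI dist_bound)
      fix Y Z t
      have "dist (P Y t) (P Z t) = norm (exp (- K * \<bar>t\<bar>) *\<^sub>R (J Y t - J Z t))"
        by (simp add: P dist_norm scaleR_right_diff_distrib[symmetric] del: norm_scaleR)
      also have "\<dots> = exp (- K * \<bar>t\<bar>) * norm (J Y t - J Z t)" by simp
      also have "\<dots> \<le> exp (- K * \<bar>t\<bar>) * (1/2 * norm (Y - Z) * exp (K * \<bar>t\<bar>))"
        by (intro mult_left_mono Jdiff) auto
      also have "\<dots> = 1/2 * dist Y Z" by (simp add: exp_minus dist_norm)
      finally show "dist (P Y t) (P Z t) \<le> 1/2 * dist Y Z" .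
    qed
  qed auto
  then obtain Y where Y: "P Y = Y" by auto
  define X where "X t = x0 + J Y t" for t
  have "exp (K * \<bar>t\<bar>) *\<^sub>R Y t = X t" for t
    by (subst Y[symmetric]) (simp add: P X_def exp_minus)
  then have "(X has_vector_derivative B t (X t)) (at t)" for t
    unfolding X_def using J[of Y t] by (auto intro!: derivative_eq_intros)
  moreover have "X 0 = x0" by (simp add: X_def J0)
  ultimately show thesis using that by blast
qed

text \<open>\<open>K\<close> need not be convex, so the mean value inequality is available only on
  small balls. Local Lipschitz continuity on a compact set then yields one constant.\<close>

lemma C1_lipschitz_on_compact:
  fixes f :: "'a::euclidean_space \<Rightarrow> 'b::euclidean_space"
  assumes "open U" "compact K" "K \<subseteq> U" "Ck_on 1 U f"
  obtains L where "L \<ge> 0" "\<And>x y. x \<in> K \<Longrightarrow> y \<in> K \<Longrightarrow> norm (f x - f y) \<le> L * norm (x - y)"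
proof -
  have F: "Ck_family (Suc 0) {0::real} U (\<lambda>_. f)"
    using assms(4) by (simp add: Ck_on_iff_Ck_family[where c="0::real"])
  have D: "(f has_derivative frechet_derivative f (at x)) (at x)" if "x \<in> U" for x
    using Ck_family_has_derivative[OF F _ that] by simp
  have C: "continuous_on U (\<lambda>x. frechet_derivative f (at x) i)" if "i \<in> Basis" for i
    using Ck_family_continuous_fixed[of 0 "{0::real}" U "\<lambda>_ x. frechet_derivative f (at x) i" 0] F that by auto
  have "local_lipschitz {0::real} U (\<lambda>_. f)"
  proof (rule local_lipschitzI)
    fix t x assume "t \<in> {0::real}" "x \<in> U"
    obtain u where u: "u > 0" "cball x u \<subseteq> U"
      using \<open>open U\<close> \<open>x \<in> U\<close> open_contains_cball by blast
    have "\<exists>B. \<forall>y\<in>cball x u. norm (frechet_derivative f (at y) i) \<le> B" if "i \<in> Basis" for i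
    proof -
      have "compact ((\<lambda>y. frechet_derivative f (at y) i) ` cball x u)"
        by (intro compact_continuous_image continuous_on_subset[OF C[OF that] u(2)]) auto
      then show ?thesis by (auto dest!: compact_imp_bounded simp: bounded_iff)
    qed
    then obtain B where B: "\<And>i y. i \<in> Basis \<Longrightarrow> y \<in> cball x u \<Longrightarrow> norm (frechet_derivative f (at y) i) \<le> B i"
      by metis
    have on: "onorm (frechet_derivative f (at y)) \<le> (\<Sum>i\<in>Basis. B i)" if "y \<in> cball x u" for y
    proof (rule onorm_le)
      fix v
      interpret l: linear "frechet_derivative f (at y)"
        by (rule has_derivative_linear[OF D]) (use that u in auto)
      have "frechet_derivative f (at y) v = frechet_derivative f (at y) (\<Sum>i\<in>Basis. (v \<bullet> i) *\<^sub>R i)"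
        by (simp add: euclidean_representation)
      also have "norm \<dots> \<le> (\<Sum>i\<in>Basis. norm ((v \<bullet> i) *\<^sub>R frechet_derivative f (at y) i))"
        by (simp only: l.sum l.scaleR norm_sum)
      also have "\<dots> \<le> (\<Sum>i\<in>Basis. B i * norm v)"
      proof (rule sum_mono)
        fix i :: 'a assume i: "i \<in> Basis"
        have "norm ((v \<bullet> i) *\<^sub>R frechet_derivative f (at y) i) = \<bar>v \<bullet> i\<bar> * norm (frechet_derivative f (at y) i)" by simp
        also have "\<dots> \<le> norm v * B i"
          using Basis_le_norm[OF i, of v] B[OF i that] by (intro mult_mono) auto
        finally show "norm ((v \<bullet> i) *\<^sub>R frechet_derivative f (at y) i) \<le> B i * norm v" by (simp only: mult.commute)
      qed
      finally show "norm (frechet_derivative f (at y) v) \<le> (\<Sum>i\<in>Basis. B i) * norm v"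
        by (simp add: sum_distrib_right)
    qed
    have "0 \<le> (\<Sum>i\<in>Basis. B i)" 
    proof (rule sum_nonneg)
      fix i :: 'a assume "i \<in> Basis"
      then have "norm (frechet_derivative f (at x) i) \<le> B i" using B[of i x] u(1) by simp
      then show "0 \<le> B i" using norm_ge_zero order_trans by blast
    qed
    moreover have "norm (f y - f z) \<le> (\<Sum>i\<in>Basis. B i) * norm (y - z)" if "y \<in> cball x u" "z \<in> cball x u" for y z
      by (rule differentiable_bound[OF convex_cball _ on that])
        (rule has_derivative_at_withinI[OF D], use u in blast)
    ultimately have "(\<Sum>i\<in>Basis. B i)-lipschitz_on (cball x u \<inter> U) f"
      by (intro lipschitz_onI) (simp_all add: dist_norm)
    with u show "\<exists>u>0. \<exists>L. \<forall>t\<in>cball t u \<inter> {0}. L-lipschitz_on (cball x u \<inter> U) f" by blast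
  qed
  then have "local_lipschitz {0::real} K (\<lambda>_. f)"
    by (rule local_lipschitz_subset) (use assms in auto)
  then obtain L where "L-lipschitz_on K f"
    by (rule local_lipschitz_compact_implies_lipschitz[OF _ assms(2), of "{0::real}"]) auto
  then show thesis
    by (intro that[of L]) (auto simp: lipschitz_on_def dist_norm)
qed

section \<open>Floquet multipliers\<close>

text \<open>Replacing column \<open>j\<close> of \<open>z - M\<close> by a fixed vector \<open>e\<close> of \<open>M\<close> divides the determinant by \<open>z - 1\<close> (up to the
  factor \<open>e $ j\<close>), so that simplicity of the multiplier \<open>1\<close> becomes an open condition.\<close>

definition bordered_char :: "'n \<Rightarrow> real^'n \<Rightarrow> real^'n^'n \<Rightarrow> complex \<Rightarrow> complex^'n^'n" where
  "bordered_char j e M z =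
     (\<chi> i l. if l = j then complex_of_real (e$i) else (if i = l then z else 0) - complex_of_real (M$i$l))"

lemma poly_det: "poly (det A) z = det (\<chi> i j. poly (A $ i $ j) z)"
  for A :: "complex poly^'n^'n"
  by (simp add: det_def poly_sum poly_prod poly_of_int of_int_poly)

lemma det_of_real: "det (\<chi> i j. complex_of_real (A $ i $ j)) = complex_of_real (det A)"
  for A :: "real^'n^'n"
  by (simp add: det_def)

lemma det_col_mul:
  fixes A :: "'a::comm_ring_1^'n^'n"
  shows "det (\<chi> i l. if l = j then c * b i else A $ i $ l) = c * det (\<chi> i l. if l = j then b i else A $ i $ l)"
proof -
  have *: "transpose (\<chi> i l. if l = j then d i else A $ i $ l) =
      (\<chi> l. if l = j then (\<chi> i. d i) else (\<chi> i. A $ i $ l))" for d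
    by (simp add: transpose_def vec_eq_iff)
  have **: "(\<chi> i. c * b i) = c *s (\<chi> i. b i)" by (simp add: vec_eq_iff)
  have "det (transpose (\<chi> i l. if l = j then c * b i else A $ i $ l)) =
      c * det (transpose (\<chi> i l. if l = j then b i else A $ i $ l))"
    unfolding * ** by (rule det_row_mul)
  then show ?thesis by (simp only: det_transpose)
qed

text \<open>Since M e = e, the matrix z - M maps e to (z - 1) e. Cramer's lemma puts this image into
  column \<open>j\<close>, and the factor z - 1 comes out of the column.\<close>

lemma charpoly_bordered:
  fixes M :: "real^'n^'n"
  assumes "M *v e = e"
  shows "complex_of_real (e$j) * poly (complex_charpoly M) z = (z - 1) * det (bordered_char j e M z)"
proof -
  define A :: "complex^'n^'n" where "A = (\<chi> i l. (if i = l then z else 0) - complex_of_real (M$i$l))"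
  define x :: "complex^'n" where "x = (\<chi> i. complex_of_real (e$i))"
  have p: "poly (complex_charpoly M) z = det A"
    unfolding complex_charpoly_def poly_det A_def
    by (intro arg_cong[where f=det]) (simp add: vec_eq_iff)
  have Ax: "(A *v x) $ i = (z - 1) * complex_of_real (e$i)" for i
  proof -
    have "(A *v x) $ i = (\<Sum>l\<in>UNIV. (if i = l then z else 0) * complex_of_real (e$l)) -
        (\<Sum>l\<in>UNIV. complex_of_real (M$i$l) * complex_of_real (e$l))"
      by (simp add: A_def x_def matrix_vector_mult_def sum_subtractf left_diff_distrib)
    also have "(\<Sum>l\<in>UNIV. (if i = l then z else 0) * complex_of_real (e$l)) = z * complex_of_real (e$i)"
      by (subst sum.remove[of _ i]) auto
    also have "(\<Sum>l\<in>UNIV. complex_of_real (M$i$l) * complex_of_real (e$l)) = complex_of_real ((M *v e) $ i)"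
      by (simp add: matrix_vector_mult_def)
    finally show ?thesis by (simp add: assms left_diff_distrib)
  qed
  have "x$j * det A = det (\<chi> i l. if l = j then (A *v x)$i else A$i$l)"
    by (simp add: cramer_lemma)
  also have "\<dots> = (z - 1) * det (\<chi> i l. if l = j then complex_of_real (e$i) else A$i$l)"
    unfolding Ax by (rule det_col_mul)
  also have "(\<chi> i l. if l = j then complex_of_real (e$i) else A$i$l) = bordered_char j e M z"
    by (simp add: bordered_char_def A_def vec_eq_iff)
  finally show ?thesis by (simp add: p x_def)
qed

text \<open>Up to the nonzero constant \<open>e$j\<close>, the characteristic polynomial is (X - 1)
  Q with Q the bordered determinant. Simplicity of 1 says Q(1) \<noteq> 0, and the condition on the
  other multipliers says that Q has no further root on the unit circle.\<close>

lemma simple_multiplier_iff_bordered: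
  assumes "M *v e = e" "e$j \<noteq> 0"
  shows "order 1 (complex_charpoly M) = 1 \<and>
       (\<forall>\<mu>. poly (complex_charpoly M) \<mu> = 0 \<and> norm \<mu> = 1 \<longrightarrow> \<mu> = 1) \<longleftrightarrow>
     (\<forall>z. norm z = 1 \<longrightarrow> det (bordered_char j e M z) \<noteq> 0)"
proof -
  define Q :: "complex poly" where
    "Q = det (\<chi> i l. if l = j then [:complex_of_real (e$i):]
       else (if i = l then [:0, 1:] else 0) - [:complex_of_real (M$i$l):])"
  have Q: "poly Q z = det (bordered_char j e M z)" for z
    unfolding Q_def poly_det bordered_char_def
    by (intro arg_cong[where f=det]) (simp add: vec_eq_iff)
  define c where "c = complex_of_real (e$j)"
  have c: "c \<noteq> 0" using assms by (simp add: c_def)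
  have eq: "smult c (complex_charpoly M) = [:-1, 1:] * Q"
  proof (rule poly_eq_poly_eq_iff[THEN iffD1], rule ext)
    fix z show "poly (smult c (complex_charpoly M)) z = poly ([:-1, 1:] * Q) z"
      using charpoly_bordered[OF assms(1), of j z] by (simp add: Q c_def algebra_simps)
  qed
  have root: "poly (complex_charpoly M) z = 0 \<longleftrightarrow> z = 1 \<or> poly Q z = 0" for z
    using arg_cong[OF eq, of "\<lambda>p. poly p z"] c by (auto simp: algebra_simps)
  have ord: "order 1 (complex_charpoly M) = 1 + order 1 Q" if "Q \<noteq> 0"
  proof -
    have "order 1 (complex_charpoly M) = order 1 (smult c (complex_charpoly M))"
      using c by (simp add: order_smult)
    also have "\<dots> = order 1 ([:-1, 1:] * Q)" by (simp only: eq)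
    also have "\<dots> = order 1 [:-1, 1::complex:] + order 1 Q"
    proof (rule order_mult)
      show "[:-1, 1:] * Q \<noteq> 0" using that by (simp only: mult_eq_0_iff) simp
    qed
    also have "order 1 [:-1, 1::complex:] = 1"
      using order_power_n_n[of "1::complex" 1] by simp
    finally show ?thesis .
  qed
  show ?thesis
  proof
    assume A: "order 1 (complex_charpoly M) = 1 \<and>
       (\<forall>\<mu>. poly (complex_charpoly M) \<mu> = 0 \<and> norm \<mu> = 1 \<longrightarrow> \<mu> = 1)"
    \<comment> \<open>\<open>order\<close> says nothing useful about a zero polynomial. If Q were 0,
      every number would be a multiplier, in particular -1, which lies on the unit circle.\<close>
    have "Q \<noteq> 0"
    proof
      assume "Q = 0"
      then have "poly (complex_charpoly M) (-1) = 0" using root by simp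
      with A have "(-1::complex) = 1" by (metis norm_minus_cancel norm_one)
      then show False by simp
    qed
    then have "order 1 Q = 0" using A ord by simp
    then have "poly Q 1 \<noteq> 0" using \<open>Q \<noteq> 0\<close> by (simp add: order_root)
    then show "\<forall>z. norm z = 1 \<longrightarrow> det (bordered_char j e M z) \<noteq> 0"
      using A root unfolding Q[symmetric] by metis
  next
    assume A: "\<forall>z. norm z = 1 \<longrightarrow> det (bordered_char j e M z) \<noteq> 0"
    then have 1: "poly Q 1 \<noteq> 0" by (simp add: Q)
    then have "Q \<noteq> 0" by auto
    with 1 show "order 1 (complex_charpoly M) = 1 \<and>
       (\<forall>\<mu>. poly (complex_charpoly M) \<mu> = 0 \<and> norm \<mu> = 1 \<longrightarrow> \<mu> = 1)"
      using ord root A unfolding Q[symmetric] by (auto simp: order_0I)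
  qed
qed

text \<open>The border turns the singular system for 1 - M into a regular one: entry
  \<open>j\<close> of the unknown serves as the coefficient of \<open>e\<close>, while the vector
  fed to 1 - M has component \<open>j\<close> equal to 0. That normalization fixes the phase along
  the orbit, and the coefficient will be the correction of the period.\<close>

lemma bordered_solve:
  assumes "det (bordered_char j e M 1) \<noteq> 0"
  obtains B :: "real^'n^'n" where
    "\<And>b. (mat 1 - M) *v (\<chi> i. if i = j then 0 else (B *v b)$i) + (B *v b)$j *\<^sub>R e = b"
proof -
  define A :: "real^'n^'n" where "A = (\<chi> i l. if l = j then e$i else (mat 1 - M)$i$l)"
  have "bordered_char j e M 1 = (\<chi> i l. complex_of_real (A $ i $ l))"
    by (simp add: A_def bordered_char_def vec_eq_iff mat_def)
  with assms have "det A \<noteq> 0" by (simp add: det_of_real)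
  then obtain B where B: "A ** B = mat 1"
    using invertible_det_nz unfolding invertible_def by blast
  have "(mat 1 - M) *v (\<chi> i. if i = j then 0 else x$i) + x$j *\<^sub>R e = A *v x" for x :: "real^'n"
  proof -
    have "((mat 1 - M) *v (\<chi> i. if i = j then 0 else x$i) + x$j *\<^sub>R e)$k = (A *v x)$k" for k
    proof -
      have "(A *v x)$k = A$k$j * x$j + (\<Sum>l\<in>UNIV-{j}. A$k$l * x$l)"
        by (simp add: matrix_vector_mult_def sum.remove[of _ j])
      moreover have "((mat 1 - M) *v (\<chi> i. if i = j then 0 else x$i))$k = (\<Sum>l\<in>UNIV-{j}. A$k$l * x$l)"
        by (simp add: matrix_vector_mult_def sum.remove[of _ j] A_def)
      ultimately show ?thesis by (simp add: A_def)
    qed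
    then show ?thesis by (simp add: vec_eq_iff)
  qed
  then have "(mat 1 - M) *v (\<chi> i. if i = j then 0 else (B *v b)$i) + (B *v b)$j *\<^sub>R e = b" for b
    by (simp add: matrix_vector_mul_assoc B)
  then show thesis using that by blast
qed

lemma continuous_on_det:
  fixes A :: "'a::topological_space \<Rightarrow> 'b::{real_normed_algebra_1,comm_ring_1}^'n^'n"
  assumes "\<And>i j. continuous_on S (\<lambda>x. A x $ i $ j)"
  shows "continuous_on S (\<lambda>x. det (A x))"
  unfolding det_def by (intro continuous_intros assms)

section \<open>Families of closed curves\<close>

text \<open>Indexes a sequence by \<open>1, 1/2, 1/3, \<dots>\<close> and its limit by \<open>0\<close>.\<close>

definition harmonic_set :: "real set" where
  "harmonic_set = insert 0 (range (\<lambda>n. inverse (real (Suc n))))"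

lemma harmonic_set_nonneg: "c \<in> harmonic_set \<Longrightarrow> 0 \<le> c"
  by (auto simp: harmonic_set_def)

lemma zero_in_harmonic_set [simp]: "0 \<in> harmonic_set"
  by (simp add: harmonic_set_def)

text \<open>Isolation of the nonzero parameters is the reason for this index set: joint continuity
  of a family is then a condition at the limit parameter alone.\<close>

lemma harmonic_set_isolated:
  assumes "c \<in> harmonic_set" "c \<noteq> 0"
  obtains d where "d > 0" "\<And>c'. c' \<in> harmonic_set \<Longrightarrow> dist c' c < d \<Longrightarrow> c' = c"
proof -
  obtain n where n: "c = inverse (real (Suc n))" using assms by (auto simp: harmonic_set_def)
  \<comment> \<open>The gap below \<open>c\<close>, which is smaller than both the gap above it and
    the distance to 0.\<close>
  define d where "d = inverse (real (Suc n)) - inverse (real (Suc (Suc n)))"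
  have d: "d > 0" by (simp add: d_def)
  have "c' = c" if c': "c' \<in> harmonic_set" and dist: "dist c' c < d" for c'
  proof (rule ccontr)
    assume ne: "c' \<noteq> c"
    show False
    proof (cases "c' = 0")
      case True
      have "d \<le> c" by (simp add: d_def n)
      moreover have "dist c' c = c" using True by (simp add: n dist_real_def)
      ultimately show False using dist by simp
    next
      case False
      then obtain m where m: "c' = inverse (real (Suc m))" using c' by (auto simp: harmonic_set_def)
      show False
      proof (cases "m < n")
        case True
        have "inverse (real (Suc m)) \<ge> inverse (real n)" using True by (simp add: le_imp_inverse_le)
        moreover have "inverse (real n) - inverse (real (Suc n)) \<ge> d"
        proof -
          have "inverse (real n) - inverse (real (Suc n)) = 1 / (real n * (real n + 1))"
            using True by (simp add: field_simps)
          moreover have "d = 1 / ((real n + 1) * (real n + 2))" by (simp add: d_def field_simps)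
          moreover have "1 / ((real n + 1) * (real n + 2)) \<le> 1 / (real n * (real n + 1))"
            using True by (intro frac_le mult_pos_pos) (auto simp: algebra_simps)
          ultimately show ?thesis by simp
        qed
        ultimately show False using dist by (simp add: m n dist_real_def)
      next
        case F: False
        with ne m n have "m \<ge> Suc n" by (metis le_less_Suc_eq not_less)
        then have "inverse (real (Suc m)) \<le> inverse (real (Suc (Suc n)))" by (simp add: le_imp_inverse_le)
        then show False using dist by (simp add: m n dist_real_def d_def)
      qed
    qed
  qed
  with d that show thesis by blast
qed

text \<open>At an isolated parameter only continuity in the point matters; at 0 the hypothesis
  \<open>lim\<close> is what remains to be checked. Objects chosen separately for each parameter,
  such as the persisting orbits, become jointly continuous families through this criterion.\<close>

lemma continuous_on_harmonic_family:
  fixes h :: "real \<Rightarrow> 'a::metric_space \<Rightarrow> 'b::metric_space"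
  assumes C: "C \<subseteq> harmonic_set" and cont: "\<And>c. c \<in> C \<Longrightarrow> continuous_on U (h c)"
    and lim: "\<And>x e. x \<in> U \<Longrightarrow> e > 0 \<Longrightarrow>
       \<exists>d>0. \<forall>c\<in>C. \<forall>y\<in>U. c \<noteq> 0 \<longrightarrow> c < d \<longrightarrow> dist y x < d \<longrightarrow> dist (h c y) (h 0 x) < e"
  shows "continuous_on (C \<times> U) (\<lambda>z. h (fst z) (snd z))"
  unfolding continuous_on_iff
proof (intro ballI allI impI)
  fix z and e :: real assume z: "z \<in> C \<times> U" and e: "e > 0"
  obtain c x where cx: "z = (c, x)" "c \<in> C" "x \<in> U" using z by auto
  obtain d1 where d1: "d1 > 0" "\<And>y. y \<in> U \<Longrightarrow> dist y x < d1 \<Longrightarrow> dist (h c y) (h c x) < e"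
    using cont[OF cx(2)] cx(3) e unfolding continuous_on_iff by metis
  show "\<exists>d>0. \<forall>z'\<in>C \<times> U. dist z' z < d \<longrightarrow> dist (h (fst z') (snd z')) (h (fst z) (snd z)) < e"
  proof (cases "c = 0")
    case True
    obtain d2 where d2: "d2 > 0" "\<forall>c\<in>C. \<forall>y\<in>U. c \<noteq> 0 \<longrightarrow> c < d2 \<longrightarrow> dist y x < d2 \<longrightarrow> dist (h c y) (h 0 x) < e"
      using lim[OF cx(3) e] by blast
    have "dist (h (fst z') (snd z')) (h (fst z) (snd z)) < e"
      if z': "z' \<in> C \<times> U" "dist z' z < min d1 d2" for z'
    proof -
      have "dist (fst z') c < d2" "dist (snd z') x < d2" "dist (snd z') x < d1"
        using z'(2) dist_fst_le[of z' z] dist_snd_le[of z' z] cx by auto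
      then show ?thesis using d1 d2 z' True cx by (cases "fst z' = 0") (auto simp: dist_real_def)
    qed
    then show ?thesis using d1(1) d2(1) by (intro exI[of _ "min d1 d2"]) auto
  next
    case False
    obtain d2 where d2: "d2 > 0" "\<And>c'. c' \<in> harmonic_set \<Longrightarrow> dist c' c < d2 \<Longrightarrow> c' = c"
      using harmonic_set_isolated[of c] C cx False by (metis subsetD)
    have "dist (h (fst z') (snd z')) (h (fst z) (snd z)) < e"
      if z': "z' \<in> C \<times> U" "dist z' z < min d1 d2" for z'
    proof -
      have "dist (fst z') c < d2" "dist (snd z') x < d1"
        using z'(2) dist_fst_le[of z' z] dist_snd_le[of z' z] cx by auto
      moreover from this have "fst z' = c" using d2 z' C by auto
      ultimately show ?thesis using d1 z' cx by auto
    qed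
    then show ?thesis using d1(1) d2(1) by (intro exI[of _ "min d1 d2"]) auto
  qed
qed

section \<open>Uniform closeness over compact sets and stability of injective immersions\<close>

text \<open>The tube lemma: joint continuity over a compact factor is uniform in that factor.
  Membership in \<open>C\<close> is an implication inside the filter \<open>nhds c0\<close>, so that
  several such facts combine by \<open>eventually_elim\<close>.\<close>

lemma family_eventually_close:
  fixes F :: "'c::topological_space \<Rightarrow> 'a::topological_space \<Rightarrow> 'b::metric_space"
  assumes "continuous_on (C \<times> K) (\<lambda>z. F (fst z) (snd z))" "compact K" "c0 \<in> C" "e > 0"
  shows "\<forall>\<^sub>F c in nhds c0. c \<in> C \<longrightarrow> (\<forall>x\<in>K. dist (F c x) (F c0 x) < e)"
proof -
  obtain X where X: "c0 \<in> X" "open X"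
    "\<forall>c\<in>X \<inter> C. \<forall>t\<in>K. dist (F (fst (c, t)) (snd (c, t))) (F (fst (c0, t)) (snd (c0, t))) \<le> e/2"
    by (rule continuous_on_prod_compactE[OF assms(1,2,3), of "e/2"]) (use assms(4) in auto)
  have "dist (F c t) (F c0 t) < e" if "c \<in> X" "c \<in> C" "t \<in> K" for c t
  proof -
    have "dist (F c t) (F c0 t) \<le> e/2" using X(3) that by auto
    then show ?thesis using \<open>e > 0\<close> by simp
  qed
  then show ?thesis unfolding eventually_nhds using X by blast
qed

lemma compact_norm_lower_bound:
  fixes g :: "'a::topological_space \<Rightarrow> 'b::real_normed_vector"
  assumes "compact K" "continuous_on K g" "\<And>x. x \<in> K \<Longrightarrow> g x \<noteq> 0"
  obtains m where "m > 0" "\<And>x. x \<in> K \<Longrightarrow> m \<le> norm (g x)"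
proof (cases "K = {}")
  case True then show thesis using that[of 1] by auto
next
  case False
  obtain x where x: "x \<in> K" "\<forall>y\<in>K. norm (g x) \<le> norm (g y)"
    using continuous_attains_inf[OF assms(1) False continuous_on_norm[OF assms(2)]] by blast
  then show thesis using that[of "norm (g x)"] assms(3) by auto
qed

text \<open>Over a short time the velocity of a nearby curve stays in the open half-space around
  \<open>F' s\<close>, so the projection of the curve to \<open>F' s\<close> strictly increases.
  Both constants depend on \<open>F'\<close> only. The interval \<open>{-1..2}\<close> exceeds one
  period, so that times close to each other across the endpoint can be compared after a shift by
  1.\<close>

lemma locally_injective_perturbation:
  fixes F' :: "real \<Rightarrow> 'b::real_inner"
  assumes c2: "continuous_on {-1..2} F'" and nz: "\<And>s. s \<in> {-1..2} \<Longrightarrow> F' s \<noteq> 0"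
  obtains \<delta> \<epsilon> where "\<delta> > 0" "\<epsilon> > 0"
    "\<And>G G'. (\<And>s. (G has_vector_derivative G' s) (at s)) \<Longrightarrow> (\<And>s. s \<in> {-1..2} \<Longrightarrow> dist (G' s) (F' s) < \<epsilon>) \<Longrightarrow>
      (\<forall>s\<in>{-1..2}. G' s \<noteq> 0) \<and> (\<forall>s\<in>{-1..2}. \<forall>t\<in>{-1..2}. s < t \<and> t - s < \<delta> \<longrightarrow> G s \<noteq> G t)"
proof -
  let ?I = "{-1..2::real}"
  obtain m where m: "m > 0" "\<And>s. s \<in> ?I \<Longrightarrow> m \<le> norm (F' s)"
    using compact_norm_lower_bound[OF _ c2] nz by auto
  have "uniformly_continuous_on ?I F'" by (rule compact_uniformly_continuous[OF c2]) simp
  then obtain \<delta> where \<delta>: "\<delta> > 0"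
    "\<And>s t. s \<in> ?I \<Longrightarrow> t \<in> ?I \<Longrightarrow> dist t s < \<delta> \<Longrightarrow> dist (F' t) (F' s) < m/4"
    unfolding uniformly_continuous_on_def using m(1) by (metis divide_pos_pos zero_less_numeral)
  have "(\<forall>s\<in>?I. G' s \<noteq> 0) \<and> (\<forall>s\<in>?I. \<forall>t\<in>?I. s < t \<and> t - s < \<delta> \<longrightarrow> G s \<noteq> G t)"
    if d: "\<And>s. (G has_vector_derivative G' s) (at s)" and close: "\<And>s. s \<in> ?I \<Longrightarrow> dist (G' s) (F' s) < m/4" for G G'
  proof -
    \<comment> \<open>The two deviations of m/4 add up to m/2, less than |F' s|, which keeps the
      angle between the two vectors acute.\<close>
    have pos: "G' r \<bullet> F' s > 0" if "s \<in> ?I" "r \<in> ?I" "dist r s < \<delta>" for r s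
    proof -
      define v where "v = F' s"
      have "dist (G' r) v < m/2"
        using close[OF that(2)] \<delta>(2)[OF that] dist_triangle[of "G' r" v "F' r"]
        unfolding v_def by linarith
      then have "norm (v - G' r) < m/2" by (simp add: dist_norm norm_minus_commute)
      moreover have "m \<le> norm v" using m(2) that by (simp add: v_def)
      ultimately have *: "norm (v - G' r) < norm v" using m(1) by linarith
      have "(v - G' r) \<bullet> v \<le> norm (v - G' r) * norm v" by (rule norm_cauchy_schwarz)
      also have "\<dots> < norm v * norm v" using * by (intro mult_strict_right_mono) (auto intro: le_less_trans[OF norm_ge_zero])
      also have "\<dots> = v \<bullet> v" by (simp add: power2_norm_eq_inner[symmetric] power2_eq_square)
      finally show ?thesis by (simp add: inner_diff_left v_def)
    qed
    show ?thesis
    proof (intro impI conjI ballI)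
      fix s assume "s \<in> ?I"
      then show "G' s \<noteq> 0" using pos[of s s] \<delta>(1) by auto
    next
      fix s t assume st: "s \<in> ?I" "t \<in> ?I" "s < t \<and> t - s < \<delta>"
      have "G s \<bullet> F' s < G t \<bullet> F' s"
      proof (rule DERIV_pos_imp_increasing[where f="\<lambda>r. G r \<bullet> F' s"])
        fix r assume r: "s \<le> r" "r \<le> t"
        have "((\<lambda>r. G r \<bullet> F' s) has_real_derivative G' r \<bullet> F' s) (at r)"
          unfolding has_real_derivative_iff_has_vector_derivative
          by (rule bounded_linear.has_vector_derivative[OF bounded_linear_inner_left d])
        moreover have "G' r \<bullet> F' s > 0" by (rule pos) (use r st in \<open>auto simp: dist_real_def\<close>)
        ultimately show "\<exists>y. ((\<lambda>r. G r \<bullet> F' s) has_real_derivative y) (at r) \<and> 0 < y" by blast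
      qed (use st in auto)
      then show "G s \<noteq> G t" by auto
    qed
  qed
  moreover have "m / 4 > 0" using m(1) by simp
  ultimately show thesis using that[of \<delta> "m/4"] \<delta>(1) by blast
qed

lemma locally_injective_family:
  fixes F F' :: "'c::topological_space \<Rightarrow> real \<Rightarrow> 'b::real_inner"
  assumes d: "\<And>c s. c \<in> C \<Longrightarrow> (F c has_vector_derivative F' c s) (at s)"
    and cont: "continuous_on (C \<times> UNIV) (\<lambda>z. F' (fst z) (snd z))"
    and "c0 \<in> C" and nz: "\<And>s. F' c0 s \<noteq> 0"
  obtains \<delta> where "\<delta> > 0"
    "\<forall>\<^sub>F c in nhds c0. c \<in> C \<longrightarrow> (\<forall>s\<in>{-1..2}. F' c s \<noteq> 0) \<and>
        (\<forall>s\<in>{-1..2}. \<forall>t\<in>{-1..2}. s < t \<and> t - s < \<delta> \<longrightarrow> F c s \<noteq> F c t)"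
proof -
  have c1: "continuous_on (C \<times> {-1..2}) (\<lambda>z. F' (fst z) (snd z))"
    by (rule continuous_on_subset[OF cont]) auto
  have "continuous_on {-1..2} (\<lambda>s. (\<lambda>z. F' (fst z) (snd z)) (c0, s))"
    by (rule continuous_on_compose2[OF c1]) (use assms in \<open>auto intro!: continuous_intros\<close>)
  then have c2: "continuous_on {-1..2} (F' c0)" by simp
  obtain \<delta> \<epsilon> where \<delta>: "\<delta> > 0" "\<epsilon> > 0"
    "\<And>G G'. (\<And>s. (G has_vector_derivative G' s) (at s)) \<Longrightarrow> (\<And>s. s \<in> {-1..2} \<Longrightarrow> dist (G' s) (F' c0 s) < \<epsilon>) \<Longrightarrow>
      (\<forall>s\<in>{-1..2}. G' s \<noteq> 0) \<and> (\<forall>s\<in>{-1..2}. \<forall>t\<in>{-1..2}. s < t \<and> t - s < \<delta> \<longrightarrow> G s \<noteq> G t)"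
    by (rule locally_injective_perturbation[OF c2 nz]) (rule that; blast)
  have "\<forall>\<^sub>F c in nhds c0. c \<in> C \<longrightarrow> (\<forall>s\<in>{-1..2}. dist (F' c s) (F' c0 s) < \<epsilon>)"
    by (rule family_eventually_close[OF c1]) (use assms \<delta> in auto)
  then have "\<forall>\<^sub>F c in nhds c0. c \<in> C \<longrightarrow> (\<forall>s\<in>{-1..2}. F' c s \<noteq> 0) \<and>
        (\<forall>s\<in>{-1..2}. \<forall>t\<in>{-1..2}. s < t \<and> t - s < \<delta> \<longrightarrow> F c s \<noteq> F c t)"
  proof eventually_elim
    case (elim c)
    show ?case
    proof
      assume c: "c \<in> C"
      show "(\<forall>s\<in>{-1..2}. F' c s \<noteq> 0) \<and> (\<forall>s\<in>{-1..2}. \<forall>t\<in>{-1..2}. s < t \<and> t - s < \<delta> \<longrightarrow> F c s \<noteq> F c t)"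
        by (rule \<delta>(3)[OF d[OF c]]) (use elim c in blast)
    qed
  qed
  with \<delta>(1) that show thesis by blast
qed

lemma periodic_eq_at_int:
  fixes F :: "real \<Rightarrow> 'a"
  assumes "\<And>s. F (s + 1) = F s" shows "F (s + of_int n) = F s"
proof -
  have nat: "F (s + real k) = F s" for s k
    by (induction k) (use assms in \<open>auto simp: algebra_simps\<close>, metis add.assoc add.commute)
  show ?thesis
  proof (cases "n \<ge> 0")
    case True then show ?thesis using nat[of s "nat n"] by simp
  next
    case False then show ?thesis using nat[of "s + of_int n" "nat (-n)"] by simp
  qed
qed

lemma periodic_eq_frac:
  fixes F :: "real \<Rightarrow> 'a"
  assumes "\<And>s. F (s + 1) = F s" shows "F (frac s) = F s"
  using periodic_eq_at_int[of F "frac s" "floor s", OF assms] by (simp add: frac_def)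

text \<open>Pairs of times fall into three classes: closer than \<delta>, closer than \<delta>
  across the endpoint, and the rest. The first two are settled by local injectivity; on the compact
  rest the limit curve separates the points by some m, which a perturbation below m/3 cannot
  undo.\<close>

lemma injective_immersion_family:
  fixes F F' :: "'c::topological_space \<Rightarrow> real \<Rightarrow> 'b::real_inner"
  assumes d: "\<And>c s. c \<in> C \<Longrightarrow> (F c has_vector_derivative F' c s) (at s)"
    and cF: "continuous_on (C \<times> UNIV) (\<lambda>z. F (fst z) (snd z))"
    and cont: "continuous_on (C \<times> UNIV) (\<lambda>z. F' (fst z) (snd z))"
    and per: "\<And>c s. c \<in> C \<Longrightarrow> F c (s + 1) = F c s" "\<And>c s. c \<in> C \<Longrightarrow> F' c (s + 1) = F' c s"
    and "c0 \<in> C" and nz: "\<And>s. F' c0 s \<noteq> 0" and inj: "inj_on (F c0) {0..<1}"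
  shows "\<forall>\<^sub>F c in nhds c0. c \<in> C \<longrightarrow> inj_on (F c) {0..<1} \<and> (\<forall>s. F' c s \<noteq> 0)"
proof -
  obtain \<delta> where \<delta>: "\<delta> > 0"
    "\<forall>\<^sub>F c in nhds c0. c \<in> C \<longrightarrow> (\<forall>s\<in>{-1..2}. F' c s \<noteq> 0) \<and>
        (\<forall>s\<in>{-1..2}. \<forall>t\<in>{-1..2}. s < t \<and> t - s < \<delta> \<longrightarrow> F c s \<noteq> F c t)"
    using locally_injective_family[OF d cont \<open>c0 \<in> C\<close> nz] by blast
  define K where "K = {z::real \<times> real. z \<in> {0..1} \<times> {0..1} \<and> \<delta> \<le> snd z - fst z \<and> snd z - fst z \<le> 1 - \<delta>}"
  have K: "compact K"
  proof -
    have "K = ({0..1} \<times> {0..1}) \<inter> {z. \<delta> \<le> snd z - fst z} \<inter> {z. snd z - fst z \<le> 1 - \<delta>}"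
      by (auto simp: K_def)
    moreover have "closed {z::real\<times>real. \<delta> \<le> snd z - fst z}" "closed {z::real\<times>real. snd z - fst z \<le> 1 - \<delta>}"
      by (intro closed_Collect_le continuous_intros)+
    ultimately show ?thesis by (simp add: compact_Int_closed compact_Times)
  qed
  have cc: "continuous_on (C \<times> {0..1}) (\<lambda>z. F (fst z) (snd z))"
    by (rule continuous_on_subset[OF cF]) auto
  have c0': "continuous_on UNIV (F c0)"
    by (rule has_vector_derivative_imp_continuous_on[OF d[OF \<open>c0 \<in> C\<close>]])
  have "F c0 (snd z) - F c0 (fst z) \<noteq> 0" if "z \<in> K" for z
  proof
    assume "F c0 (snd z) - F c0 (fst z) = 0"
    then have eq: "F c0 (snd z) = F c0 (fst z)" by simp
    have z: "0 \<le> fst z" "fst z < snd z" "snd z \<le> 1" "snd z - fst z < 1"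
      using that \<delta>(1) by (auto simp: K_def)
    show False
    proof (cases "snd z = 1")
      case True
      then have "F c0 0 = F c0 (fst z)" using eq per(1)[OF \<open>c0 \<in> C\<close>, of 0] by simp
      then show False using inj_onD[OF inj, of 0 "fst z"] z True by auto
    next
      case False then show False using inj_onD[OF inj eq] z by auto
    qed
  qed
  moreover have "continuous_on K (\<lambda>z. F c0 (snd z) - F c0 (fst z))"
    by (intro continuous_on_diff continuous_on_compose2[OF c0'] continuous_intros) auto
  ultimately obtain m where m: "m > 0" "\<And>z. z \<in> K \<Longrightarrow> m \<le> norm (F c0 (snd z) - F c0 (fst z))"
    using compact_norm_lower_bound[OF K, of "\<lambda>z. F c0 (snd z) - F c0 (fst z)"] by blast
  have ev: "\<forall>\<^sub>F c in nhds c0. c \<in> C \<longrightarrow> (\<forall>s\<in>{0..1}. dist (F c s) (F c0 s) < m/3)"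
    by (rule family_eventually_close[OF cc]) (use m \<open>c0 \<in> C\<close> in auto)
  from ev \<delta>(2) show ?thesis
  proof eventually_elim
    case (elim c)
    show ?case
    proof (intro impI conjI)
      assume c: "c \<in> C"
      have ne: "F c s \<noteq> F c t" if st: "0 \<le> s" "s < t" "t < 1" for s t
      proof (cases "t - s < \<delta>")
        case True then show ?thesis using elim(2) c st by auto
      next
        case A: False
        show ?thesis
        proof (cases "t - s \<le> 1 - \<delta>")
          case True
          have "(s, t) \<in> K" using st A True by (auto simp: K_def)
          from m(2)[OF this] have "m \<le> dist (F c0 t) (F c0 s)" by (simp add: dist_norm)
          moreover have "dist (F c t) (F c0 t) < m/3" "dist (F c s) (F c0 s) < m/3"
            using elim(1) c st by auto
          moreover have "dist (F c0 t) (F c0 s) \<le> dist (F c t) (F c0 t) + dist (F c s) (F c0 s)" if "F c s = F c t"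
            using dist_triangle3[of "F c0 t" "F c0 s" "F c t"] that by (simp add: dist_commute)
          ultimately show ?thesis using m(1) by force
        next
          case False
          have "F c (t - 1) \<noteq> F c s" using elim(2) c st False by auto
          then show ?thesis using per(1)[OF c, of "t - 1"] by auto
        qed
      qed
      show "inj_on (F c) {0..<1}"
        by (rule linorder_inj_onI) (use ne in auto)
      show "\<forall>s. F' c s \<noteq> 0"
      proof
        fix s
        have "frac s \<in> {-1..2::real}" using frac_lt_1[of s] frac_ge_0[of s] by (simp del: frac_ge_0)
        then have "F' c (frac s) \<noteq> 0" using elim(2) c by blast
        then show "F' c s \<noteq> 0" using periodic_eq_frac[of "F' c", OF per(2)[OF c]] by simp
      qed
    qed
  qed
qed

section \<open>The circle as a compact quotient\<close>

lemma rmod_eq_frac: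
  assumes "T > 0" shows "t rmod T = T * frac (t / T)"
  using assms by (simp add: rmod_def frac_def algebra_simps)

text \<open>A continuous injection of a compact space into a Hausdorff space is an embedding. The
  circle is compact as the image of \<open>{0..T}\<close> under reduction modulo
  \<open>T\<close>.\<close>

lemma circle_embedding_iff:
  fixes F :: "real \<Rightarrow> 'a::real_normed_vector"
  assumes T: "T > 0"
  shows "circle_embedding T F \<longleftrightarrow> (\<forall>t. F (t + T) = F t) \<and>
     (\<forall>t. \<exists>D. D \<noteq> 0 \<and> (F has_vector_derivative D) (at t)) \<and> inj_on F {0..<T}"
proof -
  have "embedding_map (circle_topology T) euclidean F \<longleftrightarrow> inj_on F {0..<T}"
    if per: "\<forall>t. F (t + T) = F t" and d: "\<forall>t. \<exists>D. D \<noteq> 0 \<and> (F has_vector_derivative D) (at t)"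
  proof
    assume "embedding_map (circle_topology T) euclidean F"
    then show "inj_on F {0..<T}"
      by (simp add: embedding_map_def homeomorphic_map_def topspace_circle_topology[OF T])
  next
    assume inj: "inj_on F {0..<T}"
    have cF: "continuous_on UNIV F"
      using d has_vector_derivative_continuous by (blast intro: continuous_at_imp_continuous_on)
    have Frmod: "F (t rmod T) = F t" for t
    proof -
      have "(\<lambda>s. F (T * s)) (frac (t / T)) = (\<lambda>s. F (T * s)) (t / T)"
        by (rule periodic_eq_frac[of "\<lambda>s. F (T * s)"]) (use per in \<open>simp add: distrib_left\<close>)
      then show ?thesis using T by (simp add: rmod_eq_frac)
    qed
    have range: "t rmod T \<in> {0..<T}" for t
      using T by (auto simp: rmod_nonneg rmod_less)
    have "continuous_map (circle_topology T) euclidean F"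
      unfolding continuous_map_def
    proof (intro conjI allI impI)
      fix W :: "'a set" assume "openin euclidean W"
      then have "open W" by simp
      have "{t. t rmod T \<in> {x \<in> topspace (circle_topology T). F x \<in> W}} = F -` W"
        using range by (auto simp: topspace_circle_topology[OF T] Frmod)
      moreover have "open (F -` W)"
        using cF \<open>open W\<close> by (simp add: continuous_on_open_vimage)
      ultimately show "openin (circle_topology T) {x \<in> topspace (circle_topology T). F x \<in> W}"
        by (auto simp: openin_circle_topology topspace_circle_topology[OF T])
    qed auto
    moreover have "compact_space (circle_topology T)"
    proof -
      have "continuous_map (top_of_set {0..T}) (circle_topology T) (\<lambda>t. t rmod T)"
        unfolding continuous_map_def
      proof (intro conjI allI impI)
        fix V assume "openin (circle_topology T) V"
        then have "open {t. t rmod T \<in> V}" by (simp add: openin_circle_topology)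
        then have "openin (top_of_set {0..T}) ({0..T} \<inter> {t. t rmod T \<in> V})" by (rule openin_open_Int)
        moreover have "{0..T} \<inter> {t. t rmod T \<in> V} = {x \<in> topspace (top_of_set {0..T}). x rmod T \<in> V}" by auto
        ultimately show "openin (top_of_set {0..T}) {x \<in> topspace (top_of_set {0..T}). x rmod T \<in> V}" by simp
      qed (use range in \<open>auto simp: topspace_circle_topology[OF T]\<close>)
      moreover have "compactin (top_of_set {0..T}) {0..T}" by (simp add: compactin_subtopology)
      ultimately have "compactin (circle_topology T) ((\<lambda>t. t rmod T) ` {0..T})" by (rule image_compactin[rotated])
      moreover have "(\<lambda>t. t rmod T) ` {0..T} = {0..<T}"
      proof
        show "{0..<T} \<subseteq> (\<lambda>t. t rmod T) ` {0..T}"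
        proof
          fix t assume t: "t \<in> {0..<T}"
          then have "frac (t / T) = t / T" using T by (simp add: frac_eq)
          then have "t rmod T = t" using T by (simp add: rmod_eq_frac)
          then show "t \<in> (\<lambda>t. t rmod T) ` {0..T}" using t by (intro image_eqI[of _ _ t]) auto
        qed
      qed (use range in auto)
      ultimately show ?thesis by (simp add: compact_space_def topspace_circle_topology[OF T])
    qed
    ultimately show "embedding_map (circle_topology T) euclidean F"
      using inj by (intro continuous_imp_embedding_map) (auto simp: topspace_circle_topology[OF T])
  qed
  then show ?thesis unfolding circle_embedding_def by blast
qed

section \<open>Hyperbolic periodic solutions in rescaled time\<close>

lemma bounded_bilinear_matrix_mult:
  "bounded_bilinear ((**) :: real^'n^'m \<Rightarrow> real^'p^'n \<Rightarrow> real^'p^'m)"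
  unfolding bilinear_conv_bounded_bilinear[symmetric] bilinear_def
  by (auto intro!: linearI simp: vec_eq_iff matrix_matrix_mult_def sum.distrib
      sum_distrib_left algebra_simps)

lemma bounded_bilinear_matrix_vector_mult:
  "bounded_bilinear ((*v) :: real^'n^'m \<Rightarrow> real^'n \<Rightarrow> real^'m)"
  unfolding bilinear_conv_bounded_bilinear[symmetric] bilinear_def
  by (auto intro!: linearI simp: vec_eq_iff matrix_vector_mult_def sum.distrib
      sum_distrib_left algebra_simps)

lemmas continuous_on_matrix_mult = bounded_bilinear.continuous_on[OF bounded_bilinear_matrix_mult]
lemmas continuous_on_matrix_vector_mult = bounded_bilinear.continuous_on[OF bounded_bilinear_matrix_vector_mult]

lemma norm_matrix_mult_bound:
  obtains K where "K > 0" "\<And>A B. norm ((A::real^'n^'m) ** (B::real^'p^'n)) \<le> norm A * norm B * K"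
  using bounded_bilinear.pos_bounded[OF bounded_bilinear_matrix_mult] by blast

lemma norm_matrix_vector_mult_bound:
  obtains K where "K > 0" "\<And>A x. norm ((A::real^'n^'m) *v x) \<le> norm A * norm x * K"
  using bounded_bilinear.pos_bounded[OF bounded_bilinear_matrix_vector_mult] by blast

lemma continuous_on_jacobian_family:
  fixes g :: "'c::topological_space \<Rightarrow> real^'n \<Rightarrow> real^'m"
  assumes "Ck_family (Suc 0) C W g"
  shows "continuous_on (C \<times> W) (\<lambda>z. jacobian (g (fst z)) (at (snd z)))"
proof -
  have "continuous_on (C \<times> W) (\<lambda>z. frechet_derivative (g (fst z)) (at (snd z)) (axis j 1))" for j
    using assms by (simp add: axis_in_Basis_iff)
  then show ?thesis
    unfolding jacobian_def matrix_def by (intro continuous_on_vec_lambda continuous_on_component)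
qed

lemma has_derivative_jacobian:
  fixes g :: "'c::topological_space \<Rightarrow> real^'n \<Rightarrow> real^'m"
  assumes "Ck_family (Suc m) C W g" "c \<in> C" "x \<in> W"
  shows "(g c has_derivative (\<lambda>v. jacobian (g c) (at x) *v v)) (at x)"
  using jacobian_works[of "g c" "at x"] assms by simp

lemma periodic_continuous_bounded:
  fixes A :: "real \<Rightarrow> 'a::real_normed_vector"
  assumes "continuous_on UNIV A" "\<And>s. A (s + 1) = A s"
  obtains b where "b > 0" "\<And>s. norm (A s) \<le> b"
proof -
  obtain b where b: "b > 0" "\<And>s. s \<in> {0..1} \<Longrightarrow> norm (A s) \<le> b"
    using continuous_on_bounded_interval[OF continuous_on_subset[OF assms(1) subset_UNIV]] by blast
  have "norm (A s) \<le> b" for s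
    using b(2)[of "frac s"] periodic_eq_frac[of A, OF assms(2)] frac_lt_1[of s] by auto
  with b(1) that show thesis by blast
qed

lemma fundamental_matrix_exists:
  fixes A :: "real \<Rightarrow> real^'n^'n"
  assumes "continuous_on UNIV A" "\<And>s. norm (A s) \<le> b"
  obtains \<Phi> where "\<Phi> 0 = mat 1" "\<And>s. (\<Phi> has_vector_derivative A s ** \<Phi> s) (at s)"
proof -
  obtain K where K: "K > 0" "\<And>A B. norm ((A::real^'n^'n) ** (B::real^'n^'n)) \<le> norm A * norm B * K"
    using norm_matrix_mult_bound by blast
  have b: "b \<ge> 0" using assms(2)[of 0] norm_ge_zero order_trans by blast
  have bd: "norm (A s ** X) \<le> (b * K) * norm X" for s and X :: "real^'n^'n"
  proof -
    have "norm (A s ** X) \<le> norm (A s) * norm X * K" by (rule K(2))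
    also have "\<dots> \<le> b * norm X * K" using assms(2)[of s] K(1) by (intro mult_right_mono) auto
    finally show ?thesis by (simp add: ac_simps)
  qed
  have cont: "continuous_on UNIV (\<lambda>z. A (fst z) ** snd z)"
    by (intro continuous_on_matrix_mult continuous_on_compose2[OF assms(1)] continuous_intros) auto
  have lin: "linear ((**) (A s) :: real^'n^'n \<Rightarrow> real^'n^'n)" for s
    using bounded_bilinear.bounded_linear_right[OF bounded_bilinear_matrix_mult] by (rule bounded_linear.linear)
  have "b * K \<ge> 0" using b K(1) by simp
  then obtain X where "X 0 = mat 1" "\<And>t. (X has_vector_derivative A t ** X t) (at t)"
    using linear_ode_exists[OF lin bd _ cont, of "mat 1"] by blast
  with that show thesis by blast
qed

text \<open>The difference D of the two fundamental matrices solves D' = A D + (A - A0) \<Phi>0 with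
  D(0) = 0, to which the energy estimate applies with a small inhomogeneity.\<close>

lemma fundamental_matrix_close:
  fixes A0 \<Phi>0 :: "real \<Rightarrow> real^'n^'n"
  assumes A0: "continuous_on UNIV A0"
    and \<Phi>0: "\<Phi>0 0 = mat 1" "\<And>s. (\<Phi>0 has_vector_derivative A0 s ** \<Phi>0 s) (at s)"
    and "\<delta> > 0"
  obtains \<epsilon> where "\<epsilon> > 0" "\<And>A \<Phi>. \<Phi> 0 = mat 1 \<Longrightarrow> (\<And>s. (\<Phi> has_vector_derivative A s ** \<Phi> s) (at s)) \<Longrightarrow>
     (\<And>s. s \<in> {0..1} \<Longrightarrow> norm (A s - A0 s) \<le> \<epsilon>) \<Longrightarrow> norm (\<Phi> 1 - \<Phi>0 1) < \<delta>"
proof -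
  obtain K where K: "K > 0" "\<And>A B. norm ((A::real^'n^'n) ** (B::real^'n^'n)) \<le> norm A * norm B * K"
    using norm_matrix_mult_bound by blast
  obtain a where a: "a > 0" "\<And>s. s \<in> {0..1} \<Longrightarrow> norm (A0 s) \<le> a" 
    using continuous_on_bounded_interval[OF continuous_on_subset[OF A0 subset_UNIV]] by blast
  have c\<Phi>0: "continuous_on UNIV \<Phi>0"
    by (rule has_vector_derivative_imp_continuous_on[OF \<Phi>0(2)])
  obtain b where b: "b > 0" "\<And>s. s \<in> {0..1} \<Longrightarrow> norm (\<Phi>0 s) \<le> b"
    using continuous_on_bounded_interval[OF continuous_on_subset[OF c\<Phi>0 subset_UNIV]] by blast
  define L where "L = K * (a + 1)"
  define E where "E = exp ((2 * L + 1) * 1)"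
  have E: "E > 0" "L \<ge> 0" using K a by (auto simp: E_def L_def)
  \<comment> \<open>The bound 1 allows the constant \<open>L\<close> to be fixed before
    \<open>A\<close> is known; the second entry makes the Gronwall bound E / (E + 1)^2 times
    \<open>\<delta>\<^sup>2\<close>, hence strictly less than
    \<open>\<delta>\<^sup>2\<close>.\<close>
  define \<epsilon> where "\<epsilon> = min 1 (\<delta> / (K * b * (E + 1)))"
  have \<epsilon>: "\<epsilon> > 0" "\<epsilon> \<le> 1" "K * b * \<epsilon> \<le> \<delta> / (E + 1)"
  proof -
    show "\<epsilon> > 0" "\<epsilon> \<le> 1" using K b E \<open>\<delta> > 0\<close> by (auto simp: \<epsilon>_def)
    have cancel: "X * (\<delta> / (X * Y)) = \<delta> / Y" if "X \<noteq> 0" for X Y :: real using that by simp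
    have "K * b * \<epsilon> \<le> K * b * (\<delta> / (K * b * (E + 1)))"
      using K b by (intro mult_left_mono) (auto simp: \<epsilon>_def)
    also have "\<dots> = \<delta> / (E + 1)" using K(1) b(1) by (intro cancel) simp
    finally show "K * b * \<epsilon> \<le> \<delta> / (E + 1)" .
  qed
  have "norm (\<Phi> 1 - \<Phi>0 1) < \<delta>"
    if \<Phi>: "\<Phi> 0 = mat 1" "\<And>s. (\<Phi> has_vector_derivative A s ** \<Phi> s) (at s)"
      and A: "\<And>s. s \<in> {0..1} \<Longrightarrow> norm (A s - A0 s) \<le> \<epsilon>" for A \<Phi>
  proof -
    have "(norm (\<Phi> 1 - \<Phi>0 1))\<^sup>2 \<le> ((norm (\<Phi> 0 - \<Phi>0 0))\<^sup>2 + (K * b * \<epsilon>)\<^sup>2) * exp ((2 * L + 1) * 1)"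
    proof (rule gronwall_energy[where x="\<lambda>s. \<Phi> s - \<Phi>0 s"])
      fix s
      have "((\<lambda>s. \<Phi> s - \<Phi>0 s) has_vector_derivative A s ** \<Phi> s - A0 s ** \<Phi>0 s) (at s)"
        by (intro has_vector_derivative_diff \<Phi> \<Phi>0)
      also have "A s ** \<Phi> s - A0 s ** \<Phi>0 s = A s ** (\<Phi> s - \<Phi>0 s) + (A s - A0 s) ** \<Phi>0 s"
        by (simp add: bounded_bilinear.diff_left[OF bounded_bilinear_matrix_mult]
            bounded_bilinear.diff_right[OF bounded_bilinear_matrix_mult])
      finally show "((\<lambda>s. \<Phi> s - \<Phi>0 s) has_vector_derivative A s ** (\<Phi> s - \<Phi>0 s) + (A s - A0 s) ** \<Phi>0 s) (at s)" .
    next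
      fix s :: real assume "0 \<le> s" "s \<le> 1"
      then have s: "s \<in> {0..1}" by simp
      have "norm (A s) \<le> a + 1"
        using norm_triangle_ineq[of "A s - A0 s" "A0 s"] A[OF s] a(2)[OF s] \<epsilon>(2) by simp
      have "norm (A s ** (\<Phi> s - \<Phi>0 s) + (A s - A0 s) ** \<Phi>0 s)
          \<le> norm (A s) * norm (\<Phi> s - \<Phi>0 s) * K + norm (A s - A0 s) * norm (\<Phi>0 s) * K"
        by (rule order_trans[OF norm_triangle_ineq]) (intro add_mono K)
      also have "\<dots> \<le> (a + 1) * norm (\<Phi> s - \<Phi>0 s) * K + \<epsilon> * b * K"
        using K(1) b s A[OF s] \<open>norm (A s) \<le> a + 1\<close> a(1) \<epsilon>
        by (intro add_mono mult_right_mono mult_mono) auto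
      finally show "norm (A s ** (\<Phi> s - \<Phi>0 s) + (A s - A0 s) ** \<Phi>0 s) \<le> L * norm (\<Phi> s - \<Phi>0 s) + K * b * \<epsilon>"
        by (simp add: L_def ac_simps)
    qed (use E in auto)
    also have "\<dots> = (K * b * \<epsilon>)\<^sup>2 * E" by (simp add: \<Phi> \<Phi>0 E_def)
    also have "\<dots> \<le> (\<delta> / (E + 1))\<^sup>2 * E"
      using K b \<epsilon> E by (intro mult_right_mono power_mono) auto
    also have "\<dots> = \<delta>\<^sup>2 * (E / (E + 1)\<^sup>2)" by (simp add: power_divide)
    also have "\<dots> < \<delta>\<^sup>2 * 1"
    proof (rule mult_strict_left_mono)
      have "E * 1 < (E + 1) * (E + 1)" using E(1) by (intro mult_strict_mono) auto
      then show "E / (E + 1)\<^sup>2 < 1" using E(1) by (simp add: power2_eq_square)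
    qed (use \<open>\<delta> > 0\<close> in simp)
    finally have "(norm (\<Phi> 1 - \<Phi>0 1))\<^sup>2 < \<delta>\<^sup>2" by simp
    then show ?thesis by (rule power_less_imp_less_base) (use \<open>\<delta> > 0\<close> in simp)
  qed
  with \<epsilon>(1) that show thesis by blast
qed

text \<open>The unit circle is compact, so the bordered determinant is bounded away from 0 there,
  and nearby pairs (e, M) move it uniformly by less.\<close>

lemma bordered_char_open:
  fixes e0 :: "real^'n" and M0 :: "real^'n^'n"
  assumes "e0$j \<noteq> 0" "\<And>z. norm z = 1 \<Longrightarrow> det (bordered_char j e0 M0 z) \<noteq> 0"
  obtains \<delta> where "\<delta> > 0" "\<And>e M. norm (e - e0) < \<delta> \<Longrightarrow> norm (M - M0) < \<delta> \<Longrightarrow>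
     e$j \<noteq> 0 \<and> (\<forall>z. norm z = 1 \<longrightarrow> det (bordered_char j e M z) \<noteq> 0)"
proof -
  let ?S = "{z::complex. norm z = 1}"
  have S: "compact ?S" using compact_sphere[of "0::complex" 1] by (simp add: sphere_def dist_norm)
  let ?F = "\<lambda>p z. det (bordered_char j (fst p) (snd p) z)"
  have cF: "continuous_on (UNIV \<times> ?S) (\<lambda>q. ?F (fst q) (snd q))"
  proof (rule continuous_on_det)
    fix i l
    show "continuous_on (UNIV \<times> ?S) (\<lambda>q. bordered_char j (fst (fst q)) (snd (fst q)) (snd q) $ i $ l)"
      unfolding bordered_char_def
      by (cases "l = j"; cases "i = l") (auto intro!: continuous_intros)
  qed
  have "continuous_on ?S (\<lambda>z. (\<lambda>q. ?F (fst q) (snd q)) ((e0, M0), z))"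
    by (rule continuous_on_compose2[OF cF]) (auto intro!: continuous_intros)
  then obtain m where m: "m > 0" "\<And>z. z \<in> ?S \<Longrightarrow> m \<le> norm (?F (e0, M0) z)"
    using compact_norm_lower_bound[OF S, of "?F (e0, M0)"] assms(2) by auto
  have "\<forall>\<^sub>F p in nhds (e0, M0). p \<in> UNIV \<longrightarrow> (\<forall>z\<in>?S. dist (?F p z) (?F (e0, M0) z) < m)"
    by (rule family_eventually_close[OF cF S]) (use m in auto)
  then obtain \<delta>1 where \<delta>1: "\<delta>1 > 0" "\<And>p z. dist p (e0, M0) < \<delta>1 \<Longrightarrow> z \<in> ?S \<Longrightarrow> dist (?F p z) (?F (e0, M0) z) < m"
    unfolding eventually_nhds_metric by auto
  \<comment> \<open>The half accounts for the two components of the pair; the second entry keeps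
    component \<open>j\<close> of \<open>e\<close> away from 0.\<close>
  define \<delta> where "\<delta> = min (\<delta>1 / 2) \<bar>e0$j\<bar>"
  have "e$j \<noteq> 0 \<and> (\<forall>z. norm z = 1 \<longrightarrow> det (bordered_char j e M z) \<noteq> 0)"
    if "norm (e - e0) < \<delta>" "norm (M - M0) < \<delta>" for e M
  proof (intro conjI allI impI notI)
    assume "e$j = 0"
    then have "\<bar>e0$j\<bar> \<le> norm (e - e0)" using component_le_norm_cart[of "e - e0" j] by simp
    then show False using that by (simp add: \<delta>_def)
  next
    fix z assume z: "norm z = 1" "det (bordered_char j e M z) = 0"
    have "dist (e, M) (e0, M0) \<le> dist e e0 + dist M M0"
      by (simp add: dist_Pair_Pair sqrt_sum_squares_le_sum)
    then have "dist (e, M) (e0, M0) < \<delta>1" using that by (simp add: \<delta>_def dist_norm)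
    from \<delta>1(2)[OF this, of z] m(2)[of z] z show False by simp
  qed
  moreover have "\<delta> > 0" using \<delta>1 assms(1) by (simp add: \<delta>_def)
  ultimately show thesis using that by blast
qed

section \<open>Passing between hyperbolicity and its form in rescaled time\<close>

lemma ode_unique:
  fixes f :: "real^'n \<Rightarrow> real^'n"
  assumes "open W" "Ck_on 1 W f" "compact K" "K \<subseteq> W"
    and x: "\<And>t. x t \<in> K" "\<And>t. (x has_vector_derivative T *\<^sub>R f (x t)) (at t)"
    and y: "\<And>t. y t \<in> K" "\<And>t. (y has_vector_derivative T *\<^sub>R f (y t)) (at t)"
    and "x a = y a"
  shows "x t = y t"
proof -
  obtain L where L: "L \<ge> 0" "\<And>x y. x \<in> K \<Longrightarrow> y \<in> K \<Longrightarrow> norm (f x - f y) \<le> L * norm (x - y)"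
    using C1_lipschitz_on_compact[OF assms(1,3,4,2)] by blast
  have "x t - y t = 0"
  proof (rule gronwall_unique[where x="\<lambda>t. x t - y t"])
    show "((\<lambda>t. x t - y t) has_vector_derivative T *\<^sub>R f (x t) - T *\<^sub>R f (y t)) (at t)" for t
      by (intro has_vector_derivative_diff x y)
    show "norm (T *\<^sub>R f (x t) - T *\<^sub>R f (y t)) \<le> (\<bar>T\<bar> * L) * norm (x t - y t)" for t
      using mult_left_mono[OF L(2)[OF x(1) y(1), of t t], of "\<bar>T\<bar>"]
      by (simp add: scaleR_right_diff_distrib[symmetric] ac_simps)
  qed (use L assms in auto)
  then show ?thesis by simp
qed

lemma periodic_orbit_compact:
  fixes u :: "real \<Rightarrow> 'a::real_normed_vector"
  assumes "continuous_on UNIV u" "\<And>s. u (s + 1) = u s"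
  shows "compact (range u)"
proof -
  have "u s \<in> u ` {0..1}" for s
    using periodic_eq_frac[of u s, OF assms(2)] frac_lt_1[of s]
    by (intro image_eqI[of _ _ "frac s"]) auto
  then have "range u = u ` {0..1}" by auto
  then show ?thesis by (auto intro!: compact_continuous_image continuous_on_subset[OF assms(1)])
qed

text \<open>The velocity of the orbit solves the variational equation along it, and solutions of
  that equation are unique. At s = 1 this exhibits f (u 0) as a fixed vector of the monodromy
  matrix, the source of the trivial multiplier 1.\<close>

lemma variational_flow_vector:
  fixes f :: "real^'n \<Rightarrow> real^'n"
  assumes "open W" "Ck_on 1 W f" and u: "\<And>s. u s \<in> W" "\<And>s. u (s + 1) = u s"
      "\<And>s. (u has_vector_derivative T *\<^sub>R f (u s)) (at s)"
    and \<Phi>: "\<Phi> 0 = mat 1" "\<And>s. (\<Phi> has_vector_derivative (T *\<^sub>R jacobian f (at (u s))) ** \<Phi> s) (at s)"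
  shows "\<Phi> s *v f (u 0) = f (u s)"
proof -
  have fam: "Ck_family (Suc 0) {0::real} W (\<lambda>_. f)"
    using assms(2) by (simp add: Ck_on_iff_Ck_family[where c="0::real"])
  have cu: "continuous_on UNIV u"
    by (rule has_vector_derivative_imp_continuous_on[OF u(3)])
  have cJ: "continuous_on UNIV (\<lambda>s. jacobian f (at (u s)))"
  proof -
    have "continuous_on UNIV (\<lambda>s. (\<lambda>z. jacobian f (at (snd z))) (0::real, u s))"
      by (rule continuous_on_compose2[OF continuous_on_jacobian_family[OF fam]])
        (use u in \<open>auto intro!: continuous_intros cu\<close>)
    then show ?thesis by simp
  qed
  obtain b where b: "b > 0" "\<And>s. norm (jacobian f (at (u s))) \<le> b"
    using periodic_continuous_bounded[OF cJ] u(2) by auto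
  obtain K where K: "K > 0" "\<And>A x. norm ((A::real^'n^'n) *v x) \<le> norm A * norm x * K"
    using norm_matrix_vector_mult_bound by blast
  have "\<Phi> s *v f (u 0) - f (u s) = 0"
  proof (rule gronwall_unique[where a=0 and x="\<lambda>s. \<Phi> s *v f (u 0) - f (u s)"])
    fix s
    let ?A = "T *\<^sub>R jacobian f (at (u s))"
    have 1: "((\<lambda>s. \<Phi> s *v f (u 0)) has_vector_derivative (?A ** \<Phi> s) *v f (u 0)) (at s)"
      by (rule bounded_linear.has_vector_derivative[OF bounded_bilinear.bounded_linear_left[OF bounded_bilinear_matrix_vector_mult] \<Phi>(2)])
    have "(f has_derivative (\<lambda>v. jacobian f (at (u s)) *v v)) (at (u s))"
      using has_derivative_jacobian[OF fam _ u(1)] by simp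
    from vector_derivative_diff_chain_within[OF u(3), of f "\<lambda>v. jacobian f (at (u s)) *v v" s]
    have 2: "((\<lambda>s. f (u s)) has_vector_derivative jacobian f (at (u s)) *v (T *\<^sub>R f (u s))) (at s)"
      using \<open>(f has_derivative _) _\<close> by (simp add: o_def has_derivative_at_withinI)
    have "((\<lambda>s. \<Phi> s *v f (u 0) - f (u s)) has_vector_derivative
        (?A ** \<Phi> s) *v f (u 0) - jacobian f (at (u s)) *v (T *\<^sub>R f (u s))) (at s)"
      by (intro has_vector_derivative_diff 1 2)
    also have "(?A ** \<Phi> s) *v f (u 0) - jacobian f (at (u s)) *v (T *\<^sub>R f (u s)) = ?A *v (\<Phi> s *v f (u 0) - f (u s))"
      by (simp add: matrix_vector_mul_assoc[symmetric] bounded_bilinear.diff_right[OF bounded_bilinear_matrix_vector_mult]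
         bounded_bilinear.scaleR_right[OF bounded_bilinear_matrix_vector_mult] bounded_bilinear.scaleR_left[OF bounded_bilinear_matrix_vector_mult])
    finally show "((\<lambda>s. \<Phi> s *v f (u 0) - f (u s)) has_vector_derivative ?A *v (\<Phi> s *v f (u 0) - f (u s))) (at s)" .
    have "norm (?A *v (\<Phi> s *v f (u 0) - f (u s))) \<le> norm ?A * norm (\<Phi> s *v f (u 0) - f (u s)) * K" by (rule K(2))
    also have "\<dots> \<le> (\<bar>T\<bar> * b) * norm (\<Phi> s *v f (u 0) - f (u s)) * K"
      using b(2)[of s] K(1) by (intro mult_right_mono) (auto intro!: mult_left_mono)
    finally show "norm (?A *v (\<Phi> s *v f (u 0) - f (u s))) \<le> (\<bar>T\<bar> * b * K) * norm (\<Phi> s *v f (u 0) - f (u s))"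
      by (simp add: ac_simps)
  qed (use b K \<Phi> in auto)
  then show ?thesis by simp
qed

lemma has_vector_derivative_rescale:
  assumes "\<And>t. (F has_vector_derivative F' t) (at t)"
  shows "((\<lambda>s. F (s * T)) has_vector_derivative T *\<^sub>R F' (s * T)) (at s)"
proof -
  have "((F \<circ> (\<lambda>s. s * T)) has_vector_derivative T *\<^sub>R F' (s * T)) (at s)"
    by (rule vector_diff_chain_at) (auto intro!: derivative_eq_intros assms)
  then show ?thesis by (simp add: o_def)
qed

lemma has_vector_derivative_rescale_divide:
  assumes "T > 0" "\<And>s. (F has_vector_derivative T *\<^sub>R F' s) (at s)"
  shows "((\<lambda>t. F (t / T)) has_vector_derivative F' (t / T)) (at t)"
  using has_vector_derivative_rescale[of F "\<lambda>s. T *\<^sub>R F' s" "1 / T" t] assms by simp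

text \<open>By uniqueness, a coincidence u s = u t propagates along the whole orbit and makes t - s
  a period, contradicting minimality; a zero of f on the orbit would make it constant. The
  multiplier condition is delivered in its bordered form, the one that perturbs well.\<close>

lemma hyperbolic_scaled:
  fixes f :: "real^'n \<Rightarrow> real^'n"
  assumes W: "open W" "Ck_on 1 W f" and "T > 0" and uW: "\<And>s. u s \<in> W"
    and hyp: "hyperbolic_periodic_solution U f T (\<lambda>t. u (t / T))"
  obtains \<Phi> j where "\<And>s. u (s + 1) = u s" "\<And>s. (u has_vector_derivative T *\<^sub>R f (u s)) (at s)"
    "inj_on u {0..<1}" "\<And>s. f (u s) \<noteq> 0" "\<Phi> 0 = mat 1"
    "\<And>s. (\<Phi> has_vector_derivative (T *\<^sub>R jacobian f (at (u s))) ** \<Phi> s) (at s)"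
    "f (u 0) $ j \<noteq> 0" "\<And>z. norm z = 1 \<Longrightarrow> det (bordered_char j (f (u 0)) (\<Phi> 1) z) \<noteq> 0"
proof -
  have ps: "periodic_solution U f T (\<lambda>t. u (t / T))"
    using hyp by (simp add: hyperbolic_periodic_solution_def)
  have d0: "((\<lambda>t. u (t / T)) has_vector_derivative f (u (t / T))) (at t)"
    and per0: "u ((t + T) / T) = u (t / T)" and nc: "\<not> (\<lambda>t. u (t / T)) constant_on UNIV"
    and minp: "0 < S \<Longrightarrow> S < T \<Longrightarrow> \<not> (\<forall>t. u ((t + S) / T) = u (t / T))" for t S
    using ps unfolding periodic_solution_def by auto
  note chain = has_vector_derivative_rescale[where T=T]
  have du: "(u has_vector_derivative T *\<^sub>R f (u s)) (at s)" for s
    using chain[OF d0, of s] \<open>T > 0\<close> by simp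
  have per: "u (s + 1) = u s" for s
    using per0[of "s * T"] \<open>T > 0\<close> by (simp add: add_divide_distrib)
  have cu: "continuous_on UNIV u"
    by (rule has_vector_derivative_imp_continuous_on[OF du])
  note K = periodic_orbit_compact[OF cu per]
  have KW: "range u \<subseteq> W" using uW by auto
  have shift: "u (x + d) = u x" if "u (s + d) = u s" for s d x
  proof (rule ode_unique[OF W K KW, where T=T])
    show "((\<lambda>x. u (x + d)) has_vector_derivative T *\<^sub>R f (u (t + d))) (at t)" for t
    proof -
      have "((u \<circ> (\<lambda>s. s + d)) has_vector_derivative 1 *\<^sub>R (T *\<^sub>R f (u (t + d)))) (at t)"
        by (rule vector_diff_chain_at) (auto intro!: derivative_eq_intros du)
      then show ?thesis by (simp add: o_def)
    qed
  qed (use that du in auto)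
  have inj: "inj_on u {0..<1}"
  proof (rule linorder_inj_onI)
    fix s t :: real assume st: "s < t" "s \<in> {0..<1}" "t \<in> {0..<1}"
    show "u s \<noteq> u t"
    proof
      assume "u s = u t"
      then have *: "u (x + (t - s)) = u x" for x using shift[of s "t - s"] by simp
      have "u ((x + (t - s) * T) / T) = u (x / T)" for x
        using *[of "x / T"] \<open>T > 0\<close> by (simp add: add_divide_distrib)
      moreover have "0 < (t - s) * T" "(t - s) * T < T" using st \<open>T > 0\<close> by auto
      ultimately show False using minp by blast
    qed
  qed auto
  have nz: "f (u s) \<noteq> 0" for s
  proof
    assume "f (u s) = 0"
    have "u x = u s" for x
    proof (rule ode_unique[OF W K KW, where T=T and x=u and y="\<lambda>_. u s" and a=s])
      show "((\<lambda>_. u s) has_vector_derivative T *\<^sub>R f (u s)) (at t)" for t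
        using \<open>f (u s) = 0\<close> by simp
    qed (auto intro: du)
    then have "u x = u y" for x y by metis
    then have "(\<lambda>t. u (t / T)) constant_on UNIV" unfolding constant_on_def by blast
    with nc show False by blast
  qed
  obtain M where M: "monodromy_matrix f T (\<lambda>t. u (t / T)) M"
    "order 1 (complex_charpoly M) = 1 \<and> (\<forall>\<mu>. poly (complex_charpoly M) \<mu> = 0 \<and> norm \<mu> = 1 \<longrightarrow> \<mu> = 1)"
    using hyp unfolding hyperbolic_periodic_solution_def by blast
  then obtain \<Psi> where \<Psi>: "\<Psi> 0 = mat 1" "M = \<Psi> T"
    "\<And>t. (\<Psi> has_vector_derivative (jacobian f (at (u (t / T))) ** \<Psi> t)) (at t)"
    unfolding monodromy_matrix_def by blast
  define \<Phi> where "\<Phi> s = \<Psi> (s * T)" for s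
  have \<Phi>0: "\<Phi> 0 = mat 1" by (simp add: \<Phi>_def \<Psi>)
  have d\<Phi>: "(\<Phi> has_vector_derivative (T *\<^sub>R jacobian f (at (u s))) ** \<Phi> s) (at s)" for s
    using chain[OF \<Psi>(3), of s] \<open>T > 0\<close>
    by (simp add: \<Phi>_def[abs_def] bounded_bilinear.scaleR_left[OF bounded_bilinear_matrix_mult])
  have e: "M *v f (u 0) = f (u 0)"
    using variational_flow_vector[OF W uW per du \<Phi>0 d\<Phi>, of 1] per[of 0] \<open>T > 0\<close>
    by (simp add: \<Phi>_def \<Psi>)
  obtain j where j: "f (u 0) $ j \<noteq> 0" using nz[of 0] by (auto simp: vec_eq_iff)
  have "det (bordered_char j (f (u 0)) (\<Phi> 1) z) \<noteq> 0" if "norm z = 1" for z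
    using simple_multiplier_iff_bordered[OF e j] M(2) that \<Psi>(2) by (simp add: \<Phi>_def)
  from that[OF per du inj nz \<Phi>0 d\<Phi> j this] show thesis .
qed

text \<open>Injectivity on one period rules out every smaller period, and thereby also a constant
  solution.\<close>

lemma hyperbolic_scaledI:
  fixes f :: "real^'n \<Rightarrow> real^'n"
  assumes W: "open W" "Ck_on 1 W f" "W \<subseteq> U" and "T > 0" and uW: "\<And>s. u s \<in> W"
    and per: "\<And>s. u (s + 1) = u s" and du: "\<And>s. (u has_vector_derivative T *\<^sub>R f (u s)) (at s)"
    and inj: "inj_on u {0..<1}" and \<Phi>0: "\<Phi> 0 = mat 1"
    and d\<Phi>: "\<And>s. (\<Phi> has_vector_derivative (T *\<^sub>R jacobian f (at (u s))) ** \<Phi> s) (at s)"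
    and j: "f (u 0) $ j \<noteq> 0" and det: "\<And>z. norm z = 1 \<Longrightarrow> det (bordered_char j (f (u 0)) (\<Phi> 1) z) \<noteq> 0"
  shows "hyperbolic_periodic_solution U f T (\<lambda>t. u (t / T))"
proof -
  note chain = has_vector_derivative_rescale_divide[OF \<open>T > 0\<close>]
  have nper: "\<not> (\<forall>t. u ((t + S) / T) = u (t / T))" if "0 < S" "S < T" for S
  proof
    assume "\<forall>t. u ((t + S) / T) = u (t / T)"
    then have "u (S / T) = u 0" by (metis add_0 div_0)
    then have "S / T = 0" using inj_onD[OF inj, of "S / T" 0] that \<open>T > 0\<close> by auto
    then show False using that by auto
  qed
  have "periodic_solution U f T (\<lambda>t. u (t / T))"
    unfolding periodic_solution_def
  proof (intro conjI allI impI)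
    show "u (t / T) \<in> U" for t using uW W(3) by auto
    show "((\<lambda>t. u (t / T)) has_vector_derivative f (u (t / T))) (at t)" for t by (rule chain[OF du])
    show "u ((t + T) / T) = u (t / T)" for t using per[of "t / T"] \<open>T > 0\<close> by (simp add: add_divide_distrib)
    show "\<not> (\<lambda>t. u (t / T)) constant_on UNIV"
    proof
      assume "(\<lambda>t. u (t / T)) constant_on UNIV"
      then show False using nper[of "T / 2"] \<open>T > 0\<close> by (auto simp: constant_on_def)
    qed
  qed (use \<open>T > 0\<close> nper in auto)
  moreover have "monodromy_matrix f T (\<lambda>t. u (t / T)) (\<Phi> 1)"
    unfolding monodromy_matrix_def
  proof (intro exI[of _ "\<lambda>t. \<Phi> (t / T)"] conjI allI)
    show "((\<lambda>t. \<Phi> (t / T)) has_vector_derivative jacobian f (at (u (t / T))) ** \<Phi> (t / T)) (at t)" for t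
      by (rule chain[where F=\<Phi> and F'="\<lambda>s. jacobian f (at (u s)) ** \<Phi> s"])
        (use d\<Phi> in \<open>simp add: bounded_bilinear.scaleR_left[OF bounded_bilinear_matrix_mult]\<close>)
  qed (use \<Phi>0 \<open>T > 0\<close> in auto)
  moreover have e: "\<Phi> 1 *v f (u 0) = f (u 0)"
    using variational_flow_vector[OF W(1,2) uW per du \<Phi>0 d\<Phi>, of 1] per[of 0] by simp
  ultimately show ?thesis
    using simple_multiplier_iff_bordered[OF e j] det unfolding hyperbolic_periodic_solution_def by blast
qed

text \<open>The border index \<open>j\<close> of the limit orbit serves for all nearby ones, as
  velocity and monodromy matrix vary continuously. Minimality of the period comes from stability of
  injectivity.\<close>

lemma hyperbolic_family:
  fixes g :: "'c::topological_space \<Rightarrow> real^'n \<Rightarrow> real^'n"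
  assumes W: "open W" "W \<subseteq> U" and g: "Ck_family (Suc 0) C W g" and "c0 \<in> C"
    and S: "continuous_on C S" "\<And>c. c \<in> C \<Longrightarrow> S c > 0"
    and cu: "continuous_on (C \<times> UNIV) (\<lambda>z. u (fst z) (snd z))"
    and uW: "\<And>c s. c \<in> C \<Longrightarrow> u c s \<in> W"
    and per: "\<And>c s. c \<in> C \<Longrightarrow> u c (s + 1) = u c s"
    and du: "\<And>c s. c \<in> C \<Longrightarrow> (u c has_vector_derivative S c *\<^sub>R g c (u c s)) (at s)"
    and hyp: "hyperbolic_periodic_solution U (g c0) (S c0) (\<lambda>t. u c0 (t / S c0))"
  shows "\<forall>\<^sub>F c in nhds c0. c \<in> C \<longrightarrow> hyperbolic_periodic_solution U (g c) (S c) (\<lambda>t. u c (t / S c))"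
proof -
  have g1: "Ck_on 1 W (g c)" if "c \<in> C" for c
    using Ck_family_imp_Ck_on[OF g that] by simp
  obtain \<Phi>0 j where h: "inj_on (u c0) {0..<1}" "\<And>s. g c0 (u c0 s) \<noteq> 0" "\<Phi>0 0 = mat 1"
    "\<And>s. (\<Phi>0 has_vector_derivative (S c0 *\<^sub>R jacobian (g c0) (at (u c0 s))) ** \<Phi>0 s) (at s)"
    "g c0 (u c0 0) $ j \<noteq> 0" "\<And>z. norm z = 1 \<Longrightarrow> det (bordered_char j (g c0 (u c0 0)) (\<Phi>0 1) z) \<noteq> 0"
    by (rule hyperbolic_scaled[OF W(1) g1[OF \<open>c0 \<in> C\<close>] S(2)[OF \<open>c0 \<in> C\<close>] uW[OF \<open>c0 \<in> C\<close>] hyp]) blast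
  have cS: "continuous_on (C \<times> UNIV) (\<lambda>z. S (fst z))"
    by (rule continuous_on_compose2[OF S(1)]) (auto intro!: continuous_intros)
  have cgu: "continuous_on (C \<times> UNIV) (\<lambda>z. g (fst z) (u (fst z) (snd z)))"
  proof -
    have "continuous_on (C \<times> UNIV) (\<lambda>z. (\<lambda>w. g (fst w) (snd w)) (fst z, u (fst z) (snd z)))"
      by (rule continuous_on_compose2[OF Ck_family_continuous[OF g]]) (use uW in \<open>auto intro!: continuous_intros cu\<close>)
    then show ?thesis by simp
  qed
  define A where "A c s = S c *\<^sub>R jacobian (g c) (at (u c s))" for c s
  have h4: "(\<Phi>0 has_vector_derivative A c0 s ** \<Phi>0 s) (at s)" for s
    using h(4) by (simp add: A_def)
  have cA: "continuous_on (C \<times> UNIV) (\<lambda>z. A (fst z) (snd z))"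
  proof -
    have "continuous_on (C \<times> UNIV) (\<lambda>z. (\<lambda>w. jacobian (g (fst w)) (at (snd w))) (fst z, u (fst z) (snd z)))"
      by (rule continuous_on_compose2[OF continuous_on_jacobian_family[OF g]]) (use uW in \<open>auto intro!: continuous_intros cu\<close>)
    then show ?thesis unfolding A_def by (intro continuous_intros cS) simp
  qed
  have cAc: "continuous_on UNIV (A c)" if "c \<in> C" for c
  proof -
    have "continuous_on UNIV (\<lambda>s. (\<lambda>z. A (fst z) (snd z)) (c, s))"
      by (rule continuous_on_compose2[OF cA]) (use that in \<open>auto intro!: continuous_intros\<close>)
    then show ?thesis by simp
  qed
  have "\<exists>\<Phi>. \<Phi> 0 = mat 1 \<and> (\<forall>s. (\<Phi> has_vector_derivative A c s ** \<Phi> s) (at s))" if c: "c \<in> C" for c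
  proof -
    have "A c (s + 1) = A c s" for s by (simp add: A_def per[OF c])
    then obtain b where "b > 0" "\<And>s. norm (A c s) \<le> b"
      using periodic_continuous_bounded[OF cAc[OF c]] by blast
    then show ?thesis using fundamental_matrix_exists[OF cAc[OF c]] by metis
  qed
  then obtain \<Phi> where \<Phi>: "\<And>c. c \<in> C \<Longrightarrow> \<Phi> c 0 = mat 1"
    "\<And>c s. c \<in> C \<Longrightarrow> (\<Phi> c has_vector_derivative A c s ** \<Phi> c s) (at s)"
    by metis
  obtain \<delta> where \<delta>: "\<delta> > 0" "\<And>e M. norm (e - g c0 (u c0 0)) < \<delta> \<Longrightarrow> norm (M - \<Phi>0 1) < \<delta> \<Longrightarrow>
     e$j \<noteq> 0 \<and> (\<forall>z. norm z = 1 \<longrightarrow> det (bordered_char j e M z) \<noteq> 0)"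
    using bordered_char_open[OF h(5,6)] by blast
  obtain \<epsilon> where \<epsilon>: "\<epsilon> > 0" "\<And>A' \<Phi>. \<Phi> 0 = mat 1 \<Longrightarrow> (\<And>s. (\<Phi> has_vector_derivative A' s ** \<Phi> s) (at s)) \<Longrightarrow>
     (\<And>s. s \<in> {0..1} \<Longrightarrow> norm (A' s - A c0 s) \<le> \<epsilon>) \<Longrightarrow> norm (\<Phi> 1 - \<Phi>0 1) < \<delta>"
    using fundamental_matrix_close[of "A c0" \<Phi>0 \<delta>] cAc[OF \<open>c0 \<in> C\<close>] h(3) h4 \<delta>(1) by blast
  have "\<forall>\<^sub>F c in nhds c0. c \<in> C \<longrightarrow> (\<forall>s\<in>{0..1}. dist (A c s) (A c0 s) < \<epsilon>)"
    by (rule family_eventually_close[OF continuous_on_subset[OF cA]]) (use \<epsilon> \<open>c0 \<in> C\<close> in auto)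
  moreover have "\<forall>\<^sub>F c in nhds c0. c \<in> C \<longrightarrow> (\<forall>s\<in>{0::real}. dist (g c (u c s)) (g c0 (u c0 s)) < \<delta>)"
    by (rule family_eventually_close[OF continuous_on_subset[OF cgu]]) (use \<delta> \<open>c0 \<in> C\<close> in auto)
  moreover have "\<forall>\<^sub>F c in nhds c0. c \<in> C \<longrightarrow> inj_on (u c) {0..<1} \<and> (\<forall>s. S c *\<^sub>R g c (u c s) \<noteq> 0)"
  proof (rule injective_immersion_family[OF du cu])
    show "continuous_on (C \<times> UNIV) (\<lambda>z. S (fst z) *\<^sub>R g (fst z) (u (fst z) (snd z)))"
      by (intro continuous_intros cS cgu)
  qed (use per \<open>c0 \<in> C\<close> h S(2)[OF \<open>c0 \<in> C\<close>] in auto)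
  ultimately show ?thesis
  proof eventually_elim
    case (elim c)
    show ?case
    proof
      assume c: "c \<in> C"
      have "norm (\<Phi> c 1 - \<Phi>0 1) < \<delta>"
        by (rule \<epsilon>(2)[of "\<Phi> c" "A c"]) (use \<Phi> c elim(1) in \<open>auto simp: dist_norm less_imp_le\<close>)
      moreover have "norm (g c (u c 0) - g c0 (u c0 0)) < \<delta>" using elim(2) c by (simp add: dist_norm)
      ultimately have D: "g c (u c 0) $ j \<noteq> 0" "\<And>z. norm z = 1 \<Longrightarrow> det (bordered_char j (g c (u c 0)) (\<Phi> c 1) z) \<noteq> 0"
        using \<delta>(2) by blast+
      show "hyperbolic_periodic_solution U (g c) (S c) (\<lambda>t. u c (t / S c))"
        by (rule hyperbolic_scaledI[OF W(1) g1[OF c] W(2) S(2)[OF c] uW[OF c] per[OF c] du[OF c] _ \<Phi>(1)[OF c] _ D])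
          (use elim(3) c \<Phi>(2)[OF c] in \<open>auto simp: A_def\<close>)
    qed
  qed
qed

section \<open>Persistence of hyperbolic periodic solutions\<close>

text \<open>Solves \<open>V' = A V + \<kappa> w + \<rho>\<close> with \<open>V\<close> of period one, where \<open>w = \<Phi> e\<close> is the flow direction. The condition
  \<open>V 1 = V 0\<close> reads \<open>(1 - M) v\<^sub>0 - \<kappa> e = M \<integral> \<Psi> \<rho>\<close>; it is solvable since the bordered matrix is invertible.\<close>

lemma linear_periodic_solution_operator:
  fixes A \<Phi> :: "real \<Rightarrow> real^'n^'n"
  assumes A: "continuous_on UNIV A" "\<And>s. norm (A s) \<le> b"
    and \<Phi>: "\<Phi> 0 = mat 1" "\<And>s. (\<Phi> has_vector_derivative A s ** \<Phi> s) (at s)"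
    and e: "\<Phi> 1 *v e = e" and det: "det (bordered_char j e (\<Phi> 1) 1) \<noteq> 0"
  obtains V :: "(real \<Rightarrow>\<^sub>C (real^'n)) \<Rightarrow> real \<Rightarrow> real^'n" and \<kappa> K where "K > 0"
    "\<And>\<rho> \<rho>' s. s \<in> {0..1} \<Longrightarrow> norm (V \<rho> s - V \<rho>' s) \<le> K * norm (\<rho> - \<rho>')"
    "\<And>\<rho> \<rho>'. \<bar>\<kappa> \<rho> - \<kappa> \<rho>'\<bar> \<le> K * norm (\<rho> - \<rho>')"
    "\<And>s. V 0 s = 0" "\<kappa> 0 = 0" "\<And>\<rho>. V \<rho> 1 = V \<rho> 0"
    "\<And>\<rho> s. (V \<rho> has_vector_derivative A s *v V \<rho> s + \<kappa> \<rho> *\<^sub>R (\<Phi> s *v e) + \<rho> s) (at s)"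
proof -
  note mm = bounded_bilinear_matrix_mult and mv = bounded_bilinear_matrix_vector_mult
  obtain k1 where k1: "k1 > 0" "\<And>A B. norm ((A::real^'n^'n) ** (B::real^'n^'n)) \<le> norm A * norm B * k1"
    using norm_matrix_mult_bound by blast
  obtain k2 where k2: "k2 > 0" "\<And>A x. norm ((A::real^'n^'n) *v x) \<le> norm A * norm x * k2"
    using norm_matrix_vector_mult_bound by blast
  have b0: "b \<ge> 0" using A(2)[of 0] norm_ge_zero order_trans by blast
  have lin: "linear (\<lambda>X. - (X ** A s) :: real^'n^'n)" for s
    by (intro bounded_linear.linear bounded_linear_minus bounded_bilinear.bounded_linear_left[OF mm])
  have bd: "norm (- (X ** A s)) \<le> (b * k1) * norm X" for s and X :: "real^'n^'n"
  proof -
    have "norm (- (X ** A s)) \<le> norm X * norm (A s) * k1" using k1(2) by simp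
    also have "\<dots> \<le> norm X * b * k1" using A(2)[of s] k1(1) by (intro mult_right_mono mult_left_mono) auto
    finally show ?thesis by (simp add: ac_simps)
  qed
  have cont: "continuous_on UNIV (\<lambda>z. - (snd z ** A (fst z)) :: real^'n^'n)"
    by (intro continuous_on_minus continuous_on_matrix_mult continuous_on_compose2[OF A(1)] continuous_intros) auto
  have "b * k1 \<ge> 0" using b0 k1 by simp
  then obtain \<Psi> where \<Psi>: "\<Psi> 0 = mat 1" "\<And>s. (\<Psi> has_vector_derivative - (\<Psi> s ** A s)) (at s)"
    using linear_ode_exists[OF lin bd _ cont, of "mat 1"] by blast
  \<comment> \<open>\<open>\<Psi>\<close> is the inverse of \<open>\<Phi>\<close>. Constructing it
    from the adjoint equation gives it a derivative at once, without differentiating a matrix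
    inverse.\<close>
  have "((\<lambda>s. \<Psi> s ** \<Phi> s) has_vector_derivative 0) (at s)" for s
    using bounded_bilinear.has_vector_derivative[OF mm \<Psi>(2)[of s] \<Phi>(2)[of s]]
    by (simp add: bounded_bilinear.minus_left[OF mm] matrix_mul_assoc)
  then obtain c where c: "\<And>s. \<Psi> s ** \<Phi> s = c"
    using has_vector_derivative_zero_constant[of UNIV "\<lambda>s. \<Psi> s ** \<Phi> s"] by auto
  have "\<Psi> s ** \<Phi> s = mat 1" for s using c[of s] c[of 0] \<Phi> \<Psi> by simp
  then have inv: "\<Phi> s ** \<Psi> s = mat 1" for s using matrix_left_right_inverse by blast
  have c\<Psi>: "continuous_on UNIV \<Psi>" and c\<Phi>: "continuous_on UNIV \<Phi>"
    by (intro continuous_at_imp_continuous_on ballI has_vector_derivative_continuous[OF \<Psi>(2)]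
          has_vector_derivative_continuous[OF \<Phi>(2)])+
  obtain b\<Phi> where b\<Phi>: "b\<Phi> > 0" "\<And>s. s \<in> {0..1} \<Longrightarrow> norm (\<Phi> s) \<le> b\<Phi>" 
    using continuous_on_bounded_interval[OF continuous_on_subset[OF c\<Phi> subset_UNIV]] by blast
  obtain b\<Psi> where b\<Psi>: "b\<Psi> > 0" "\<And>s. s \<in> {0..1} \<Longrightarrow> norm (\<Psi> s) \<le> b\<Psi>" 
    using continuous_on_bounded_interval[OF continuous_on_subset[OF c\<Psi> subset_UNIV]] by blast
  have "\<exists>I. I 0 = 0 \<and> (\<forall>s. (I has_vector_derivative \<Psi> s *v apply_bcontfun \<rho> s) (at s))" for \<rho>
  proof -
    have "continuous_on UNIV (\<lambda>s. \<Psi> s *v apply_bcontfun \<rho> s)"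
      by (intro continuous_on_matrix_vector_mult c\<Psi>) auto
    from antiderivative_real[OF this] show ?thesis by metis
  qed
  then obtain I where I: "\<And>\<rho>. I \<rho> 0 = 0"
    "\<And>\<rho> s. (I \<rho> has_vector_derivative \<Psi> s *v apply_bcontfun \<rho> s) (at s)" by metis
  define kI where "kI = b\<Psi> * k2"
  have kI: "kI > 0" using b\<Psi> k2 by (simp add: kI_def)
  have Idiff: "norm (I \<rho> s - I \<rho>' s) \<le> kI * norm (\<rho> - \<rho>')" if s: "s \<in> {0..1}" for \<rho> \<rho>' s
  proof (cases "s = 0")
    case True then show ?thesis using I(1) kI by simp
  next
    case False
    have D: "((\<lambda>s. I \<rho> s - I \<rho>' s) has_vector_derivative \<Psi> s *v (\<rho> - \<rho>') s) (at s)" for s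
      using has_vector_derivative_diff[OF I(2)[of \<rho> s] I(2)[of \<rho>' s]]
      by (simp add: bounded_bilinear.diff_right[OF mv])
    have "norm ((I \<rho> s - I \<rho>' s) - (I \<rho> 0 - I \<rho>' 0)) \<le> (kI * norm (\<rho> - \<rho>')) * s - (kI * norm (\<rho> - \<rho>')) * 0"
    proof (rule differentiable_bound_general[where f="\<lambda>s. I \<rho> s - I \<rho>' s" and f'="\<lambda>s. \<Psi> s *v (\<rho> - \<rho>') s"
         and \<phi>'="\<lambda>_. kI * norm (\<rho> - \<rho>')"])
      show "continuous_on {0..s} (\<lambda>s. I \<rho> s - I \<rho>' s)"
        by (rule has_vector_derivative_imp_continuous_on[OF D])
      show "((\<lambda>s. (kI * norm (\<rho> - \<rho>')) * s) has_vector_derivative kI * norm (\<rho> - \<rho>')) (at r)" for r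
        by (auto intro!: derivative_eq_intros)
      fix r assume r: "0 < r" "r < s"
      have "norm (\<Psi> r *v (\<rho> - \<rho>') r) \<le> norm (\<Psi> r) * norm ((\<rho> - \<rho>') r) * k2" by (rule k2(2))
      also have "\<dots> \<le> b\<Psi> * norm (\<rho> - \<rho>') * k2"
        using r s b\<Psi> k2(1) by (intro mult_right_mono mult_mono norm_bounded) auto
      finally show "norm (\<Psi> r *v (\<rho> - \<rho>') r) \<le> kI * norm (\<rho> - \<rho>')" by (simp add: kI_def ac_simps)
    qed (use s False D in \<open>auto intro!: continuous_intros\<close>)
    also have "\<dots> \<le> kI * norm (\<rho> - \<rho>') * 1"
      using s kI by (simp add: mult_left_le)
    finally show ?thesis using I(1) by simp
  qed
  have I0: "I 0 s = 0" for s
  proof -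
    have "(I 0 has_vector_derivative 0) (at s)" for s using I(2)[of 0 s] by (simp add: bounded_bilinear.zero_right[OF mv])
    then obtain c where "\<And>s. I 0 s = c"
      using has_vector_derivative_zero_constant[of UNIV "I 0"] by auto
    then show ?thesis using I(1)[of 0] by metis
  qed
  obtain B where B: "\<And>b. (mat 1 - \<Phi> 1) *v (\<chi> i. if i = j then 0 else (B *v b)$i) + (B *v b)$j *\<^sub>R e = b"
    using bordered_solve[OF det] by blast
  \<comment> \<open>One solve of the bordered system yields both unknowns: entry \<open>j\<close> is
    minus the period correction, the other entries are the initial value.\<close>
  define x where "x \<rho> = B *v (\<Phi> 1 *v I \<rho> 1)" for \<rho>
  define v0 where "v0 \<rho> = (\<chi> i. if i = j then 0 else x \<rho> $ i)" for \<rho>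
  define \<kappa> where "\<kappa> \<rho> = - x \<rho> $ j" for \<rho>
  \<comment> \<open>Variation of constants. The forcing in the flow direction integrates to
    \<open>(s * \<kappa> \<rho>) *\<^sub>R e\<close>, since \<open>\<Psi>\<close> maps
    \<open>\<Phi> s *v e\<close> back to \<open>e\<close>.\<close>
  define V where "V \<rho> s = \<Phi> s *v (v0 \<rho> + (s * \<kappa> \<rho>) *\<^sub>R e + I \<rho> s)" for \<rho> s
  define kx where "kx = norm B * (b\<Phi> * kI * k2) * k2"
  have kx: "kx \<ge> 0" using b\<Phi> kI k2 by (simp add: kx_def)
  have xdiff: "norm (x \<rho> - x \<rho>') \<le> kx * norm (\<rho> - \<rho>')" for \<rho> \<rho>'
  proof -
    have "norm (x \<rho> - x \<rho>') = norm (B *v (\<Phi> 1 *v (I \<rho> 1 - I \<rho>' 1)))"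
      by (simp add: x_def bounded_bilinear.diff_right[OF mv])
    also have "\<dots> \<le> norm B * norm (\<Phi> 1 *v (I \<rho> 1 - I \<rho>' 1)) * k2" by (rule k2)
    also have "\<dots> \<le> norm B * (b\<Phi> * (kI * norm (\<rho> - \<rho>')) * k2) * k2"
    proof (intro mult_right_mono mult_left_mono)
      have "norm (\<Phi> 1 *v (I \<rho> 1 - I \<rho>' 1)) \<le> norm (\<Phi> 1) * norm (I \<rho> 1 - I \<rho>' 1) * k2" by (rule k2)
      also have "\<dots> \<le> b\<Phi> * (kI * norm (\<rho> - \<rho>')) * k2"
        using b\<Phi> k2(1) Idiff[of 1] by (intro mult_right_mono mult_mono) auto
      finally show "norm (\<Phi> 1 *v (I \<rho> 1 - I \<rho>' 1)) \<le> b\<Phi> * (kI * norm (\<rho> - \<rho>')) * k2" .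
    qed (use k2 in auto)
    finally show ?thesis using k2(1) by (simp add: kx_def ac_simps)
  qed
  have \<kappa>diff: "\<bar>\<kappa> \<rho> - \<kappa> \<rho>'\<bar> \<le> kx * norm (\<rho> - \<rho>')" for \<rho> \<rho>'
    using component_le_norm_cart[of "x \<rho> - x \<rho>'" j] xdiff[of \<rho> \<rho>'] by (simp add: \<kappa>_def)
  have v0diff: "norm (v0 \<rho> - v0 \<rho>') \<le> kx * norm (\<rho> - \<rho>')" for \<rho> \<rho>'
  proof -
    have "norm (v0 \<rho> - v0 \<rho>') \<le> norm (x \<rho> - x \<rho>')"
      by (rule norm_le_componentwise_cart) (simp add: v0_def)
    then show ?thesis using xdiff[of \<rho> \<rho>'] by simp
  qed
  define K where "K = b\<Phi> * (kx + kx * norm e + kI) * k2 + kx"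
  have K: "K > 0" "K \<ge> kx"
  proof -
    have "0 < b\<Phi> * (kx + kx * norm e + kI) * k2"
      using b\<Phi>(1) kx kI k2(1) by (intro mult_pos_pos add_nonneg_pos add_nonneg_nonneg) auto
    then show "K > 0" "K \<ge> kx" using kx by (simp_all add: K_def)
  qed
  have Vdiff: "norm (V \<rho> s - V \<rho>' s) \<le> K * norm (\<rho> - \<rho>')" if s: "s \<in> {0..1}" for \<rho> \<rho>' s
  proof -
    let ?n = "norm (\<rho> - \<rho>')"
    let ?d = "(v0 \<rho> - v0 \<rho>') + (s * (\<kappa> \<rho> - \<kappa> \<rho>')) *\<^sub>R e + (I \<rho> s - I \<rho>' s)"
    have "norm ?d \<le> norm (v0 \<rho> - v0 \<rho>') + norm ((s * (\<kappa> \<rho> - \<kappa> \<rho>')) *\<^sub>R e) + norm (I \<rho> s - I \<rho>' s)"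
      by (rule norm_triangle_le) (intro add_right_mono norm_triangle_ineq)
    also have "norm ((s * (\<kappa> \<rho> - \<kappa> \<rho>')) *\<^sub>R e) \<le> 1 * (kx * ?n) * norm e"
    proof -
      have "norm ((s * (\<kappa> \<rho> - \<kappa> \<rho>')) *\<^sub>R e) = \<bar>s\<bar> * \<bar>\<kappa> \<rho> - \<kappa> \<rho>'\<bar> * norm e" by (simp add: abs_mult)
      also have "\<dots> \<le> 1 * (kx * ?n) * norm e"
        using s \<kappa>diff[of \<rho> \<rho>'] by (intro mult_right_mono mult_mono) auto
      finally show ?thesis .
    qed
    finally have d: "norm ?d \<le> (kx + kx * norm e + kI) * ?n"
      using v0diff[of \<rho> \<rho>'] Idiff[OF s, of \<rho> \<rho>'] by (simp add: algebra_simps)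
    have "V \<rho> s - V \<rho>' s = \<Phi> s *v ?d"
      by (simp add: V_def bounded_bilinear.diff_right[OF mv, symmetric] algebra_simps)
    also have "norm \<dots> \<le> norm (\<Phi> s) * norm ?d * k2" by (rule k2)
    also have "\<dots> \<le> b\<Phi> * ((kx + kx * norm e + kI) * ?n) * k2"
      using b\<Phi> s d k2(1) by (intro mult_right_mono mult_mono) auto
    also have "\<dots> \<le> K * ?n" using kx by (simp add: K_def algebra_simps)
    finally show ?thesis .
  qed
  have per: "V \<rho> 1 = V \<rho> 0" for \<rho>
  proof -
    have "(mat 1 - \<Phi> 1) *v v0 \<rho> - \<kappa> \<rho> *\<^sub>R e = \<Phi> 1 *v I \<rho> 1"
      using B[of "\<Phi> 1 *v I \<rho> 1"] unfolding v0_def \<kappa>_def x_def by simp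
    then have "v0 \<rho> = \<Phi> 1 *v v0 \<rho> + \<kappa> \<rho> *\<^sub>R e + \<Phi> 1 *v I \<rho> 1"
      by (simp add: bounded_bilinear.diff_left[OF mv] algebra_simps)
    then show ?thesis
      by (simp add: V_def \<Phi> I bounded_bilinear.add_right[OF mv] bounded_bilinear.scaleR_right[OF mv] e)
  qed
  have dV: "(V \<rho> has_vector_derivative A s *v V \<rho> s + \<kappa> \<rho> *\<^sub>R (\<Phi> s *v e) + \<rho> s) (at s)" for \<rho> s
  proof -
    let ?w = "\<lambda>s. v0 \<rho> + (s * \<kappa> \<rho>) *\<^sub>R e + I \<rho> s"
    have "(?w has_vector_derivative \<kappa> \<rho> *\<^sub>R e + \<Psi> s *v \<rho> s) (at s)"
      by (auto intro!: derivative_eq_intros I(2))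
    from bounded_bilinear.has_vector_derivative[OF mv \<Phi>(2)[of s] this]
    show ?thesis
      by (simp add: V_def[abs_def] bounded_bilinear.add_right[OF mv] bounded_bilinear.scaleR_right[OF mv]
        matrix_vector_mul_assoc inv algebra_simps)
  qed
  have x0: "x 0 = 0" by (simp add: x_def I0 bounded_bilinear.zero_right[OF mv])
  have "v0 0 = 0" by (simp add: v0_def x0 vec_eq_iff)
  then have V0: "V 0 s = 0" for s by (simp add: V_def I0 \<kappa>_def x0 bounded_bilinear.zero_right[OF mv])
  have "\<bar>\<kappa> \<rho> - \<kappa> \<rho>'\<bar> \<le> K * norm (\<rho> - \<rho>')" for \<rho> \<rho>'
    using \<kappa>diff[of \<rho> \<rho>'] mult_right_mono[OF K(2), of "norm (\<rho> - \<rho>')"] by simp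
  with that[of K V \<kappa>] K Vdiff V0 per dV show thesis by (simp add: \<kappa>_def x0)
qed

text \<open>The difference between the rescaled equation for \<open>u + v\<close> with the field \<open>h\<close> and period \<open>T + \<kappa>\<close>
  and its linearization in \<open>(v, \<kappa>)\<close> at the solution \<open>u\<close> for the field \<open>f\<close>.\<close>

definition newton_remainder ::
  "real \<Rightarrow> (real \<Rightarrow> real^'n) \<Rightarrow> (real^'n \<Rightarrow> real^'n) \<Rightarrow> (real^'n \<Rightarrow> real^'n) \<Rightarrow> real^'n \<Rightarrow> real \<Rightarrow> real \<Rightarrow> real^'n"
  where
  "newton_remainder T u f h v \<kappa> s =
     (T + \<kappa>) *\<^sub>R h (u s + v) - T *\<^sub>R f (u s) - (T *\<^sub>R jacobian f (at (u s))) *v v - \<kappa> *\<^sub>R f (u s)"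

text \<open>At the parameter 0 the linearization has been subtracted, so the derivative of the
  remainder in (v, \<kappa>) vanishes at the origin. By continuity its Lipschitz constant is as
  small as desired on a small ball and for small parameters.\<close>

lemma newton_remainder_lipschitz:
  fixes g :: "real \<Rightarrow> real^'n \<Rightarrow> real^'n" and u :: "real \<Rightarrow> real^'n" and T \<eta> d :: real
  assumes "open W" and g: "Ck_family (Suc 0) C W g" and "0 \<in> C"
    and cu: "continuous_on UNIV u" and uW: "\<And>s. u s \<in> W" and per: "\<And>s. u (s + 1) = u s"
    and "T > 0" "\<eta> > 0" "d > 0"
  obtains \<delta> where "\<delta> > 0" "\<delta> \<le> d"
    "\<And>s v. norm v \<le> \<delta> \<Longrightarrow> u s + v \<in> W"
    "\<forall>\<^sub>F c in nhds 0. c \<in> C \<longrightarrow> (\<forall>s\<in>{0..1}. \<forall>v v' \<kappa> \<kappa>'. norm v \<le> \<delta> \<and> norm v' \<le> \<delta> \<and> \<bar>\<kappa>\<bar> \<le> \<delta> \<and> \<bar>\<kappa>'\<bar> \<le> \<delta> \<longrightarrow>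
        norm (newton_remainder T u (g 0) (g c) v \<kappa> s - newton_remainder T u (g 0) (g c) v' \<kappa>' s)
          \<le> \<eta> * (norm (v - v') + \<bar>\<kappa> - \<kappa>'\<bar>))"
proof -
  note mv = bounded_bilinear_matrix_vector_mult
  obtain k where k: "k > 0" "\<And>A x. norm ((A::real^'n^'n) *v x) \<le> norm A * norm x * k"
    using norm_matrix_vector_mult_bound by blast
  have "range u \<subseteq> W" using uW by auto
  then obtain \<delta>0 where \<delta>0: "\<delta>0 > 0" "(\<Union>x\<in>range u. cball x \<delta>0) \<subseteq> W"
    using compact_subset_open_imp_cball_epsilon_subset[OF periodic_orbit_compact[OF cu per] \<open>open W\<close>] by metis
  have inW: "u s + v \<in> W" if "norm v \<le> \<delta>0" for s v
  proof -
    have "u s + v \<in> cball (u s) \<delta>0" using that by (simp add: dist_norm)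
    then show ?thesis using \<delta>0(2) by blast
  qed
  let ?P = "C \<times> cball (0::real^'n) \<delta>0"
  define G where "G p s = g (fst p) (u s + snd p)" for p :: "real \<times> (real^'n)" and s
  define J where "J p s = jacobian (g (fst p)) (at (u s + snd p))" for p :: "real \<times> (real^'n)" and s
  have cus: "continuous_on S (\<lambda>z. u (h z))" if "continuous_on S h" for S and h :: "'z::topological_space \<Rightarrow> real"
    by (rule continuous_on_compose2[OF cu that]) auto
  have cq: "continuous_on (?P \<times> {0..1}) (\<lambda>z. (fst (fst z), u (snd z) + snd (fst z)))"
    by (intro continuous_on_Pair continuous_on_add cus continuous_intros)
  have cG: "continuous_on (?P \<times> {0..1}) (\<lambda>z. G (fst z) (snd z))"
  proof -
    have "continuous_on (?P \<times> {0..1}) (\<lambda>z. (\<lambda>w. g (fst w) (snd w)) (fst (fst z), u (snd z) + snd (fst z)))"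
      by (rule continuous_on_compose2[OF Ck_family_continuous[OF g] cq]) (use inW in auto)
    then show ?thesis by (simp add: G_def)
  qed
  have cJ: "continuous_on (?P \<times> {0..1}) (\<lambda>z. J (fst z) (snd z))"
  proof -
    have "continuous_on (?P \<times> {0..1}) (\<lambda>z. (\<lambda>w. jacobian (g (fst w)) (at (snd w))) (fst (fst z), u (snd z) + snd (fst z)))"
      by (rule continuous_on_compose2[OF continuous_on_jacobian_family[OF g] cq]) (use inW in auto)
    then show ?thesis by (simp add: J_def)
  qed
  have p0: "(0, 0) \<in> ?P" using \<open>0 \<in> C\<close> \<delta>0 by simp
  have "continuous_on {0..1} (\<lambda>s. (\<lambda>z. J (fst z) (snd z)) ((0,0), s))"
    by (rule continuous_on_compose2[OF cJ]) (use p0 in \<open>auto intro!: continuous_intros\<close>)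
  then obtain b where b: "b > 0" "\<And>s. s \<in> {0..1} \<Longrightarrow> norm (J (0,0) s) \<le> b"
    by (auto dest: continuous_on_bounded_interval)
  \<comment> \<open>Bounds the deviation of both the field and its Jacobian: the first entry
    controls the coefficient of the period difference, the second makes the term multiplied by
    \<open>T\<close> contribute at most \<eta>/2.\<close>
  define \<epsilon> where "\<epsilon> = min \<eta> (\<eta> / (2 * T * k))"
  have \<epsilon>: "\<epsilon> > 0" "\<epsilon> \<le> \<eta>" "T * (\<epsilon> * k) \<le> \<eta> / 2"
  proof -
    show "\<epsilon> > 0" "\<epsilon> \<le> \<eta>" using \<open>\<eta> > 0\<close> \<open>T > 0\<close> k by (auto simp: \<epsilon>_def)
    have "T * (\<epsilon> * k) \<le> T * (\<eta> / (2 * T * k) * k)"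
      using \<open>T > 0\<close> k by (intro mult_left_mono mult_right_mono) (auto simp: \<epsilon>_def)
    also have "\<dots> = \<eta> / 2" using \<open>T > 0\<close> k by simp
    finally show "T * (\<epsilon> * k) \<le> \<eta> / 2" .
  qed
  have "\<forall>\<^sub>F p in nhds (0,0). p \<in> ?P \<longrightarrow> (\<forall>s\<in>{0..1}. dist (G p s) (G (0,0) s) < \<epsilon>)"
    by (rule family_eventually_close[OF cG]) (use p0 \<epsilon> in auto)
  moreover have "\<forall>\<^sub>F p in nhds (0,0). p \<in> ?P \<longrightarrow> (\<forall>s\<in>{0..1}. dist (J p s) (J (0,0) s) < \<epsilon>)"
    by (rule family_eventually_close[OF cJ]) (use p0 \<epsilon> in auto)
  ultimately have "\<forall>\<^sub>F p in nhds (0,0). p \<in> ?P \<longrightarrow> (\<forall>s\<in>{0..1}. dist (G p s) (G (0,0) s) < \<epsilon> \<and> dist (J p s) (J (0,0) s) < \<epsilon>)"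
    by eventually_elim auto
  then obtain \<delta>1 where \<delta>1: "\<delta>1 > 0" "\<forall>p. dist p (0,0) < \<delta>1 \<longrightarrow> p \<in> ?P \<longrightarrow> (\<forall>s\<in>{0..1}.
      dist (G p s) (G (0,0) s) < \<epsilon> \<and> dist (J p s) (J (0,0) s) < \<epsilon>)"
    unfolding eventually_nhds_metric by (elim exE conjE)
  define L where "L = \<epsilon> * k + b * k"
  have L: "L > 0" using \<epsilon> k b by (simp add: L_def add_pos_pos)
  \<comment> \<open>\<delta>0 keeps u s + v inside \<open>W\<close>, \<delta>1/3 for the vector and
    for the parameter keeps the pair within distance \<delta>1, and the last entry makes the term
    multiplied by \<kappa> contribute the other \<eta>/2.\<close>
  define \<delta> where "\<delta> = Min {d, \<delta>0, \<delta>1 / 3, \<eta> / (2 * L)}"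
  have \<delta>: "\<delta> > 0" "\<delta> \<le> d" "\<delta> \<le> \<delta>0" "\<delta> \<le> \<delta>1 / 3" "\<delta> \<le> \<eta> / (2 * L)"
    using \<open>\<eta> > 0\<close> \<open>d > 0\<close> \<delta>0(1) \<delta>1(1) L by (simp_all add: \<delta>_def)
  have near: "norm (g c (u s + v) - g 0 (u s)) < \<epsilon>" "norm (jacobian (g c) (at (u s + v)) - J (0,0) s) < \<epsilon>"
    if "c \<in> C" "\<bar>c\<bar> < \<delta>1 / 3" "norm v \<le> \<delta>" "s \<in> {0..1}" for c v and s :: real
  proof -
    have "dist (c, v) (0, 0) \<le> dist c 0 + dist v 0"
      using sqrt_sum_squares_le_sum_abs[of c "norm v"] by (simp add: dist_Pair_Pair)
    also have "\<dots> < \<delta>1" using that \<delta> \<delta>1 by simp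
    finally show "norm (g c (u s + v) - g 0 (u s)) < \<epsilon>" "norm (jacobian (g c) (at (u s + v)) - J (0,0) s) < \<epsilon>"
      using \<delta>1(2)[rule_format, of "(c, v)" s] that \<delta>(3) by (auto simp: dist_norm G_def J_def)
  qed
  have main: "norm (newton_remainder T u (g 0) (g c) v \<kappa> s - newton_remainder T u (g 0) (g c) v' \<kappa>' s)
          \<le> \<eta> * (norm (v - v') + \<bar>\<kappa> - \<kappa>'\<bar>)"
    if c: "c \<in> C" "\<bar>c\<bar> < \<delta>1 / 3" and s: "s \<in> {0..1}"
      and v: "norm v \<le> \<delta>" "norm v' \<le> \<delta>" "\<bar>\<kappa>\<bar> \<le> \<delta>" "\<bar>\<kappa>'\<bar> \<le> \<delta>" for c v v' \<kappa> \<kappa>' and s :: real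
  proof -
    let ?J = "J (0,0) s"
    let ?H = "\<lambda>v. g c (u s + v) - ?J *v v"
    have lin: "norm (?H v - ?H v') \<le> (\<epsilon> * k) * norm (v - v')"
    proof (rule differentiable_bound[of "cball 0 \<delta>"])
      fix w assume w: "w \<in> cball (0::real^'n) \<delta>"
      then have nw: "norm w \<le> \<delta>" by simp
      have "u s + w \<in> W" using inW nw \<delta> by auto
      then have dg: "(g c has_derivative (\<lambda>h. jacobian (g c) (at (u s + w)) *v h)) (at (u s + w))"
        by (rule has_derivative_jacobian[OF g c(1)])
      have "((\<lambda>v. u s + v) has_derivative (\<lambda>h. h)) (at w within cball 0 \<delta>)"
        by (auto intro!: derivative_eq_intros)
      from has_derivative_compose[OF this dg]
      have "((\<lambda>v. g c (u s + v)) has_derivative (\<lambda>h. jacobian (g c) (at (u s + w)) *v h)) (at w within cball 0 \<delta>)" .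
      moreover have "((\<lambda>v. ?J *v v) has_derivative (\<lambda>h. ?J *v h)) (at w within cball 0 \<delta>)"
        by (rule bounded_linear_imp_has_derivative) (rule matrix_vector_mul_bounded_linear)
      ultimately have "(?H has_derivative (\<lambda>h. jacobian (g c) (at (u s + w)) *v h - ?J *v h)) (at w within cball 0 \<delta>)"
        by (rule has_derivative_diff)
      then show "(?H has_derivative (\<lambda>h. (jacobian (g c) (at (u s + w)) - ?J) *v h)) (at w within cball 0 \<delta>)"
        by (simp add: bounded_bilinear.diff_left[OF mv])
      show "onorm (\<lambda>h. (jacobian (g c) (at (u s + w)) - ?J) *v h) \<le> \<epsilon> * k"
      proof (rule onorm_le)
        fix h
        have "norm ((jacobian (g c) (at (u s + w)) - ?J) *v h) \<le> norm (jacobian (g c) (at (u s + w)) - ?J) * norm h * k" by (rule k)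
        also have "\<dots> \<le> \<epsilon> * norm h * k"
          using near(2)[OF c nw s] k(1) by (intro mult_right_mono) auto
        finally show "norm ((jacobian (g c) (at (u s + w)) - ?J) *v h) \<le> \<epsilon> * k * norm h" by (simp add: ac_simps)
      qed
    qed (use v in auto)
    have gl: "norm (g c (u s + v) - g c (u s + v')) \<le> L * norm (v - v')"
    proof -
      have "g c (u s + v) - g c (u s + v') = (?H v - ?H v') + ?J *v (v - v')"
        by (simp add: bounded_bilinear.diff_right[OF mv])
      also have "norm \<dots> \<le> norm (?H v - ?H v') + norm (?J *v (v - v'))" by (rule norm_triangle_ineq)
      also have "norm (?J *v (v - v')) \<le> b * norm (v - v') * k"
      proof -
        have "norm (?J *v (v - v')) \<le> norm ?J * norm (v - v') * k" by (rule k)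
        also have "\<dots> \<le> b * norm (v - v') * k"
          using b(2)[OF s] k(1) by (intro mult_right_mono) auto
        finally show ?thesis .
      qed
      finally show ?thesis using lin by (simp add: L_def algebra_simps)
    qed
    have J0: "jacobian (g 0) (at (u s)) = ?J" by (simp add: J_def)
    \<comment> \<open>Splits the difference into the deviation of the field from its linear part, a
      term small because \<kappa> is small, and a term small because the fields are close.\<close>
    have "newton_remainder T u (g 0) (g c) v \<kappa> s - newton_remainder T u (g 0) (g c) v' \<kappa>' s =
        T *\<^sub>R (?H v - ?H v') + \<kappa> *\<^sub>R (g c (u s + v) - g c (u s + v')) + (\<kappa> - \<kappa>') *\<^sub>R (g c (u s + v') - g 0 (u s))"
      unfolding newton_remainder_def J0
      by (simp add: bounded_bilinear.scaleR_left[OF mv] algebra_simps)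
    also have "norm \<dots> \<le> norm (T *\<^sub>R (?H v - ?H v')) + norm (\<kappa> *\<^sub>R (g c (u s + v) - g c (u s + v'))) + norm ((\<kappa> - \<kappa>') *\<^sub>R (g c (u s + v') - g 0 (u s)))"
      by (rule norm_triangle_le) (intro add_right_mono norm_triangle_ineq)
    also have "norm (T *\<^sub>R (?H v - ?H v')) \<le> \<eta> / 2 * norm (v - v')"
    proof -
      have "norm (T *\<^sub>R (?H v - ?H v')) \<le> T * ((\<epsilon> * k) * norm (v - v'))"
        using lin \<open>T > 0\<close> by simp
      also have "\<dots> = T * (\<epsilon> * k) * norm (v - v')" by simp
      also have "\<dots> \<le> \<eta> / 2 * norm (v - v')" using \<epsilon>(3) by (rule mult_right_mono) simp
      finally show ?thesis .
    qed
    also have "norm (\<kappa> *\<^sub>R (g c (u s + v) - g c (u s + v'))) \<le> \<eta> / 2 * norm (v - v')"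
    proof -
      have "norm (\<kappa> *\<^sub>R (g c (u s + v) - g c (u s + v'))) \<le> \<delta> * (L * norm (v - v'))"
        using gl v(3) \<delta>(1) by (simp add: mult_mono)
      also have "\<dots> \<le> \<eta> / (2 * L) * (L * norm (v - v'))"
        using \<delta>(5) L by (intro mult_right_mono) auto
      also have "\<dots> = \<eta> / 2 * norm (v - v')" using L by simp
      finally show ?thesis .
    qed
    also have "norm ((\<kappa> - \<kappa>') *\<^sub>R (g c (u s + v') - g 0 (u s))) \<le> \<eta> * \<bar>\<kappa> - \<kappa>'\<bar>"
    proof -
      have "norm (g c (u s + v') - g 0 (u s)) \<le> \<eta>" using near(1)[OF c v(2) s] \<epsilon>(2) by linarith
      then have "\<bar>\<kappa> - \<kappa>'\<bar> * norm (g c (u s + v') - g 0 (u s)) \<le> \<bar>\<kappa> - \<kappa>'\<bar> * \<eta>"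
        by (intro mult_left_mono) auto
      then show ?thesis by (simp add: mult.commute)
    qed
    finally show ?thesis by (simp add: algebra_simps)
  qed
  have "\<forall>\<^sub>F c in nhds (0::real). \<bar>c\<bar> < \<delta>1 / 3"
    unfolding eventually_nhds_metric using \<delta>1(1) by (intro exI[of _ "\<delta>1 / 3"]) (auto simp: dist_real_def)
  then have "\<forall>\<^sub>F c in nhds 0. c \<in> C \<longrightarrow> (\<forall>s\<in>{0..1}. \<forall>v v' \<kappa> \<kappa>'. norm v \<le> \<delta> \<and> norm v' \<le> \<delta> \<and> \<bar>\<kappa>\<bar> \<le> \<delta> \<and> \<bar>\<kappa>'\<bar> \<le> \<delta> \<longrightarrow>
        norm (newton_remainder T u (g 0) (g c) v \<kappa> s - newton_remainder T u (g 0) (g c) v' \<kappa>' s)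
          \<le> \<eta> * (norm (v - v') + \<bar>\<kappa> - \<kappa>'\<bar>))"
    by eventually_elim (use main in blast)
  moreover have "u s + v \<in> W" if "norm v \<le> \<delta>" for s v
    by (rule inW) (use that \<delta>(3) in simp)
  ultimately show thesis using that[OF \<delta>(1,2)] by blast
qed


text \<open>The unknown of the contraction is the residual \<rho>, not the curve: \<rho> determines
  the correction \<open>V \<rho>\<close> and the period change \<open>\<kappa> \<rho>\<close>, and a
  fixed point of \<rho> = R (V \<rho>) (\<kappa> \<rho>) solves the nonlinear equation. The estimate
  linear in \<open>m\<close> is what later gives convergence of orbits and periods.\<close>

lemma persistent_fixed_point:
  fixes g :: "real \<Rightarrow> real^'n \<Rightarrow> real^'n" and u :: "real \<Rightarrow> real^'n"
  assumes "open W" and g: "Ck_family (Suc 0) C W g" and "0 \<in> C" and "T > 0" and uW: "\<And>s. u s \<in> W"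
    and hyp: "hyperbolic_periodic_solution U (g 0) T (\<lambda>t. u (t / T))"
  obtains K where "K > 0" "\<forall>\<^sub>F c in nhds 0. c \<in> C \<longrightarrow> (\<exists>\<sigma> y. \<sigma> > 0 \<and> y 0 = y 1 \<and>
     (\<forall>s\<in>{0..1}. y s \<in> W \<and> (y has_vector_derivative \<sigma> *\<^sub>R g c (y s)) (at s)) \<and>
     (\<forall>m. (\<forall>s\<in>{0..1}. norm (g c (u s) - g 0 (u s)) \<le> m) \<longrightarrow>
        (\<forall>s\<in>{0..1}. norm (y s - u s) \<le> K * m) \<and> \<bar>\<sigma> - T\<bar> \<le> K * m))"
proof -
  note mv = bounded_bilinear_matrix_vector_mult
  have g1: "Ck_on 1 W (g 0)" using Ck_family_imp_Ck_on[OF g \<open>0 \<in> C\<close>] by simp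
  obtain \<Phi> j where per: "\<And>s. u (s + 1) = u s"
    and du: "\<And>s. (u has_vector_derivative T *\<^sub>R g 0 (u s)) (at s)"
    and \<Phi>: "\<Phi> 0 = mat 1"
      "\<And>s. (\<Phi> has_vector_derivative (T *\<^sub>R jacobian (g 0) (at (u s))) ** \<Phi> s) (at s)"
    and det: "\<And>z. norm z = 1 \<Longrightarrow> det (bordered_char j (g 0 (u 0)) (\<Phi> 1) z) \<noteq> 0"
    by (rule hyperbolic_scaled[OF \<open>open W\<close> g1 \<open>T > 0\<close> uW hyp]) blast
  have cu: "continuous_on UNIV u"
    by (rule has_vector_derivative_imp_continuous_on[OF du])
  define A where "A s = T *\<^sub>R jacobian (g 0) (at (u s))" for s
  have cA: "continuous_on UNIV A"
  proof -
    have "continuous_on UNIV (\<lambda>s. (\<lambda>w. jacobian (g (fst w)) (at (snd w))) (0, u s))"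
      by (rule continuous_on_compose2[OF continuous_on_jacobian_family[OF g]])
        (use uW \<open>0 \<in> C\<close> in \<open>auto intro!: continuous_intros cu\<close>)
    then show ?thesis unfolding A_def by (intro continuous_intros) simp
  qed
  have perA: "A (s + 1) = A s" for s by (simp add: A_def per)
  obtain b where b: "\<And>s. norm (A s) \<le> b"
    using periodic_continuous_bounded[OF cA] perA by blast
  have w: "\<Phi> s *v g 0 (u 0) = g 0 (u s)" for s
    by (rule variational_flow_vector[OF \<open>open W\<close> g1 uW per du \<Phi>])
  have d\<Phi>: "(\<Phi> has_vector_derivative A s ** \<Phi> s) (at s)" for s using \<Phi>(2) by (simp add: A_def)
  have e: "\<Phi> 1 *v g 0 (u 0) = g 0 (u 0)" using w[of 1] per[of 0] by simp
  have det1: "det (bordered_char j (g 0 (u 0)) (\<Phi> 1) 1) \<noteq> 0" by (rule det) simp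
  obtain V :: "(real \<Rightarrow>\<^sub>C (real^'n)) \<Rightarrow> real \<Rightarrow> real^'n" and \<kappa> K where K: "K > 0"
    and V: "\<And>\<rho> \<rho>' s. s \<in> {0..1} \<Longrightarrow> norm (V \<rho> s - V \<rho>' s) \<le> K * norm (\<rho> - \<rho>')"
    and \<kappa>: "\<And>\<rho> \<rho>'. \<bar>\<kappa> \<rho> - \<kappa> \<rho>'\<bar> \<le> K * norm (\<rho> - \<rho>')"
    and V0: "\<And>s. V 0 s = 0" "\<kappa> 0 = 0" and Vper: "\<And>\<rho>. V \<rho> 1 = V \<rho> 0"
    and dV: "\<And>\<rho> s. (V \<rho> has_vector_derivative A s *v V \<rho> s + \<kappa> \<rho> *\<^sub>R (\<Phi> s *v g 0 (u 0)) + \<rho> s) (at s)"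
    by (rule linear_periodic_solution_operator[OF cA b \<Phi>(1) d\<Phi> e det1]) (rule that; assumption)
  \<comment> \<open>The curve and the period each respond to \<rho> with Lipschitz constant
    \<open>K\<close>, so 1 / (4 K) makes the composition a contraction with factor 1/2. The bound
    T/2 on the period correction keeps the new period positive.\<close>
  have \<eta>: "1 / (4 * K) > 0" "T / 2 > 0" using K \<open>T > 0\<close> by auto
  obtain \<delta> where \<delta>: "\<delta> > 0" "\<delta> \<le> T / 2" "\<And>s v. norm v \<le> \<delta> \<Longrightarrow> u s + v \<in> W"
    and lip: "\<forall>\<^sub>F c in nhds 0. c \<in> C \<longrightarrow> (\<forall>s\<in>{0..1}. \<forall>v v' \<kappa> \<kappa>'. norm v \<le> \<delta> \<and> norm v' \<le> \<delta> \<and> \<bar>\<kappa>\<bar> \<le> \<delta> \<and> \<bar>\<kappa>'\<bar> \<le> \<delta> \<longrightarrow>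
        norm (newton_remainder T u (g 0) (g c) v \<kappa> s - newton_remainder T u (g 0) (g c) v' \<kappa>' s)
          \<le> 1 / (4 * K) * (norm (v - v') + \<bar>\<kappa> - \<kappa>'\<bar>))"
    by (rule newton_remainder_lipschitz[OF \<open>open W\<close> g \<open>0 \<in> C\<close> cu uW per \<open>T > 0\<close> \<eta>]) (rule that; assumption)
  \<comment> \<open>On the ball of this radius both \<open>V \<rho>\<close> and
    \<open>\<kappa> \<rho>\<close> stay below \<delta>, where the Lipschitz estimate holds.\<close>
  define r where "r = \<delta> / K"
  have r: "r > 0" "K * r = \<delta>" using \<delta> K by (auto simp: r_def)
  have cgu: "continuous_on (C \<times> {0..1}) (\<lambda>z. g (fst z) (u (snd z)))"
  proof -
    have "continuous_on (C \<times> {0..1}) (\<lambda>z. (\<lambda>w. g (fst w) (snd w)) (fst z, u (snd z)))"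
      by (rule continuous_on_compose2[OF Ck_family_continuous[OF g]])
        (use uW in \<open>auto intro!: continuous_intros continuous_on_compose2[OF cu]\<close>)
    then show ?thesis by simp
  qed
  \<comment> \<open>Makes the remainder at \<rho> = 0 at most r/2. The contraction adds at most
    another r/2, so the ball is mapped into itself.\<close>
  have "\<forall>\<^sub>F c in nhds 0. c \<in> C \<longrightarrow> (\<forall>s\<in>{0..1}. dist (g c (u s)) (g 0 (u s)) < r / (2 * T))"
    by (rule family_eventually_close[OF cgu]) (use \<open>0 \<in> C\<close> r \<open>T > 0\<close> in auto)
  with lip have "\<forall>\<^sub>F c in nhds 0. c \<in> C \<longrightarrow> (\<exists>\<sigma> y. \<sigma> > 0 \<and> y 0 = y 1 \<and>
     (\<forall>s\<in>{0..1}. y s \<in> W \<and> (y has_vector_derivative \<sigma> *\<^sub>R g c (y s)) (at s)) \<and>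
     (\<forall>m. (\<forall>s\<in>{0..1}. norm (g c (u s) - g 0 (u s)) \<le> m) \<longrightarrow>
        (\<forall>s\<in>{0..1}. norm (y s - u s) \<le> 2 * T * K * m) \<and> \<bar>\<sigma> - T\<bar> \<le> 2 * T * K * m))"
  proof eventually_elim
    case (elim c)
    show ?case
    proof
      assume c: "c \<in> C"
      define R where "R v k s = newton_remainder T u (g 0) (g c) v k s" for v k s
      \<comment> \<open>The residual has to be a bounded continuous function on the line, but the
        remainder is controlled only for times in \<open>{0..1}\<close>. Clamping reconciles both;
        the fixed point therefore solves the equation on \<open>{0..1}\<close> only.\<close>
      define cl where "cl s = max 0 (min 1 s)" for s :: real
      have cl: "cl s \<in> {0..1}" for s by (auto simp: cl_def)
      have ccl: "continuous_on UNIV cl" unfolding cl_def by (intro continuous_intros)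
      define N where "N \<rho> = Bcontfun (\<lambda>s. R (V \<rho> (cl s)) (\<kappa> \<rho>) (cl s))" for \<rho>
      have small: "norm (V \<rho> s) \<le> K * norm \<rho>" "\<bar>\<kappa> \<rho>\<bar> \<le> K * norm \<rho>" if "s \<in> {0..1}" for \<rho> s
        using V[OF that, of \<rho> 0] \<kappa>[of \<rho> 0] V0 by auto
      have small': "norm (V \<rho> s) \<le> \<delta>" "\<bar>\<kappa> \<rho>\<bar> \<le> \<delta>" if "s \<in> {0..1}" "norm \<rho> \<le> r" for \<rho> s
        using small[OF that(1), of \<rho>] mult_left_mono[OF that(2), of K] K r(2) by auto
      have Rdiff: "norm (R (V \<rho> s) (\<kappa> \<rho>) s - R (V \<rho>' s) (\<kappa> \<rho>') s) \<le> 1/2 * norm (\<rho> - \<rho>')"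
        if s: "s \<in> {0..1}" and n: "norm \<rho> \<le> r" "norm \<rho>' \<le> r" for \<rho> \<rho>' s
      proof -
        have "norm (R (V \<rho> s) (\<kappa> \<rho>) s - R (V \<rho>' s) (\<kappa> \<rho>') s)
            \<le> 1 / (4 * K) * (norm (V \<rho> s - V \<rho>' s) + \<bar>\<kappa> \<rho> - \<kappa> \<rho>'\<bar>)"
          using elim(1) c s small'[OF s n(1)] small'[OF s n(2)] unfolding R_def by blast
        also have "\<dots> \<le> 1 / (4 * K) * (K * norm (\<rho> - \<rho>') + K * norm (\<rho> - \<rho>'))"
          using K by (intro mult_left_mono add_mono V[OF s] \<kappa>) auto
        also have "\<dots> = 1/2 * norm (\<rho> - \<rho>')" using K by simp
        finally show ?thesis .
      qed
      have R0: "R 0 0 s = T *\<^sub>R (g c (u s) - g 0 (u s))" for s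
        by (simp add: R_def newton_remainder_def scaleR_right_diff_distrib bounded_bilinear.zero_right[OF mv])
      have Rbound: "norm (R (V \<rho> s) (\<kappa> \<rho>) s) \<le> T * m + 1/2 * norm \<rho>"
        if s: "s \<in> {0..1}" and n: "norm \<rho> \<le> r" and m: "norm (g c (u s) - g 0 (u s)) \<le> m" for \<rho> s m
      proof -
        have "norm (R (V \<rho> s) (\<kappa> \<rho>) s) \<le> norm (R 0 0 s) + norm (R (V \<rho> s) (\<kappa> \<rho>) s - R 0 0 s)"
          by (rule norm_triangle_sub)
        also have "norm (R 0 0 s) \<le> T * m" using m \<open>T > 0\<close> by (simp add: R0)
        also have "norm (R (V \<rho> s) (\<kappa> \<rho>) s - R 0 0 s) \<le> 1/2 * norm \<rho>"
          using Rdiff[OF s n, of 0] V0 r by simp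
        finally show ?thesis by simp
      qed
      have gr: "norm (g c (u s) - g 0 (u s)) \<le> r / (2 * T)" if "s \<in> {0..1}" for s
        using elim(2) c that by (auto simp: dist_norm less_imp_le)
      have Rr: "norm (R (V \<rho> s) (\<kappa> \<rho>) s) \<le> r" if "s \<in> {0..1}" "norm \<rho> \<le> r" for \<rho> s
        using Rbound[OF that gr[OF that(1)]] that(2) \<open>T > 0\<close> by simp
      have N: "apply_bcontfun (N \<rho>) = (\<lambda>s. R (V \<rho> (cl s)) (\<kappa> \<rho>) (cl s))" if n: "norm \<rho> \<le> r" for \<rho>
        unfolding N_def
      proof (rule Bcontfun_inverse, rule bcontfun_normI)
        have cV: "continuous_on UNIV (V \<rho>)"
          by (rule has_vector_derivative_imp_continuous_on[OF dV])
        have cg0: "continuous_on UNIV (\<lambda>s. g 0 (u (cl s)))"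
          by (rule continuous_on_compose2[OF Ck_family_continuous_fixed[OF g \<open>0 \<in> C\<close>]])
            (use uW in \<open>auto intro!: continuous_on_compose2[OF cu] ccl\<close>)
        have "continuous_on UNIV (\<lambda>s. u (cl s) + V \<rho> (cl s))"
          by (intro continuous_intros continuous_on_compose2[OF cu ccl] continuous_on_compose2[OF cV ccl]) auto
        then have cgc: "continuous_on UNIV (\<lambda>s. g c (u (cl s) + V \<rho> (cl s)))"
          by (rule continuous_on_compose2[OF Ck_family_continuous_fixed[OF g c]])
            (use \<delta>(3) small'[OF cl n] in auto)
        have cAcl: "continuous_on UNIV (\<lambda>s. A (cl s) *v V \<rho> (cl s))"
          by (intro continuous_on_matrix_vector_mult continuous_on_compose2[OF cA ccl] continuous_on_compose2[OF cV ccl]) auto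
        show "continuous_on UNIV (\<lambda>s. R (V \<rho> (cl s)) (\<kappa> \<rho>) (cl s))"
          unfolding R_def newton_remainder_def A_def[symmetric]
          by (intro continuous_intros cg0 cgc cAcl)
        show "norm (R (V \<rho> (cl s)) (\<kappa> \<rho>) (cl s)) \<le> r" for s by (rule Rr[OF cl n])
      qed
      have "\<exists>!\<rho>\<in>cball 0 r. N \<rho> = \<rho>"
      proof (rule Banach_fix[where c="1/2"])
        show "complete (cball (0::real \<Rightarrow>\<^sub>C (real^'n)) r)" by (simp add: complete_eq_closed)
        show "cball (0::real \<Rightarrow>\<^sub>C (real^'n)) r \<noteq> {}" using r by simp
        show "N ` cball 0 r \<subseteq> cball 0 r"
          by (auto simp: N intro!: norm_bound Rr[OF cl])
        fix \<rho> \<rho>' :: "real \<Rightarrow>\<^sub>C (real^'n)" assume \<rho>: "\<rho> \<in> cball 0 r" "\<rho>' \<in> cball 0 r"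
        then have n: "norm \<rho> \<le> r" "norm \<rho>' \<le> r" by auto
        show "dist (N \<rho>) (N \<rho>') \<le> 1/2 * dist \<rho> \<rho>'"
          by (rule dist_bound) (use Rdiff[OF cl n] in \<open>simp add: N n dist_norm\<close>)
      qed auto
      then obtain \<rho> where \<rho>: "norm \<rho> \<le> r" "N \<rho> = \<rho>" by auto
      have \<rho>s: "\<rho> s = R (V \<rho> s) (\<kappa> \<rho>) s" if "s \<in> {0..1}" for s
      proof -
        have "cl s = s" using that by (auto simp: cl_def)
        then show ?thesis using N[OF \<rho>(1)] \<rho>(2) by metis
      qed
      define y where "y s = u s + V \<rho> s" for s
      define \<sigma> where "\<sigma> = T + \<kappa> \<rho>"
      have \<kappa>\<rho>: "\<bar>\<kappa> \<rho>\<bar> \<le> \<delta>" using small'(2)[of 0 \<rho>] \<rho> by simp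
      have 1: "\<sigma> > 0" using \<kappa>\<rho> \<delta>(2) \<open>T > 0\<close> by (simp add: \<sigma>_def abs_le_iff)
      have 2: "y 0 = y 1" using Vper[of \<rho>] per[of 0] by (simp add: y_def)
      have 3: "y s \<in> W" "(y has_vector_derivative \<sigma> *\<^sub>R g c (y s)) (at s)" if s: "s \<in> {0..1}" for s
      proof -
        show "y s \<in> W" using \<delta>(3) small'(1)[OF s \<rho>(1)] by (simp add: y_def)
        have "(y has_vector_derivative T *\<^sub>R g 0 (u s) + (A s *v V \<rho> s + \<kappa> \<rho> *\<^sub>R g 0 (u s) + \<rho> s)) (at s)"
          unfolding y_def using has_vector_derivative_add[OF du dV] by (simp add: w)
        moreover have "T *\<^sub>R g 0 (u s) + (A s *v V \<rho> s + \<kappa> \<rho> *\<^sub>R g 0 (u s) + \<rho> s) = \<sigma> *\<^sub>R g c (y s)"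
          unfolding \<rho>s[OF s] R_def newton_remainder_def A_def y_def \<sigma>_def by (simp add: algebra_simps)
        ultimately show "(y has_vector_derivative \<sigma> *\<^sub>R g c (y s)) (at s)" by simp
      qed
      have 4: "(\<forall>s\<in>{0..1}. norm (y s - u s) \<le> 2 * T * K * m) \<and> \<bar>\<sigma> - T\<bar> \<le> 2 * T * K * m"
        if m: "\<forall>s\<in>{0..1}. norm (g c (u s) - g 0 (u s)) \<le> m" for m
      proof -
        \<comment> \<open>An a priori bound from the fixed point equation: half of the norm is
          absorbed on the left. With m = 0 it forces \<rho> = 0, which identifies the solution at
          the parameter 0 with \<open>u\<close>.\<close>
        have "norm (\<rho> s) \<le> T * m + 1/2 * norm \<rho>" for s
        proof -
          have "\<rho> s = R (V \<rho> (cl s)) (\<kappa> \<rho>) (cl s)" using N[OF \<rho>(1)] \<rho>(2) by metis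
          then show ?thesis using Rbound[OF cl \<rho>(1)] m cl by metis
        qed
        then have "norm \<rho> \<le> T * m + 1/2 * norm \<rho>" by (rule norm_bound)
        then have "norm \<rho> \<le> 2 * T * m" by simp
        then have "K * norm \<rho> \<le> 2 * T * K * m" using mult_left_mono[of "norm \<rho>" "2 * T * m" K] K by (simp add: ac_simps)
        moreover have "norm (y s - u s) \<le> K * norm \<rho>" if "s \<in> {0..1}" for s
          using small(1)[OF that, of \<rho>] by (simp add: y_def)
        moreover have "\<bar>\<sigma> - T\<bar> \<le> K * norm \<rho>" using small(2)[of 0 \<rho>] by (simp add: \<sigma>_def)
        ultimately show ?thesis by (meson order_trans)
      qed
      show "\<exists>\<sigma> y. \<sigma> > 0 \<and> y 0 = y 1 \<and>
        (\<forall>s\<in>{0..1}. y s \<in> W \<and> (y has_vector_derivative \<sigma> *\<^sub>R g c (y s)) (at s)) \<and>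
        (\<forall>m. (\<forall>s\<in>{0..1}. norm (g c (u s) - g 0 (u s)) \<le> m) \<longrightarrow>
          (\<forall>s\<in>{0..1}. norm (y s - u s) \<le> 2 * T * K * m) \<and> \<bar>\<sigma> - T\<bar> \<le> 2 * T * K * m)"
        by (intro exI[of _ \<sigma>] exI[of _ y] conjI ballI allI impI 1 2 3) (use 4 in blast)+
    qed
  qed
  moreover have "2 * T * K > 0" using K \<open>T > 0\<close> by simp
  ultimately show thesis using that by blast
qed

text \<open>For an autonomous equation, equal end values have equal velocities, so at an integer the
  derivatives from the left and from the right agree and the glued curve is differentiable.\<close>

lemma periodic_extension_derivative:
  fixes y :: "real \<Rightarrow> 'a::real_normed_vector"
  assumes "y 0 = y 1" and d: "\<And>s. s \<in> {0..1} \<Longrightarrow> (y has_vector_derivative F (y s)) (at s)"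
  shows "((\<lambda>s. y (frac s)) has_vector_derivative F (y (frac s))) (at s)"
proof -
  define w where "w s = y (frac s)" for s
  have w: "w x = y (x - of_int n)" if "x \<in> {of_int n..of_int n + 1}" for x and n :: int
  proof (cases "x = of_int n + 1")
    case True
    then have "x = of_int (n + 1)" by simp
    then have "frac x = 0" by (simp only: frac_of_int)
    then show ?thesis using True assms(1) by (simp add: w_def)
  next
    case False
    then have "\<lfloor>x\<rfloor> = n" using that by (auto simp: floor_eq_iff)
    then show ?thesis by (simp add: w_def frac_def)
  qed
  have wd: "(w has_vector_derivative F (w x)) (at x within {of_int n..of_int n + 1})"
    if x: "x \<in> {of_int n..of_int n + 1}" for x and n :: int
  proof -
    have "((y \<circ> (\<lambda>x. x - of_int n)) has_vector_derivative 1 *\<^sub>R F (y (x - of_int n))) (at x)"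
      by (rule vector_diff_chain_at) (use x in \<open>auto intro!: derivative_eq_intros d\<close>)
    then have "((\<lambda>x. y (x - of_int n)) has_vector_derivative F (w x)) (at x within {of_int n..of_int n + 1})"
      using w[OF x] by (simp add: o_def has_vector_derivative_at_within)
    then show ?thesis
      by (rule has_vector_derivative_transform[OF x, rotated]) (rule w)
  qed
  define n where "n = \<lfloor>s\<rfloor>"
  have n: "of_int n \<le> s" "s < of_int n + 1" by (auto simp: n_def)
  have "(w has_vector_derivative F (w s)) (at s)"
  proof (cases "s = of_int n")
    case False
    then have "at s within {of_int n..of_int n + 1} = at s" using n by (intro at_within_interior) auto
    then show ?thesis using wd[of s n] n by simp
  next
    case True
    have "(w has_vector_derivative F (w s)) (at s within {of_int n..of_int n + 1})"
      "(w has_vector_derivative F (w s)) (at s within {of_int n - 1..of_int n})"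
      using wd[of s n] wd[of s "n - 1"] True by auto
    then have "(w has_vector_derivative F (w s)) (at s within ({of_int n - 1..of_int n} \<union> {of_int n..of_int n + 1}))"
      by (simp only: has_vector_derivative_def has_derivative_within Lim_within_Un simp_thms)
    moreover have "{of_int n - 1..of_int n} \<union> {of_int n..of_int n + 1} = {of_int n - 1..of_int n + 1 :: real}" by auto
    moreover have "at s within {of_int n - 1..of_int n + 1} = at s" using True by (intro at_within_interior) auto
    ultimately show ?thesis by simp
  qed
  then show ?thesis by (simp add: w_def[abs_def])
qed

text \<open>\<open>C'\<close> collects the parameters for which the fixed point exists. The
  solutions are chosen one parameter at a time; joint continuity holds nevertheless, because nonzero
  parameters are isolated and the estimate in \<open>m\<close> gives convergence at 0.\<close>

lemma periodic_solution_persists: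
  fixes g :: "real \<Rightarrow> real^'n \<Rightarrow> real^'n" and u :: "real \<Rightarrow> real^'n"
  assumes C: "C \<subseteq> harmonic_set" "0 \<in> C" and "open W" and g: "Ck_family (Suc 0) C W g"
    and "T > 0" and uW: "\<And>s. u s \<in> W"
    and hyp: "hyperbolic_periodic_solution U (g 0) T (\<lambda>t. u (t / T))"
  obtains C' S v where "C' \<subseteq> C" "0 \<in> C'" "\<forall>\<^sub>F c in nhds 0. c \<in> C \<longrightarrow> c \<in> C'" "S 0 = T" "v 0 = u"
    "continuous_on C' S" "\<And>c. c \<in> C' \<Longrightarrow> S c > 0"
    "continuous_on (C' \<times> UNIV) (\<lambda>z. v (fst z) (snd z))"
    "\<And>c s. c \<in> C' \<Longrightarrow> v c s \<in> W" "\<And>c s. c \<in> C' \<Longrightarrow> v c (s + 1) = v c s"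
    "\<And>c s. c \<in> C' \<Longrightarrow> (v c has_vector_derivative S c *\<^sub>R g c (v c s)) (at s)"
proof -
  have g1: "Ck_on 1 W (g 0)" using Ck_family_imp_Ck_on[OF g \<open>0 \<in> C\<close>] by simp
  obtain per: "\<And>s. u (s + 1) = u s" and du: "\<And>s. (u has_vector_derivative T *\<^sub>R g 0 (u s)) (at s)"
    by (rule hyperbolic_scaled[OF \<open>open W\<close> g1 \<open>T > 0\<close> uW hyp]) (rule that; assumption)
  have cu: "continuous_on UNIV u"
    by (rule has_vector_derivative_imp_continuous_on[OF du])
  obtain K where K: "K > 0" "\<forall>\<^sub>F c in nhds 0. c \<in> C \<longrightarrow> (\<exists>\<sigma> y. \<sigma> > 0 \<and> y 0 = y 1 \<and>
     (\<forall>s\<in>{0..1}. y s \<in> W \<and> (y has_vector_derivative \<sigma> *\<^sub>R g c (y s)) (at s)) \<and>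
     (\<forall>m. (\<forall>s\<in>{0..1}. norm (g c (u s) - g 0 (u s)) \<le> m) \<longrightarrow>
        (\<forall>s\<in>{0..1}. norm (y s - u s) \<le> K * m) \<and> \<bar>\<sigma> - T\<bar> \<le> K * m))"
    by (rule persistent_fixed_point[OF \<open>open W\<close> g \<open>0 \<in> C\<close> \<open>T > 0\<close> uW hyp]) blast
  define Q where "Q c \<sigma> y \<longleftrightarrow> \<sigma> > 0 \<and> y 0 = y 1 \<and>
     (\<forall>s\<in>{0..1}. y s \<in> W \<and> (y has_vector_derivative \<sigma> *\<^sub>R g c (y s)) (at s)) \<and>
     (\<forall>m. (\<forall>s\<in>{0..1}. norm (g c (u s) - g 0 (u s)) \<le> m) \<longrightarrow>
        (\<forall>s\<in>{0..1}. norm (y s - u s) \<le> K * m) \<and> \<bar>\<sigma> - T\<bar> \<le> K * m)" for c \<sigma> y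
  define C' where "C' = {c \<in> C. \<exists>\<sigma> y. Q c \<sigma> y}"
  have ev: "\<forall>\<^sub>F c in nhds 0. c \<in> C \<longrightarrow> c \<in> C'"
    using K(2) unfolding C'_def Q_def by simp
  have "\<forall>c\<in>C'. \<exists>p. Q c (fst p) (snd p)" by (auto simp: C'_def)
  then obtain p where "\<forall>c\<in>C'. Q c (fst (p c)) (snd (p c))" by (rule bchoice[THEN exE])
  then obtain S y where Sy: "\<And>c. c \<in> C' \<Longrightarrow> Q c (S c) (y c)"
    using that[of "fst \<circ> p" "snd \<circ> p"] by simp
  have 0: "0 \<in> C'" using eventually_nhds_x_imp_x[OF ev] \<open>0 \<in> C\<close> by simp
  define v where "v c s = y c (frac s)" for c s
  have frac01: "frac s \<in> {0..1}" for s :: real using frac_lt_1[of s] by auto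
  have close: "dist (v c s) (u s) \<le> K * m \<and> dist (S c) T \<le> K * m"
    if c: "c \<in> C'" and m: "\<forall>s\<in>{0..1}. dist (g c (u s)) (g 0 (u s)) \<le> m" for c m s
  proof -
    have *: "(\<forall>s\<in>{0..1}. norm (y c s - u s) \<le> K * m) \<and> \<bar>S c - T\<bar> \<le> K * m"
      using Sy[OF c] m unfolding Q_def dist_norm by blast
    have "norm (y c (frac s) - u (frac s)) \<le> K * m" using * frac01 by blast
    moreover have "u (frac s) = u s" by (rule periodic_eq_frac[of u, OF per])
    ultimately show ?thesis using * by (simp add: v_def dist_norm)
  qed
  \<comment> \<open>At the parameter 0 the field difference vanishes, so the estimate applies with m
    = 0.\<close>
  have v0: "v 0 = u" and S0: "S 0 = T"
    using close[OF 0, of 0] by auto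
  have dv: "(v c has_vector_derivative S c *\<^sub>R g c (v c s)) (at s)" if "c \<in> C'" for c s
    unfolding v_def using Sy[OF that] by (intro periodic_extension_derivative) (auto simp: Q_def)
  have cv: "continuous_on UNIV (v c)" if "c \<in> C'" for c
    by (rule has_vector_derivative_imp_continuous_on[OF dv[OF that]])
  have cgu: "continuous_on (C \<times> {0..1}) (\<lambda>z. g (fst z) (u (snd z)))"
  proof -
    have "continuous_on (C \<times> {0..1}) (\<lambda>z. (\<lambda>w. g (fst w) (snd w)) (fst z, u (snd z)))"
      by (rule continuous_on_compose2[OF Ck_family_continuous[OF g]])
        (use uW in \<open>auto intro!: continuous_intros continuous_on_compose2[OF cu]\<close>)
    then show ?thesis by simp
  qed
  have lim: "\<exists>d>0. \<forall>c\<in>C'. c < d \<longrightarrow> (\<forall>s. dist (v c s) (u s) < e \<and> dist (S c) T < e)" if "e > 0" for e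
  proof -
    have "\<forall>\<^sub>F c in nhds 0. c \<in> C \<longrightarrow> (\<forall>s\<in>{0..1}. dist (g c (u s)) (g 0 (u s)) < e / (2 * K))"
      by (rule family_eventually_close[OF cgu]) (use \<open>0 \<in> C\<close> K that in auto)
    then obtain d where d: "d > 0" "\<forall>c. dist c 0 < d \<longrightarrow> c \<in> C \<longrightarrow> (\<forall>s\<in>{0..1}. dist (g c (u s)) (g 0 (u s)) < e / (2 * K))"
      unfolding eventually_nhds_metric by (elim exE conjE)
    have "dist (v c s) (u s) < e \<and> dist (S c) T < e" if c: "c \<in> C'" "c < d" for c s
    proof -
      have "c \<in> C" "dist c 0 < d" using c harmonic_set_nonneg[of c] C(1) by (auto simp: C'_def dist_real_def)
      then have "\<forall>s\<in>{0..1}. dist (g c (u s)) (g 0 (u s)) \<le> e / (2 * K)" using d(2) by (auto intro: less_imp_le)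
      from close[OF c(1) this, of s] show ?thesis using K(1) \<open>e > 0\<close> by simp
    qed
    with d(1) show ?thesis by blast
  qed
  have "continuous_on (C' \<times> (UNIV :: real set)) (\<lambda>z. S (fst z))"
  proof (rule continuous_on_harmonic_family[where h="\<lambda>c _. S c"])
    show "C' \<subseteq> harmonic_set" using C by (auto simp: C'_def)
    fix x e :: real assume "e > 0"
    then obtain d where "d > 0" "\<forall>c\<in>C'. c < d \<longrightarrow> (\<forall>s. dist (v c s) (u s) < e \<and> dist (S c) T < e)"
      using lim by blast
    then show "\<exists>d>0. \<forall>c\<in>C'. \<forall>y\<in>UNIV. c \<noteq> 0 \<longrightarrow> c < d \<longrightarrow> dist y x < d \<longrightarrow> dist (S c) (S 0) < e"
      unfolding S0 by blast
  qed simp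
  then have "continuous_on C' (\<lambda>c. (\<lambda>z. S (fst z)) (c, 0::real))"
    by (rule continuous_on_compose2) (auto intro!: continuous_intros)
  then have cS: "continuous_on C' S" by simp
  have cvv: "continuous_on (C' \<times> UNIV) (\<lambda>z. v (fst z) (snd z))"
  proof (rule continuous_on_harmonic_family)
    show "C' \<subseteq> harmonic_set" using C by (auto simp: C'_def)
    fix x e :: real assume "e > 0"
    obtain d1 where d1: "d1 > 0" "\<forall>c\<in>C'. c < d1 \<longrightarrow> (\<forall>s. dist (v c s) (u s) < e/2 \<and> dist (S c) T < e/2)"
      using lim[of "e/2"] \<open>e > 0\<close> by auto
    obtain d2 where d2: "d2 > 0" "\<And>y. dist y x < d2 \<Longrightarrow> dist (u y) (u x) < e/2"
      using cu \<open>e > 0\<close> unfolding continuous_on_iff by (metis UNIV_I half_gt_zero)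
    have "dist (v c z) (v 0 x) < e" if "c \<in> C'" "c < min d1 d2" "dist z x < min d1 d2" for c z
      using d1(2)[rule_format, of c z] d2(2)[of z] that dist_triangle[of "v c z" "u x" "u z"] by (simp add: v0)
    then show "\<exists>d>0. \<forall>c\<in>C'. \<forall>y\<in>UNIV. c \<noteq> 0 \<longrightarrow> c < d \<longrightarrow> dist y x < d \<longrightarrow> dist (v c y) (v 0 x) < e"
      using d1 d2 by (intro exI[of _ "min d1 d2"]) auto
  qed (rule cv)
  show thesis
  proof (rule that[of C' S v])
    show "v c (s + 1) = v c s" if "c \<in> C'" for c s by (simp add: v_def frac_1_eq)
    show "v c s \<in> W" if "c \<in> C'" for c s using Sy[OF that] frac01 by (auto simp: v_def Q_def)
    show "S c > 0" if "c \<in> C'" for c using Sy[OF that] by (simp add: Q_def)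
    show "C' \<subseteq> C" by (auto simp: C'_def)
  qed (fact 0 ev S0 v0 cS cvv dv)+
qed

section \<open>Generic avoidance of zeros\<close>

lemma differentiable_on_sum:
  "(\<And>i. i \<in> I \<Longrightarrow> f i differentiable_on S) \<Longrightarrow> (\<lambda>x. \<Sum>i\<in>I. f i x) differentiable_on S"
  by (induction I rule: infinite_finite_induct) (auto intro!: differentiable_on_add)

text \<open>By Cramer's rule the bad vectors \<open>d\<close> form a differentiable image of a set of lower dimension.\<close>

lemma avoid_zero_step:
  fixes b :: "'m::euclidean_space \<Rightarrow> real^3" and L :: "'m \<Rightarrow> real^3^3"
  assumes dim: "DIM('m) < 3"
    and b: "\<And>i. (\<lambda>x. b x $ i) differentiable_on K"
    and L: "\<And>i l. (\<lambda>x. L x $ i $ l) differentiable_on K"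
    and det: "\<And>x. x \<in> K \<Longrightarrow> det (L x) \<noteq> 0" and "\<epsilon> > 0"
  obtains d where "norm d < \<epsilon>" "\<And>x. x \<in> K \<Longrightarrow> b x + L x *v d \<noteq> 0"
proof -
  define F where "F k x = det (\<chi> i l. if l = k then (- b x) $ i else L x $ i $ l) / det (L x)" for k x
  have ent: "(\<lambda>x. if l = k then (- b x) $ i else L x $ i $ l) differentiable_on K" for k l i
    using b L by (cases "l = k") (auto intro: differentiable_on_minus)
  have num: "(\<lambda>x. det (\<chi> i l. if l = k then (- b x) $ i else L x $ i $ l)) differentiable_on K" for k
    by (simp only: det_3 vec_lambda_beta)
      (intro differentiable_on_mult differentiable_on_add differentiable_on_diff ent)
  have den: "(\<lambda>x. det (L x)) differentiable_on K"
    unfolding det_3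
    by (intro differentiable_on_mult differentiable_on_add differentiable_on_diff L)
  have "F k differentiable_on K" for k
    unfolding F_def divide_inverse
    by (intro differentiable_on_mult num differentiable_on_inverse den det)
  then have *: "(\<lambda>x. \<Sum>k\<in>UNIV. F k x *\<^sub>R (axis k 1 :: real^3)) differentiable_on K"
    by (intro differentiable_on_sum differentiable_on_scaleR) auto
  then have "(\<lambda>x. \<chi> k. F k x) differentiable_on K"
  proof -
    have "(\<Sum>k\<in>UNIV. F k x *\<^sub>R (axis k 1 :: real^3)) = (\<chi> k. F k x)" for x
      using basis_expansion[of "\<chi> k. F k x"] by (simp add: scalar_mult_eq_scaleR)
    with * show ?thesis by (simp only:)
  qed
  then have neg: "negligible ((\<lambda>x. \<chi> k. F k x) ` K)"
    by (rule negligible_differentiable_image_lowdim[rotated]) (use dim in simp)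
  have "\<not> negligible (ball (0::real^3) \<epsilon>)"
    by (rule open_not_negligible) (use \<open>\<epsilon> > 0\<close> in auto)
  then have "\<not> ball 0 \<epsilon> \<subseteq> (\<lambda>x. \<chi> k. F k x) ` K"
    using negligible_subset[OF neg] by blast
  then obtain d where "d \<in> ball 0 \<epsilon>" and d2: "d \<notin> (\<lambda>x. \<chi> k. F k x) ` K" by blast
  then have d: "norm d < \<epsilon>" by simp
  have "b x + L x *v d \<noteq> 0" if "x \<in> K" for x
  proof
    assume "b x + L x *v d = 0"
    then have "L x *v d = - b x" by (simp add: eq_neg_iff_add_eq_0 add.commute)
    then have "d = (\<chi> k. F k x)" unfolding F_def by (rule cramer[OF det[OF that], THEN iffD1])
    with d2 that show False by blast
  qed
  with d that show thesis by blast
qed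

text \<open>Induction over the compact patches: three coefficients whose determinant is nonzero on
  the new patch are adjusted there, by so little that zeros already avoided on the earlier patches
  stay avoided. Different patches may use different triples.\<close>

lemma avoid_zeros_finite:
  fixes b :: "'j \<Rightarrow> 'm::euclidean_space \<Rightarrow> real^3" and L :: "'j \<Rightarrow> 'q \<Rightarrow> 'm \<Rightarrow> real^3"
  assumes "finite J" "finite B" and dim: "DIM('m) < 3"
    and K: "\<And>j. j \<in> J \<Longrightarrow> compact (K j)"
    and b: "\<And>j i. j \<in> J \<Longrightarrow> (\<lambda>x. b j x $ i) differentiable_on K j"
    and L: "\<And>j q i. j \<in> J \<Longrightarrow> q \<in> B \<Longrightarrow> (\<lambda>x. L j q x $ i) differentiable_on K j"
    and det: "\<And>j. j \<in> J \<Longrightarrow> \<exists>q :: 3 \<Rightarrow> 'q. range q \<subseteq> B \<and> (\<forall>x\<in>K j. det (\<chi> i l. L j (q l) x $ i) \<noteq> 0)"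
    and "\<epsilon> > 0"
  shows "\<exists>c. (\<forall>q. \<bar>c q\<bar> < \<epsilon>) \<and> (\<forall>j\<in>J. \<forall>x\<in>K j. b j x + (\<Sum>q\<in>B. c q *\<^sub>R L j q x) \<noteq> 0)"
  using assms(1) K b L det \<open>\<epsilon> > 0\<close>
proof (induction J arbitrary: \<epsilon>)
  case empty
  then show ?case by (intro exI[of _ "\<lambda>_. 0"]) auto
next
  case (insert j J)
  have "\<exists>c. (\<forall>q. \<bar>c q\<bar> < \<epsilon>/2) \<and> (\<forall>j\<in>J. \<forall>x\<in>K j. b j x + (\<Sum>q\<in>B. c q *\<^sub>R L j q x) \<noteq> 0)"
    by (rule insert.IH) (use insert.prems in auto)
  then obtain c where c: "\<And>q. \<bar>c q\<bar> < \<epsilon>/2" "\<And>j x. j \<in> J \<Longrightarrow> x \<in> K j \<Longrightarrow> b j x + (\<Sum>q\<in>B. c q *\<^sub>R L j q x) \<noteq> 0"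
    by blast
  obtain q :: "3 \<Rightarrow> 'q" where q: "range q \<subseteq> B" "\<And>x. x \<in> K j \<Longrightarrow> det (\<chi> i l. L j (q l) x $ i) \<noteq> 0"
    using insert.prems(4)[of j] by auto
  define F where "F i x = b i x + (\<Sum>q\<in>B. c q *\<^sub>R L i q x)" for i x
  define M :: "'j \<Rightarrow> 'm \<Rightarrow> real^3^3" where "M i x = (\<chi> k l. L i (q l) x $ k)" for i x
  have M: "M i x *v d = (\<Sum>l\<in>UNIV. d $ l *\<^sub>R L i (q l) x)" for i x d
    by (simp add: M_def matrix_vector_mult_def vec_eq_iff mult.commute)
  have dF: "(\<lambda>x. F i x $ k) differentiable_on K i" if "i \<in> insert j J" for i k
    unfolding F_def using insert.prems(2,3) that
    by (auto intro!: differentiable_on_add differentiable_on_sum differentiable_on_mult simp: \<open>finite B\<close>)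
  have dM: "(\<lambda>x. M i x $ k $ l) differentiable_on K i" if "i \<in> insert j J" for i k l
    using insert.prems(3)[OF that, of "q l" k] q(1) by (auto simp: M_def)
  \<comment> \<open>On an earlier patch the norm has a positive minimum by compactness, which a
    small change of coefficients cannot consume.\<close>
  have old: "\<forall>\<^sub>F d in nhds 0. \<forall>x\<in>K i. F i x + M i x *v d \<noteq> 0" if i: "i \<in> J" for i
  proof -
    have cF: "continuous_on (K i) (F i)"
    proof -
      have "continuous_on (K i) (\<lambda>x. \<chi> k. F i x $ k)"
        using dF i by (intro continuous_on_vec_lambda differentiable_imp_continuous_on) auto
      then show ?thesis by simp
    qed
    have cM: "continuous_on (K i) (M i)"
    proof -
      have "continuous_on (K i) (\<lambda>x. \<chi> k l. M i x $ k $ l)"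
        using dM i by (intro continuous_on_vec_lambda differentiable_imp_continuous_on) auto
      then show ?thesis by simp
    qed
    have cG: "continuous_on (UNIV \<times> K i) (\<lambda>z. F i (snd z) + M i (snd z) *v fst z)"
      by (intro continuous_intros continuous_on_matrix_vector_mult continuous_on_compose2[OF cF] continuous_on_compose2[OF cM]) auto
    obtain m where m: "m > 0" "\<And>x. x \<in> K i \<Longrightarrow> m \<le> norm (F i x)"
      using compact_norm_lower_bound[OF _ cF] insert.prems(1)[of i] c(2)[OF i] i unfolding F_def by blast
    have "\<forall>\<^sub>F d in nhds 0. d \<in> UNIV \<longrightarrow> (\<forall>x\<in>K i. dist (F i x + M i x *v d) (F i x + M i x *v 0) < m)"
      by (rule family_eventually_close[OF cG]) (use insert.prems(1) i m in auto)
    then show ?thesis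
    proof eventually_elim
      case (elim d)
      show ?case
      proof
        fix x assume x: "x \<in> K i"
        have "norm (M i x *v d) < m" using elim x by (simp add: dist_norm)
        then show "F i x + M i x *v d \<noteq> 0" using m(2)[OF x]
          by (metis add_eq_0_iff norm_minus_cancel not_less)
      qed
    qed
  qed
  have "\<forall>\<^sub>F d in nhds 0. \<forall>i\<in>J. \<forall>x\<in>K i. F i x + M i x *v d \<noteq> 0"
    using insert.hyps(1) old by (simp add: eventually_ball_finite)
  then obtain \<delta> where \<delta>: "\<delta> > 0" "\<forall>d. dist d 0 < \<delta> \<longrightarrow> (\<forall>i\<in>J. \<forall>x\<in>K i. F i x + M i x *v d \<noteq> 0)"
    unfolding eventually_nhds_metric by (elim exE conjE)
  \<comment> \<open>Three entries of size \<epsilon>/6 change a coefficient by less than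
    \<epsilon>/2; the induction hypothesis used the other half.\<close>
  have pos: "min \<delta> (\<epsilon> / 6) > 0" using \<delta>(1) insert.prems(5) by simp
  have detM: "det (M j x) \<noteq> 0" if "x \<in> K j" for x using q(2)[OF that] by (simp add: M_def)
  obtain d where d: "norm d < min \<delta> (\<epsilon> / 6)" "\<And>x. x \<in> K j \<Longrightarrow> F j x + M j x *v d \<noteq> 0"
    by (rule avoid_zero_step[OF dim dF[OF insertI1] dM[OF insertI1] detM pos]) (assumption, erule that, blast)
  \<comment> \<open>Summing over \<open>l\<close> requires no knowledge of whether \<open>q\<close>
    repeats a bump.\<close>
  define c' where "c' p = c p + (\<Sum>l\<in>UNIV. if p = q l then d $ l else 0)" for p
  have sum: "b i x + (\<Sum>p\<in>B. c' p *\<^sub>R L i p x) = F i x + M i x *v d" for i x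
  proof -
    have "(\<Sum>p\<in>B. c' p *\<^sub>R L i p x) = (\<Sum>p\<in>B. c p *\<^sub>R L i p x) +
        (\<Sum>p\<in>B. \<Sum>l\<in>UNIV. if p = q l then d $ l *\<^sub>R L i p x else 0)"
      by (simp add: c'_def scaleR_add_left sum.distrib scaleR_sum_left if_distrib[of "\<lambda>x. x *\<^sub>R _"] cong: if_cong)
    also have "(\<Sum>p\<in>B. \<Sum>l\<in>UNIV. if p = q l then d $ l *\<^sub>R L i p x else 0) =
        (\<Sum>l\<in>UNIV. \<Sum>p\<in>B. if p = q l then d $ l *\<^sub>R L i p x else 0)"
      by (rule sum.swap)
    also have "\<dots> = (\<Sum>l\<in>UNIV. d $ l *\<^sub>R L i (q l) x)"
      using q(1) \<open>finite B\<close> by (intro sum.cong refl) (auto simp: sum.delta)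
    finally show ?thesis by (simp add: F_def M)
  qed
  have small: "\<bar>c' p\<bar> < \<epsilon>" for p
  proof -
    have "\<bar>\<Sum>l\<in>UNIV. if p = q l then d $ l else 0\<bar> \<le> (\<Sum>l\<in>(UNIV::3 set). norm d)"
      by (intro order_trans[OF sum_abs] sum_mono) (simp add: component_le_norm_cart)
    also have "\<dots> = 3 * norm d" by simp
    also have "\<dots> < \<epsilon> / 2" using d(1) by simp
    finally show ?thesis using c(1)[of p] by (simp add: c'_def)
  qed
  show ?case
  proof (intro exI[of _ c'] conjI allI ballI small)
    fix i x assume i: "i \<in> insert j J" "x \<in> K i"
    show "b i x + (\<Sum>p\<in>B. c' p *\<^sub>R L i p x) \<noteq> 0"
      unfolding sum using i d \<delta>(2) by (cases "i = j") auto
  qed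
qed

section \<open>Bumps of finite smoothness and their independence along the orbit\<close>

text \<open>\<open>q\<close> is a pair of center and radius. A truncated power vanishes outside the
  ball and has an explicit derivative; finite smoothness suffices, and the exponent is chosen from
  the required class.\<close>

definition bump :: "nat \<Rightarrow> 'a::euclidean_space \<times> real \<Rightarrow> 'a \<Rightarrow> real" where
  "bump N q x = (max 0 ((snd q)\<^sup>2 - (x - fst q) \<bullet> (x - fst q))) ^ N"

definition bump_deriv :: "nat \<Rightarrow> 'a::euclidean_space \<times> real \<Rightarrow> 'a \<Rightarrow> 'a \<Rightarrow> real" where
  "bump_deriv N q x v =
     real N * (max 0 ((snd q)\<^sup>2 - (x - fst q) \<bullet> (x - fst q))) ^ (N - 1) * (- 2 * ((x - fst q) \<bullet> v))"

lemma positive_part_power_deriv: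
  assumes "N \<ge> 2"
  shows "((\<lambda>s::real. (max 0 s) ^ N) has_real_derivative real N * (max 0 s) ^ (N - 1)) (at s)"
proof -
  consider "s > 0" | "s < 0" | "s = 0" by linarith
  then show ?thesis
  proof cases
    case 1
    have "((\<lambda>s. s ^ N) has_real_derivative real N * s ^ (N - 1)) (at s)"
      by (auto intro!: derivative_eq_intros)
    then have "((\<lambda>s. (max 0 s) ^ N) has_real_derivative real N * s ^ (N - 1)) (at s)"
      by (rule has_field_derivative_transform_within_open[of _ _ _ "{0<..}"]) (use 1 in auto)
    then show ?thesis using 1 by simp
  next
    case 2
    have "((\<lambda>s. 0) has_real_derivative 0) (at s)" by simp
    then have "((\<lambda>s. (max 0 s) ^ N) has_real_derivative 0) (at s)"
      by (rule has_field_derivative_transform_within_open[of _ _ _ "{..<0}"]) (use 2 assms in auto)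
    then show ?thesis using 2 assms by (simp add: zero_power)
  next
    case 3
    have "((\<lambda>h::real. ((max 0 h) ^ N) / h) \<longlongrightarrow> 0) (at 0)"
    proof (rule Lim_null_comparison)
      show "((\<lambda>h::real. \<bar>h\<bar> ^ (N - 1)) \<longlongrightarrow> 0) (at 0)"
        using assms by (auto intro!: tendsto_eq_intros)
      show "\<forall>\<^sub>F h::real in at 0. norm ((max 0 h) ^ N / h) \<le> \<bar>h\<bar> ^ (N - 1)"
      proof (rule eventually_mono[OF eventually_neq_at_within[of 0 0]], goal_cases)
        case (1 h)
        have "\<bar>h\<bar> ^ N = \<bar>h\<bar> * \<bar>h\<bar> ^ (N - 1)" using assms by (cases N) auto
        then show ?case using 1 assms by (cases "h > 0") (auto simp: field_simps zero_power max_absorb1)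
      qed
    qed
    then show ?thesis using 3 assms by (simp add: DERIV_def zero_power)
  qed
qed

text \<open>Each differentiation lowers the exponent by one and leaves a truncated power; the last
  one must still be continuous.\<close>

lemma Ck_family_positive_part_power:
  "N > m \<Longrightarrow> Ck_family m C UNIV (\<lambda>c s::real. (max 0 s) ^ N)"
proof (induction m arbitrary: N)
  case 0
  then show ?case by (auto intro!: continuous_intros)
next
  case (Suc m)
  show ?case
  proof (rule Ck_family_SucI[where D="\<lambda>c s v. v * (real N * (max 0 s) ^ (N - 1))"])
    show "((\<lambda>s. (max 0 s) ^ N) has_derivative (\<lambda>v. v * (real N * (max 0 s) ^ (N - 1)))) (at s)" for s :: real
      using positive_part_power_deriv[of N s] Suc.prems
      by (simp add: has_field_derivative_def mult.commute[of _ "real N * _"])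
    show "Ck_family m C UNIV (\<lambda>c s. i * (real N * (max 0 s) ^ (N - 1)))" for i :: real
      using Suc by (intro Ck_family_mult Ck_family_const open_UNIV) auto
  qed (auto intro!: continuous_intros)
qed

lemma Ck_family_bump: "N > m \<Longrightarrow> Ck_family m C UNIV (\<lambda>c x. bump N q x)"
  unfolding bump_def
  by (rule Ck_family_compose[where V=UNIV and h="\<lambda>c s. (max 0 s) ^ N"])
    (auto intro!: Ck_family_positive_part_power Ck_family_diff Ck_family_const Ck_family_inner Ck_family_ident)

lemma bump_has_derivative:
  assumes "N \<ge> 2"
  shows "(bump N q has_derivative bump_deriv N q x) (at x)"
proof -
  let ?s = "\<lambda>x. (snd q)\<^sup>2 - (x - fst q) \<bullet> (x - fst q)"
  have 1: "(?s has_derivative (\<lambda>v. - (2 * ((x - fst q) \<bullet> v)))) (at x)"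
    by (auto intro!: derivative_eq_intros simp: inner_commute)
  have 2: "((\<lambda>s. (max 0 s) ^ N) has_derivative (\<lambda>v. v * (real N * (max 0 (?s x)) ^ (N - 1)))) (at (?s x))"
    using positive_part_power_deriv[OF assms, of "?s x"]
    by (simp add: has_field_derivative_def mult.commute[of _ "real N * _"])
  show ?thesis
    using has_derivative_compose[OF 1 2] by (simp add: bump_def[abs_def] bump_deriv_def[abs_def] ac_simps)
qed

lemma bump_outside:
  assumes "dist x (fst q) \<ge> snd q" "snd q > 0" "N \<ge> 2"
  shows "bump N q x = 0" "bump_deriv N q x v = 0"
proof -
  have "(snd q)\<^sup>2 \<le> (dist x (fst q))\<^sup>2" using assms by (intro power_mono) auto
  then have "(snd q)\<^sup>2 - (x - fst q) \<bullet> (x - fst q) \<le> 0"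
    by (simp add: dist_norm power2_norm_eq_inner)
  then show "bump N q x = 0" "bump_deriv N q x v = 0"
    using assms by (auto simp: bump_def bump_deriv_def max_absorb1)
qed

lemma periodic_inj_eq_iff:
  fixes u :: "real \<Rightarrow> 'a"
  assumes per: "\<And>s. u (s + 1) = u s" and inj: "inj_on u {0..<1}"
  shows "u s = u t \<longleftrightarrow> s - t \<in> \<int>"
proof
  assume "u s = u t"
  then have "u (frac s) = u (frac t)" using periodic_eq_frac[of u, OF per] by simp
  then have "frac s = frac t"
    using inj_onD[OF inj, of "frac s" "frac t"] frac_lt_1[of s] frac_lt_1[of t] by simp
  then have "s - t = of_int (\<lfloor>s\<rfloor> - \<lfloor>t\<rfloor>)" by (simp add: frac_def)
  then show "s - t \<in> \<int>" by (metis Ints_of_int)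
next
  assume "s - t \<in> \<int>"
  then obtain n where "s = t + of_int n" by (metis Ints_cases add.commute diff_add_cancel)
  then show "u s = u t" using periodic_eq_at_int[of u t n, OF per] by simp
qed

text \<open>Delays as fractions of the period. The delay \<open>1/5\<close> is chosen because its multiples \<open>1, \<dots>, 4\<close> are not
  integers, which makes the matrix in \<open>bumps_separation\<close> triangular.\<close>

definition delay_shift :: "3 \<Rightarrow> real" where
  "delay_shift i = (vector [0, 1/5, 2/5] :: real^3) $ i"

lemma delay_shift_simps [simp]:
  "delay_shift 1 = 0" "delay_shift 2 = 1/5" "delay_shift 3 = 2/5"
  by (simp_all add: delay_shift_def)

lemma fifth_not_int: "\<not> 5 dvd m \<Longrightarrow> real_of_int m / 5 \<notin> \<int>"
proof
  assume m: "\<not> 5 dvd m" "real_of_int m / 5 \<in> \<int>"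
  then obtain k where "real_of_int m / 5 = real_of_int k" by (auto elim: Ints_cases)
  then have "real_of_int m = real_of_int (5 * k)" by simp
  then have "m = 5 * k" by (simp only: of_int_eq_iff)
  with m(1) show False by simp
qed

lemma delay_shift_diff:
  assumes "i \<noteq> l" shows "delay_shift i - delay_shift l \<notin> \<int>"
proof -
  have "real_of_int 1 / 5 \<notin> \<int>" "real_of_int 2 / 5 \<notin> \<int>"
    by (rule fifth_not_int, simp)+
  then show ?thesis
    using exhaust_3[of i] exhaust_3[of l] assms minus_in_Ints_iff[of "1/5::real"] minus_in_Ints_iff[of "2/5::real"]
    by (elim disjE) simp_all
qed

lemma separated_radius:
  fixes P :: "'a::euclidean_space set"
  assumes "finite P" "open U" "P \<subseteq> U"
  obtains r where "r > 0" "\<And>x. x \<in> P \<Longrightarrow> cball x r \<subseteq> U" "\<And>x y. x \<in> P \<Longrightarrow> y \<in> P \<Longrightarrow> x \<noteq> y \<Longrightarrow> r \<le> dist x y"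
proof -
  obtain e where e: "e > 0" "(\<Union>x\<in>P. cball x e) \<subseteq> U"
    using compact_subset_open_imp_cball_epsilon_subset[OF finite_imp_compact[OF assms(1)] assms(2,3)] by blast
  define D where "D = insert e ((\<lambda>(x, y). dist x y) ` {(x, y). x \<in> P \<and> y \<in> P \<and> x \<noteq> y})"
  have "finite {(x, y). x \<in> P \<and> y \<in> P \<and> x \<noteq> y}"
    by (rule finite_subset[of _ "P \<times> P"]) (use assms(1) in auto)
  then have D: "finite D" "D \<noteq> {}" by (auto simp: D_def)
  have "Min D > 0" using D e(1) by (subst Min_gr_iff) (auto simp: D_def)
  moreover have "cball x (Min D) \<subseteq> U" if "x \<in> P" for x
  proof -
    have "Min D \<le> e" using D by (intro Min_le) (auto simp: D_def)
    then have "cball x (Min D) \<subseteq> cball x e" by (rule subset_cball)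
    then show ?thesis using e(2) that by blast
  qed
  moreover have "Min D \<le> dist x y" if "x \<in> P" "y \<in> P" "x \<noteq> y" for x y
    using D that by (intro Min_le) (auto simp: D_def)
  ultimately show thesis using that by blast
qed

text \<open>The closed ball inside \<open>U\<close> guarantees that a perturbation built from such
  bumps vanishes off \<open>U\<close>, so that the conjugacy maps \<open>U\<close> to
  itself.\<close>

definition admissible_bump :: "'a::euclidean_space set \<Rightarrow> 'a \<times> real \<Rightarrow> bool" where
  "admissible_bump U q \<longleftrightarrow> snd q > 0 \<and> cball (fst q) (snd q) \<subseteq> U"

text \<open>A bump centered on the orbit point would have derivative 0 there, so each center is
  displaced backwards along the velocity, where the slope in the direction of motion is nonzero.
  Each bump misses the other two points, and the matrix is diagonal.\<close>

lemma bumps_immersion: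
  fixes u u' :: "real \<Rightarrow> 'a::euclidean_space"
  assumes "open U" "N \<ge> 2" and uU: "\<And>s. u s \<in> U" and per: "\<And>s. u (s + 1) = u s"
    and inj: "inj_on u {0..<1}" and nz: "\<And>s. u' s \<noteq> 0"
  obtains q :: "3 \<Rightarrow> 'a \<times> real" where "\<And>l. admissible_bump U (q l)"
    "det (\<chi> i l. bump_deriv N (q l) (u (t - delay_shift i)) (u' (t - delay_shift i))) \<noteq> 0"
proof -
  define x where "x i = u (t - delay_shift i)" for i
  define v where "v i = u' (t - delay_shift i)" for i
  have xne: "x i \<noteq> x l" if "i \<noteq> l" for i l
  proof -
    have "(t - delay_shift i) - (t - delay_shift l) \<notin> \<int>" using delay_shift_diff[of l i] that by simp
    then show ?thesis unfolding x_def using periodic_inj_eq_iff[of u, OF per inj] by metis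
  qed
  obtain r where r: "r > 0" "\<And>y. y \<in> range x \<Longrightarrow> cball y r \<subseteq> U"
    "\<And>y z. y \<in> range x \<Longrightarrow> z \<in> range x \<Longrightarrow> y \<noteq> z \<Longrightarrow> r \<le> dist y z"
    using separated_radius[of "range x" U] \<open>open U\<close> uU unfolding x_def by auto
  \<comment> \<open>Normalizes the displacement to r/4. With radius r/2 the bump contains its own
    point, while the other points, at distance at least r from it, are at least 3r/4 away from the
    center.\<close>
  define \<kappa> where "\<kappa> l = r / (4 * norm (v l))" for l
  have vnz: "v l \<noteq> 0" for l by (simp add: v_def nz)
  have \<kappa>: "\<kappa> l > 0" "\<kappa> l * norm (v l) = r / 4" for l using r(1) vnz[of l] by (auto simp: \<kappa>_def)
  define q where "q l = (x l - \<kappa> l *\<^sub>R v l, r / 2)" for l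
  have dq: "dist (x l) (fst (q l)) = r / 4" for l
    using \<kappa>[of l] by (simp add: q_def dist_norm)
  have adm: "admissible_bump U (q l)" for l
  proof -
    have "cball (fst (q l)) (r / 2) \<subseteq> cball (x l) r"
      using r(1) dq[of l] by (intro cball_subset_cball_iff[THEN iffD2]) (auto simp: dist_commute)
    also have "\<dots> \<subseteq> U" by (rule r(2)) simp
    finally show ?thesis using r(1) by (simp add: admissible_bump_def q_def)
  qed
  have off: "bump_deriv N (q l) (x i) (v i) = 0" if "i \<noteq> l" for i l
  proof (rule bump_outside(2))
    have "r \<le> dist (x i) (x l)" using r(3)[of "x i" "x l"] xne[OF that] by simp
    also have "\<dots> \<le> dist (x i) (fst (q l)) + r / 4" using dist_triangle[of "x i" "x l" "fst (q l)"] dq[of l] by (simp add: dist_commute)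
    finally show "snd (q l) \<le> dist (x i) (fst (q l))" using r(1) by (simp add: q_def)
  qed (use r \<open>N \<ge> 2\<close> in \<open>auto simp: q_def\<close>)
  have on: "bump_deriv N (q l) (x l) (v l) \<noteq> 0" for l
  proof -
    have xv: "(x l - fst (q l)) = \<kappa> l *\<^sub>R v l" by (simp add: q_def)
    have "(x l - fst (q l)) \<bullet> (x l - fst (q l)) = (r / 4)\<^sup>2"
      by (simp only: power2_norm_eq_inner[symmetric] dist_norm[symmetric] dq)
    moreover have "(r/2)\<^sup>2 - (r/4)\<^sup>2 > 0" using r(1) by (simp add: power2_eq_square)
    ultimately have "max 0 ((snd (q l))\<^sup>2 - (x l - fst (q l)) \<bullet> (x l - fst (q l))) > 0"
      by (simp add: q_def)
    moreover have "(x l - fst (q l)) \<bullet> v l \<noteq> 0" unfolding xv using \<kappa>(1)[of l] vnz[of l] by simp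
    ultimately show ?thesis using \<open>N \<ge> 2\<close> unfolding bump_deriv_def by simp
  qed
  have "det (\<chi> i l. bump_deriv N (q l) (x i) (v i)) \<noteq> 0"
    unfolding det_3 using on by (simp add: off)
  with adm that show thesis unfolding x_def v_def by blast
qed

text \<open>The bumps sit at the three delayed points of time \<open>t\<close>. The diagonal entries
  equal the height \<open>h\<close>; an off-diagonal entry is nonzero only if a delayed point of
  \<open>s\<close> coincides with one of \<open>t\<close>. Such coincidences cannot occur on both
  sides of the diagonal, so the determinant is that of a triangular matrix.\<close>

lemma bumps_separation:
  fixes u :: "real \<Rightarrow> 'a::euclidean_space"
  assumes "open U" "N \<ge> 2" and uU: "\<And>s. u s \<in> U" and per: "\<And>s. u (s + 1) = u s"
    and inj: "inj_on u {0..<1}" and ts: "t - s \<notin> \<int>"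
  obtains q :: "3 \<Rightarrow> 'a \<times> real" where "\<And>l. admissible_bump U (q l)"
    "det (\<chi> i l. bump N (q l) (u (t - delay_shift i)) - bump N (q l) (u (s - delay_shift i))) \<noteq> 0"
proof -
  define x where "x i = u (t - delay_shift i)" for i
  define y where "y i = u (s - delay_shift i)" for i
  have xne: "x i \<noteq> x l" if "i \<noteq> l" for i l
  proof -
    have "(t - delay_shift i) - (t - delay_shift l) \<notin> \<int>" using delay_shift_diff[of l i] that by simp
    then show ?thesis unfolding x_def using periodic_inj_eq_iff[of u, OF per inj] by metis
  qed
  have yx: "y i \<noteq> x i" for i
  proof -
    have "(t - delay_shift i) - (s - delay_shift i) \<notin> \<int>" using ts by simp
    then show ?thesis unfolding x_def y_def using periodic_inj_eq_iff[of u, OF per inj] by metis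
  qed
  \<comment> \<open>A coincidence says that s - t agrees with a difference of two delays modulo 1.
    One below and one above the diagonal would make 2/5, 3/5 or 4/5 an integer. With delay 1/4 the
    largest of these values would be 1, and the argument would break down.\<close>
  have yx2: False if "y i = x l" "y i' = x l'" "(i, l) \<in> {(2,1), (3,1), (3,2)}" "(i', l') \<in> {(1,2), (1,3), (2,3)}"
    for i l i' l'
  proof -
    have A: "(s - delay_shift i) - (t - delay_shift l) \<in> \<int>" "(s - delay_shift i') - (t - delay_shift l') \<in> \<int>"
      using that(1,2) unfolding x_def y_def using periodic_inj_eq_iff[of u, OF per inj] by metis+
    have B: "(delay_shift i - delay_shift l) - (delay_shift i' - delay_shift l') \<in> \<int>"
      using Ints_diff[OF A(2) A(1)] by (simp add: algebra_simps)
    have C: "(delay_shift i - delay_shift l) - (delay_shift i' - delay_shift l') \<in> {2/5, 3/5, 4/5}"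
      using that(3,4) by auto
    have "(2/5::real) \<notin> \<int>" "(3/5::real) \<notin> \<int>" "(4/5::real) \<notin> \<int>"
      using fifth_not_int[of 2] fifth_not_int[of 3] fifth_not_int[of 4] by simp_all
    with B C show False by (metis insertE emptyE)
  qed
  define P where "P = range x \<union> range y"
  have P: "finite P" "P \<subseteq> U" using uU by (auto simp: P_def x_def y_def)
  obtain r where r: "r > 0" "\<And>z. z \<in> P \<Longrightarrow> cball z r \<subseteq> U" "\<And>z w. z \<in> P \<Longrightarrow> w \<in> P \<Longrightarrow> z \<noteq> w \<Longrightarrow> r \<le> dist z w"
    using separated_radius[OF P(1) \<open>open U\<close> P(2)] by blast
  define q where "q l = (x l, r)" for l
  have adm: "admissible_bump U (q l)" for l
    using r(1,2) by (auto simp: admissible_bump_def q_def P_def)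
  define h where "h = (r\<^sup>2) ^ N"
  have h: "h > 0" using r(1) by (simp add: h_def)
  have on: "bump N (q l) z = (if z = x l then h else 0)" if "z \<in> P" for z l
  proof (cases "z = x l")
    case True then show ?thesis by (simp add: bump_def q_def h_def)
  next
    case False
    have "bump N (q l) z = 0"
      by (rule bump_outside(1)) (use r False that \<open>N \<ge> 2\<close> in \<open>auto simp: q_def P_def\<close>)
    then show ?thesis using False by simp
  qed
  define A :: "real^3^3" where "A = (\<chi> i l. bump N (q l) (x i) - bump N (q l) (y i))"
  have A: "A $ i $ l = (if i = l then h else if y i = x l then - h else 0)" for i l
    using on[of "x i" l] on[of "y i" l] xne[of i l] yx[of i] by (auto simp: A_def P_def)
  have zero: "A $ i $ l * A $ i' $ l' = 0" if "(i, l) \<in> {(2,1), (3,1), (3,2)}" "(i', l') \<in> {(1,2), (1,3), (2,3)}" for i l i' l'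
  proof -
    have "i \<noteq> l" "i' \<noteq> l'" using that by auto
    then show ?thesis using yx2[OF _ _ that] by (auto simp: A)
  qed
  \<comment> \<open>Every permutation other than the identity contributes a product with one factor
    below and one above the diagonal, hence 0.\<close>
  have "det A = h * h * h"
    using zero[of 2 1 1 2] zero[of 3 1 1 3] zero[of 3 2 2 3] zero[of 3 1 1 2] zero[of 2 1 1 3]
    unfolding det_3 by (simp add: A[of 1 1] A[of 2 2] A[of 3 3] algebra_simps) (auto simp: mult.assoc)
  then have "det A \<noteq> 0" using h by simp
  with adm that show thesis unfolding A_def x_def y_def by blast
qed

section \<open>Generic bump coefficients\<close>

text \<open>A triple of bumps that is independent at one point is independent on a small ball around
  it, and finitely many balls cover \<open>E\<close>. The set \<open>B\<close> does not depend on
  \<epsilon>: the size of coefficients that a conjugacy tolerates is known only once the bumps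
  are.\<close>

lemma generic_avoidance:
  fixes b :: "'m::euclidean_space \<Rightarrow> real^3" and L :: "'q \<Rightarrow> 'm \<Rightarrow> real^3"
  assumes "compact E" and dim: "DIM('m) < 3"
    and b: "\<And>i. (\<lambda>x. b x $ i) differentiable_on UNIV"
    and L: "\<And>q i. P q \<Longrightarrow> (\<lambda>x. L q x $ i) differentiable_on UNIV"
    and det: "\<And>x. x \<in> E \<Longrightarrow> \<exists>q :: 3 \<Rightarrow> 'q. (\<forall>l. P (q l)) \<and> det (\<chi> i l. L (q l) x $ i) \<noteq> 0"
  obtains B where "finite B" "\<And>q. q \<in> B \<Longrightarrow> P q"
    "\<And>\<epsilon>. \<epsilon> > 0 \<Longrightarrow> \<exists>c. (\<forall>q. \<bar>c q\<bar> < \<epsilon>) \<and> (\<forall>x\<in>E. b x + (\<Sum>q\<in>B. c q *\<^sub>R L q x) \<noteq> 0)"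
proof -
  have "\<forall>x\<in>E. \<exists>q. (\<forall>l. P (q l)) \<and> det (\<chi> i l. L (q l) x $ i) \<noteq> 0" using det by blast
  from bchoice[OF this] obtain Q :: "'m \<Rightarrow> 3 \<Rightarrow> 'q"
    where Q: "\<And>x l. x \<in> E \<Longrightarrow> P (Q x l)" "\<And>x. x \<in> E \<Longrightarrow> det (\<chi> i l. L (Q x l) x $ i) \<noteq> 0"
    by blast
  have "\<exists>d>0. \<forall>y\<in>cball x d. det (\<chi> i l. L (Q x l) y $ i) \<noteq> 0" if x: "x \<in> E" for x
  proof -
    have "continuous_on UNIV (\<lambda>y. det (\<chi> i l. L (Q x l) y $ i))"
      by (rule continuous_on_det) (use L[OF Q(1)[OF x]] in \<open>simp add: differentiable_imp_continuous_on\<close>)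
    then have "open {y. det (\<chi> i l. L (Q x l) y $ i) \<noteq> 0}"
      by (intro open_Collect_neq) auto
    then show ?thesis using Q(2)[OF x] unfolding open_contains_cball by blast
  qed
  then have "\<forall>x\<in>E. \<exists>d. d > 0 \<and> (\<forall>y\<in>cball x d. det (\<chi> i l. L (Q x l) y $ i) \<noteq> 0)" by blast
  from bchoice[OF this] obtain D where D: "\<And>x. x \<in> E \<Longrightarrow> D x > (0::real)" "\<And>x y. x \<in> E \<Longrightarrow> y \<in> cball x (D x) \<Longrightarrow> det (\<chi> i l. L (Q x l) y $ i) \<noteq> 0"
    by blast
  have "E \<subseteq> (\<Union>x\<in>E. ball x (D x))"
  proof
    fix x assume "x \<in> E"
    then show "x \<in> (\<Union>x\<in>E. ball x (D x))" using D(1)[of x] by (intro UN_I[of x]) auto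
  qed
  then obtain J where J: "J \<subseteq> E" "finite J" "E \<subseteq> (\<Union>x\<in>J. ball x (D x))"
    by (rule compactE_image[OF \<open>compact E\<close> open_ball])
  define B where "B = (\<Union>j\<in>J. range (Q j))"
  have B: "finite B" "\<And>q. q \<in> B \<Longrightarrow> P q" using J Q(1) by (auto simp: B_def)
  have "\<exists>c. (\<forall>q. \<bar>c q\<bar> < \<epsilon>) \<and> (\<forall>x\<in>E. b x + (\<Sum>q\<in>B. c q *\<^sub>R L q x) \<noteq> 0)" if "\<epsilon> > 0" for \<epsilon>
  proof -
    have "\<exists>c. (\<forall>q. \<bar>c q\<bar> < \<epsilon>) \<and> (\<forall>j\<in>J. \<forall>x\<in>cball j (D j). b x + (\<Sum>q\<in>B. c q *\<^sub>R L q x) \<noteq> 0)"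
    proof (rule avoid_zeros_finite[OF J(2) B(1) dim _ _ _ _ that])
      show "\<exists>q :: 3 \<Rightarrow> 'q. range q \<subseteq> B \<and> (\<forall>x\<in>cball j (D j). det (\<chi> i l. L (q l) x $ i) \<noteq> 0)" if "j \<in> J" for j
        using that J(1) D(2) by (intro exI[of _ "Q j"]) (auto simp: B_def)
      show "(\<lambda>x. b x $ i) differentiable_on cball j (D j)" for i j
        by (rule differentiable_on_subset[OF b]) simp
      show "(\<lambda>x. L q x $ i) differentiable_on cball j (D j)" if "q \<in> B" for i j q
        by (rule differentiable_on_subset[OF L[OF B(2)[OF that]]]) simp
    qed auto
    moreover have "\<exists>j\<in>J. x \<in> cball j (D j)" if "x \<in> E" for x
      using that J(3) ball_subset_cball by blast
    ultimately show ?thesis by blast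
  qed
  with B that show thesis by blast
qed

lemma has_vector_derivative_vec:
  fixes f :: "'i::finite \<Rightarrow> real \<Rightarrow> real"
  assumes "\<And>i. (f i has_real_derivative f' i) (at t)"
  shows "((\<lambda>t. \<chi> i. f i t) has_vector_derivative (\<chi> i. f' i)) (at t)"
proof -
  have vec: "(\<chi> i. g i) = (\<Sum>i\<in>UNIV. g i *\<^sub>R (axis i 1 :: real^'i))" for g :: "'i \<Rightarrow> real"
    using basis_expansion[of "\<chi> i. g i"] by (simp add: scalar_mult_eq_scaleR)
  have "((\<lambda>t. \<Sum>i\<in>UNIV. f i t *\<^sub>R (axis i 1 :: real^'i)) has_vector_derivative (\<Sum>i\<in>UNIV. f' i *\<^sub>R axis i 1)) (at t)"
  proof (rule has_vector_derivative_sum)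
    fix i
    show "((\<lambda>t. f i t *\<^sub>R (axis i 1 :: real^'i)) has_vector_derivative f' i *\<^sub>R axis i 1) (at t)"
      using has_vector_derivative_scaleR[OF assms[of i] has_vector_derivative_const[of "axis i 1 :: real^'i"]] by simp
  qed
  then show ?thesis unfolding vec .
qed

lemma bump_along_curve:
  fixes u :: "real \<Rightarrow> 'a::euclidean_space"
  assumes "N \<ge> 2" and du: "(u has_vector_derivative u' t) (at t)"
  shows "((\<lambda>t. bump N q (u t)) has_real_derivative bump_deriv N q (u t) (u' t)) (at t)"
proof -
  have "((bump N q \<circ> u) has_vector_derivative bump_deriv N q (u t) (u' t)) (at t)"
    using vector_derivative_diff_chain_within[OF du, of "bump N q" "bump_deriv N q (u t)"]
      bump_has_derivative[OF \<open>N \<ge> 2\<close>, of q "u t"] by (simp add: has_derivative_at_withinI)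
  then show ?thesis by (simp add: o_def has_real_derivative_iff_has_vector_derivative)
qed

text \<open>The avoidance argument needs differentiable matrix entries. Here the entries are already
  derivatives, so one more order is required: N - 1 must be at least 2, and the curve must be twice
  differentiable.\<close>

lemma bump_deriv_along_curve_differentiable:
  fixes u :: "real \<Rightarrow> 'a::euclidean_space"
  assumes "N \<ge> 3" and du: "\<And>t. (u has_vector_derivative u' t) (at t)"
    and du': "\<And>t. (u' has_vector_derivative u'' t) (at t)"
  shows "(\<lambda>t. bump_deriv N q (u t) (u' t)) differentiable (at t)"
proof -
  have "(\<lambda>t. bump (N - 1) q (u t)) differentiable (at t)"
  proof -
    have "N - 1 \<ge> 2" using \<open>N \<ge> 3\<close> by simp
    from bump_along_curve[where u=u and u'=u', OF this du] show ?thesis unfolding real_differentiable_def by blast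
  qed
  moreover have "(\<lambda>t. (u t - fst q) \<bullet> u' t) differentiable (at t)"
    by (intro differentiable_inner differentiable_diff differentiable_const)
      (use du du' in \<open>auto intro: differentiableI_vector\<close>)
  ultimately show ?thesis
    unfolding bump_deriv_def bump_def by (intro differentiable_mult) auto
qed

lemma differentiable_shift:
  fixes f :: "real \<Rightarrow> real"
  assumes "\<And>t. f differentiable (at t)" "bounded_linear g"
  shows "(\<lambda>z. f (g z - c)) differentiable_on S"
proof -
  have "g differentiable (at z)" for z
    using bounded_linear_imp_has_derivative[OF assms(2)] by (auto simp: differentiable_def)
  then have "(\<lambda>z. g z - c) differentiable (at z)" for z
    by (intro differentiable_diff differentiable_const)
  then have "(f \<circ> (\<lambda>z. g z - c)) differentiable (at z)" for z
    by (rule differentiable_chain_at) (rule assms(1))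
  then show ?thesis by (auto simp: o_def differentiable_on_def intro: differentiable_at_withinI)
qed

lemma has_real_derivative_shift:
  fixes f f' :: "real \<Rightarrow> real"
  assumes "\<And>t. (f has_real_derivative f' t) (at t)"
  shows "((\<lambda>t. f (t - c)) has_real_derivative f' (t - c)) (at t)"
proof -
  have "((\<lambda>t. t - c) has_real_derivative 1) (at t)" by (auto intro!: derivative_eq_intros)
  from DERIV_chain2[OF assms this] show ?thesis by simp
qed

text \<open>The velocity of the perturbed delay curve is affine in the coefficients and depends on a
  single time, so generic coefficients keep it nonzero on one period; periodicity covers the
  remaining times.\<close>

lemma immersion_perturbation:
  fixes u u' u'' :: "real \<Rightarrow> 'a::euclidean_space" and y' y'' :: "real \<Rightarrow> real"
  assumes "open U" "N \<ge> 3" and uU: "\<And>s. u s \<in> U" and per: "\<And>s. u (s + 1) = u s" "\<And>s. u' (s + 1) = u' s" "\<And>s. y' (s + 1) = y' s"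
    and inj: "inj_on u {0..<1}" and nz: "\<And>s. u' s \<noteq> 0"
    and du: "\<And>t. (u has_vector_derivative u' t) (at t)" "\<And>t. (u' has_vector_derivative u'' t) (at t)"
    and dy: "\<And>t. (y' has_real_derivative y'' t) (at t)"
  obtains B where "finite B" "\<And>q. q \<in> B \<Longrightarrow> admissible_bump U q"
    "\<And>\<epsilon>. \<epsilon> > 0 \<Longrightarrow> \<exists>c. (\<forall>q. \<bar>c q\<bar> < \<epsilon>) \<and>
       (\<forall>t. (\<chi> i. y' (t - delay_shift i) + (\<Sum>q\<in>B. c q * bump_deriv N q (u (t - delay_shift i)) (u' (t - delay_shift i)))) \<noteq> 0)"
proof -
  define b :: "real \<Rightarrow> real^3" where "b t = (\<chi> i. y' (t - delay_shift i))" for t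
  define L :: "'a \<times> real \<Rightarrow> real \<Rightarrow> real^3" where
    "L q t = (\<chi> i. bump_deriv N q (u (t - delay_shift i)) (u' (t - delay_shift i)))" for q t
  obtain B where B: "finite B" "\<And>q. q \<in> B \<Longrightarrow> admissible_bump U q"
    "\<And>\<epsilon>. \<epsilon> > 0 \<Longrightarrow> \<exists>c. (\<forall>q. \<bar>c q\<bar> < \<epsilon>) \<and> (\<forall>t\<in>{0..1}. b t + (\<Sum>q\<in>B. c q *\<^sub>R L q t) \<noteq> 0)"
  proof (rule generic_avoidance[where E="{0..1::real}" and b=b and L=L and P="admissible_bump U"])
    show "(\<lambda>t. b t $ i) differentiable_on UNIV" for i
    proof -
      have "y' differentiable (at t)" for t using dy unfolding real_differentiable_def by blast
      from differentiable_shift[OF this bounded_linear_ident] show ?thesis by (simp add: b_def)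
    qed
    show "(\<lambda>t. L q t $ i) differentiable_on UNIV" for q i
      using differentiable_shift[OF bump_deriv_along_curve_differentiable[OF \<open>N \<ge> 3\<close> du] bounded_linear_ident]
      by (simp add: L_def)
    show "\<exists>q :: 3 \<Rightarrow> 'a \<times> real. (\<forall>l. admissible_bump U (q l)) \<and> det (\<chi> i l. L (q l) t $ i) \<noteq> 0" for t
    proof -
      have "N \<ge> 2" using \<open>N \<ge> 3\<close> by simp
      then obtain q :: "3 \<Rightarrow> 'a \<times> real" where "\<And>l. admissible_bump U (q l)"
        "det (\<chi> i l. bump_deriv N (q l) (u (t - delay_shift i)) (u' (t - delay_shift i))) \<noteq> 0"
        by (rule bumps_immersion[where u'=u' and t=t, OF \<open>open U\<close> _ uU per(1) inj nz]) (rule that; assumption)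
      then show ?thesis unfolding L_def by (intro exI[of _ q]) simp
    qed
  qed auto
  show thesis
  proof (rule that[OF B(1,2)])
    fix \<epsilon> :: real assume "\<epsilon> > 0"
    then obtain c where c: "\<And>q. \<bar>c q\<bar> < \<epsilon>" "\<And>t. t \<in> {0..1} \<Longrightarrow> b t + (\<Sum>q\<in>B. c q *\<^sub>R L q t) \<noteq> 0"
      using B(3) by blast
    define F :: "real \<Rightarrow> real^3" where
      "F t = (\<chi> i. y' (t - delay_shift i) + (\<Sum>q\<in>B. c q * bump_deriv N q (u (t - delay_shift i)) (u' (t - delay_shift i))))" for t
    have F: "F t = b t + (\<Sum>q\<in>B. c q *\<^sub>R L q t)" for t
      by (simp add: F_def b_def L_def vec_eq_iff)
    have "F (t + 1) = F t" for t
    proof -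
      have "t + 1 - x = (t - x) + 1" for x by simp
      then show ?thesis by (simp only: F_def per)
    qed
    then have "F t = F (frac t)" for t using periodic_eq_frac[of F t] by metis
    moreover have "F (frac t) \<noteq> 0" for t unfolding F using frac_lt_1[of t] by (intro c(2)) auto
    ultimately have "F t \<noteq> 0" for t by metis
    with c(1) show "\<exists>c. (\<forall>q. \<bar>c q\<bar> < \<epsilon>) \<and>
       (\<forall>t. (\<chi> i. y' (t - delay_shift i) + (\<Sum>q\<in>B. c q * bump_deriv N q (u (t - delay_shift i)) (u' (t - delay_shift i)))) \<noteq> 0)"
      unfolding F_def by blast
  qed
qed

text \<open>The width \<delta> around the diagonal and the tolerance \<epsilon>0 for the velocity
  are read off the unperturbed immersion, before any bump is chosen. The bumps then handle the
  compact set \<open>K\<close> of pairs of times that stay apart, and small coefficients respect the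
  tolerance.\<close>

lemma injectivity_perturbation:
  fixes u u' u'' :: "real \<Rightarrow> 'a::euclidean_space" and y y' y'' :: "real \<Rightarrow> real"
  assumes "open U" "N \<ge> 3" and uU: "\<And>s. u s \<in> U"
    and per: "\<And>s. u (s + 1) = u s" "\<And>s. u' (s + 1) = u' s" "\<And>s. y (s + 1) = y s" "\<And>s. y' (s + 1) = y' s"
    and inj: "inj_on u {0..<1}"
    and du: "\<And>t. (u has_vector_derivative u' t) (at t)" "\<And>t. (u' has_vector_derivative u'' t) (at t)"
    and dy: "\<And>t. (y has_real_derivative y' t) (at t)" "\<And>t. (y' has_real_derivative y'' t) (at t)"
    and imm: "\<And>t. (\<chi> i. y' (t - delay_shift i)) \<noteq> (0 :: real^3)"
  obtains B where "finite B" "\<And>q. q \<in> B \<Longrightarrow> admissible_bump U q"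
    "\<And>\<epsilon>. \<epsilon> > 0 \<Longrightarrow> \<exists>c. (\<forall>q. \<bar>c q\<bar> < \<epsilon>) \<and>
       (\<forall>t. (\<chi> i. y' (t - delay_shift i) + (\<Sum>q\<in>B. c q * bump_deriv N q (u (t - delay_shift i)) (u' (t - delay_shift i)))) \<noteq> (0 :: real^3)) \<and>
       inj_on (\<lambda>t. (\<chi> i. y (t - delay_shift i) + (\<Sum>q\<in>B. c q * bump N q (u (t - delay_shift i)))) :: real^3) {0..<1}"
proof -
  have N2: "N \<ge> 2" using \<open>N \<ge> 3\<close> by simp
  have cy': "continuous_on UNIV y'"
    by (intro continuous_at_imp_continuous_on ballI DERIV_isCont[OF dy(2)])
  define W where "W q t = bump N q (u t)" for q t
  define W' where "W' q t = bump_deriv N q (u t) (u' t)" for q t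
  have dW: "(W q has_real_derivative W' q t) (at t)" for q t
    unfolding W_def W'_def by (rule bump_along_curve[OF N2 du(1)])
  have dW': "W' q differentiable (at t)" for q t
    unfolding W'_def by (rule bump_deriv_along_curve_differentiable[OF \<open>N \<ge> 3\<close> du])
  define F' :: "real \<Rightarrow> real^3" where "F' t = (\<chi> i. y' (t - delay_shift i))" for t
  have cF': "continuous_on {-1..2} F'"
    unfolding F'_def
    by (intro continuous_on_vec_lambda continuous_on_compose2[OF cy'] continuous_intros) auto
  have nzF': "F' s \<noteq> 0" if "s \<in> {-1..2}" for s unfolding F'_def by (rule imm)
  obtain \<delta> \<epsilon>0 where \<delta>: "\<delta> > 0" "\<epsilon>0 > 0"
    "\<And>G G'. (\<And>s. (G has_vector_derivative G' s) (at s)) \<Longrightarrow> (\<And>s. s \<in> {-1..2} \<Longrightarrow> dist (G' s) (F' s) < \<epsilon>0) \<Longrightarrow>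
      (\<forall>s\<in>{-1..2}. G' s \<noteq> 0) \<and> (\<forall>s\<in>{-1..2}. \<forall>t\<in>{-1..2}. s < t \<and> t - s < \<delta> \<longrightarrow> G s \<noteq> G t)"
    by (rule locally_injective_perturbation[OF cF' nzF']) (assumption, (rule that; blast))
  define K where "K = {z::real \<times> real. z \<in> {0..1} \<times> {0..1} \<and> \<delta> \<le> snd z - fst z \<and> snd z - fst z \<le> 1 - \<delta>}"
  have K: "compact K"
  proof -
    have "K = ({0..1} \<times> {0..1}) \<inter> {z. \<delta> \<le> snd z - fst z} \<inter> {z. snd z - fst z \<le> 1 - \<delta>}"
      by (auto simp: K_def)
    moreover have "closed {z::real\<times>real. \<delta> \<le> snd z - fst z}" "closed {z::real\<times>real. snd z - fst z \<le> 1 - \<delta>}"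
      by (intro closed_Collect_le continuous_intros)+
    ultimately show ?thesis by (simp add: compact_Int_closed compact_Times)
  qed
  define b :: "real \<times> real \<Rightarrow> real^3" where "b z = (\<chi> i. y (snd z - delay_shift i) - y (fst z - delay_shift i))" for z
  define L :: "'a \<times> real \<Rightarrow> real \<times> real \<Rightarrow> real^3" where
    "L q z = (\<chi> i. W q (snd z - delay_shift i) - W q (fst z - delay_shift i))" for q z
  obtain B where B: "finite B" "\<And>q. q \<in> B \<Longrightarrow> admissible_bump U q"
    "\<And>\<epsilon>. \<epsilon> > 0 \<Longrightarrow> \<exists>c. (\<forall>q. \<bar>c q\<bar> < \<epsilon>) \<and> (\<forall>z\<in>K. b z + (\<Sum>q\<in>B. c q *\<^sub>R L q z) \<noteq> 0)"
  proof (rule generic_avoidance[where E=K and b=b and L=L and P="admissible_bump U"])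
    show "(\<lambda>z. b z $ i) differentiable_on UNIV" for i
    proof -
      have "y differentiable (at t)" for t using dy(1) by (auto simp: real_differentiable_def)
      then show ?thesis unfolding b_def
        by (simp, intro differentiable_on_diff differentiable_shift bounded_linear_fst bounded_linear_snd)
    qed
    show "(\<lambda>z. L q z $ i) differentiable_on UNIV" for q i
    proof -
      have "W q differentiable (at t)" for t using dW unfolding real_differentiable_def by blast
      then show ?thesis unfolding L_def
        by (simp, intro differentiable_on_diff differentiable_shift bounded_linear_fst bounded_linear_snd)
    qed
    show "\<exists>q :: 3 \<Rightarrow> 'a \<times> real. (\<forall>l. admissible_bump U (q l)) \<and> det (\<chi> i l. L (q l) z $ i) \<noteq> 0" if "z \<in> K" for z
    proof -
      have "snd z - fst z \<notin> \<int>"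
      proof
        assume "snd z - fst z \<in> \<int>"
        then obtain n where "snd z - fst z = of_int n" by (auto elim: Ints_cases)
        moreover have "0 < snd z - fst z" "snd z - fst z < 1" using that \<delta>(1) by (auto simp: K_def)
        ultimately show False by simp
      qed
      then obtain q :: "3 \<Rightarrow> 'a \<times> real" where "\<And>l. admissible_bump U (q l)"
        "det (\<chi> i l. bump N (q l) (u (snd z - delay_shift i)) - bump N (q l) (u (fst z - delay_shift i))) \<noteq> 0"
        by (rule bumps_separation[OF \<open>open U\<close> N2 uU per(1) inj]) (rule that; assumption)
      then show ?thesis unfolding L_def W_def by (intro exI[of _ q]) simp
    qed
  qed (use K in auto)
  have "\<forall>q. \<exists>M. \<forall>s\<in>{-1..2}. norm ((\<chi> i. W' q (s - delay_shift i)) :: real^3) \<le> M"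
  proof
    fix q
    have cW': "continuous_on UNIV (W' q)"
      using dW' by (intro continuous_at_imp_continuous_on ballI differentiable_imp_continuous_within)
    have "continuous_on {-1..2} (\<lambda>s. (\<chi> i. W' q (s - delay_shift i)) :: real^3)"
      by (intro continuous_on_vec_lambda continuous_on_compose2[OF cW'] continuous_intros) auto
    then show "\<exists>M. \<forall>s\<in>{-1..2}. norm ((\<chi> i. W' q (s - delay_shift i)) :: real^3) \<le> M"
      by (auto dest: continuous_on_bounded_interval)
  qed
  then obtain M where M: "\<And>q s. s \<in> {-1..2} \<Longrightarrow> norm ((\<chi> i. W' q (s - delay_shift i)) :: real^3) \<le> M q"
    unfolding choice_iff by blast
  have M0: "M q \<ge> 0" for q
  proof -
    have "0 \<le> norm ((\<chi> i. W' q (0 - delay_shift i)) :: real^3)" by simp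
    also have "\<dots> \<le> M q" by (rule M) simp
    finally show ?thesis .
  qed
  show thesis
  proof (rule that[OF B(1,2)])
    fix \<epsilon> :: real assume "\<epsilon> > 0"
    \<comment> \<open>Keeps the change of the velocity below \<epsilon>0; the added 1 avoids a zero
      denominator.\<close>
    define \<epsilon>1 where "\<epsilon>1 = min \<epsilon> (\<epsilon>0 / (1 + (\<Sum>q\<in>B. M q)))"
    have S: "(\<Sum>q\<in>B. M q) \<ge> 0" using M0 by (simp add: sum_nonneg)
    have \<epsilon>1: "\<epsilon>1 > 0" "\<epsilon>1 \<le> \<epsilon>" using \<open>\<epsilon> > 0\<close> \<delta>(2) S by (auto simp: \<epsilon>1_def)
    obtain c where c: "\<And>q. \<bar>c q\<bar> < \<epsilon>1" "\<And>z. z \<in> K \<Longrightarrow> b z + (\<Sum>q\<in>B. c q *\<^sub>R L q z) \<noteq> 0"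
      using B(3)[OF \<epsilon>1(1)] by blast
    define G :: "real \<Rightarrow> real^3" where "G t = (\<chi> i. y (t - delay_shift i) + (\<Sum>q\<in>B. c q * W q (t - delay_shift i)))" for t
    define G' :: "real \<Rightarrow> real^3" where "G' t = (\<chi> i. y' (t - delay_shift i) + (\<Sum>q\<in>B. c q * W' q (t - delay_shift i)))" for t
    have dG: "(G has_vector_derivative G' t) (at t)" for t
      unfolding G_def G'_def
    proof (rule has_vector_derivative_vec)
      fix i :: 3
      show "((\<lambda>t. y (t - delay_shift i) + (\<Sum>q\<in>B. c q * W q (t - delay_shift i))) has_real_derivative
          y' (t - delay_shift i) + (\<Sum>q\<in>B. c q * W' q (t - delay_shift i))) (at t)"
        by (intro DERIV_add DERIV_sum DERIV_cmult has_real_derivative_shift dy dW)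
    qed
    have perG: "G (t + 1) = G t" "G' (t + 1) = G' t" for t
    proof -
      have "t + 1 - x = (t - x) + 1" for x by simp
      then show "G (t + 1) = G t" "G' (t + 1) = G' t" by (simp_all only: G_def G'_def W_def W'_def per)
    qed
    have "dist (G' s) (F' s) < \<epsilon>0" if "s \<in> {-1..2}" for s
    proof -
      have "G' s - F' s = (\<Sum>q\<in>B. c q *\<^sub>R (\<chi> i. W' q (s - delay_shift i)))"
        by (simp add: G'_def F'_def vec_eq_iff)
      also have "norm \<dots> \<le> (\<Sum>q\<in>B. norm (c q *\<^sub>R ((\<chi> i. W' q (s - delay_shift i)) :: real^3)))" by (rule norm_sum)
      also have "\<dots> \<le> (\<Sum>q\<in>B. \<epsilon>1 * M q)"
      proof (rule sum_mono)
        fix q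
        have "norm (c q *\<^sub>R ((\<chi> i. W' q (s - delay_shift i)) :: real^3)) = \<bar>c q\<bar> * norm ((\<chi> i. W' q (s - delay_shift i)) :: real^3)" by simp
        also have "\<dots> \<le> \<epsilon>1 * M q" using c(1)[of q] M[OF that, of q] by (intro mult_mono) auto
        finally show "norm (c q *\<^sub>R ((\<chi> i. W' q (s - delay_shift i)) :: real^3)) \<le> \<epsilon>1 * M q" .
      qed
      also have "\<dots> = \<epsilon>1 * (\<Sum>q\<in>B. M q)" by (simp add: sum_distrib_left)
      also have "\<dots> \<le> \<epsilon>0 / (1 + (\<Sum>q\<in>B. M q)) * (\<Sum>q\<in>B. M q)"
        using S by (intro mult_right_mono) (auto simp: \<epsilon>1_def)
      also have "\<dots> < \<epsilon>0" using S \<delta>(2) by (simp add: divide_less_eq algebra_simps)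
      finally show ?thesis by (simp add: dist_norm)
    qed
    from \<delta>(3)[OF dG this] have loc: "\<And>s. s \<in> {-1..2} \<Longrightarrow> G' s \<noteq> 0"
      "\<And>s t. s \<in> {-1..2} \<Longrightarrow> t \<in> {-1..2} \<Longrightarrow> s < t \<Longrightarrow> t - s < \<delta> \<Longrightarrow> G s \<noteq> G t" by auto
    have "G' t \<noteq> 0" for t
    proof -
      have "frac t \<in> {-1..2::real}" using frac_lt_1[of t] frac_ge_0[of t] by (simp del: frac_ge_0)
      then have "G' (frac t) \<noteq> 0" by (rule loc(1))
      then show ?thesis using periodic_eq_frac[of G' t, OF perG(2)] by simp
    qed
    moreover have "inj_on G {0..<1}"
    proof (rule linorder_inj_onI)
      fix s t :: real assume "s < t" and "s \<in> {0..<1}" "t \<in> {0..<1}"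
      then have st: "0 \<le> s" "s < t" "t < 1" by auto
      show "G s \<noteq> G t"
      proof (cases "t - s < \<delta>")
        case True then show ?thesis using loc(2)[of s t] st by auto
      next
        case A: False
        show ?thesis
        proof (cases "t - s \<le> 1 - \<delta>")
          case True
          have "(s, t) \<in> K" using st A True by (auto simp: K_def)
          from c(2)[OF this] have "b (s, t) + (\<Sum>q\<in>B. c q *\<^sub>R L q (s, t)) \<noteq> 0" .
          moreover have "G t - G s = b (s, t) + (\<Sum>q\<in>B. c q *\<^sub>R L q (s, t))"
            by (simp add: b_def L_def G_def vec_eq_iff sum_subtractf right_diff_distrib)
          ultimately show ?thesis by (metis right_minus_eq)
        next
          case False
          \<comment> \<open>The two times are closer than \<delta> across the endpoint, and t - 1
            still lies in the extended interval.\<close>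
          have "G (t - 1) \<noteq> G s" using loc(2)[of "t - 1" s] st False by auto
          then show ?thesis using perG(1)[of "t - 1"] by auto
        qed
      qed
    qed auto
    ultimately show "\<exists>c. (\<forall>q. \<bar>c q\<bar> < \<epsilon>) \<and>
       (\<forall>t. (\<chi> i. y' (t - delay_shift i) + (\<Sum>q\<in>B. c q * bump_deriv N q (u (t - delay_shift i)) (u' (t - delay_shift i)))) \<noteq> (0 :: real^3)) \<and>
       inj_on (\<lambda>t. (\<chi> i. y (t - delay_shift i) + (\<Sum>q\<in>B. c q * bump N q (u (t - delay_shift i)))) :: real^3) {0..<1}"
    proof (intro exI[of _ c] conjI allI)
      show "\<bar>c q\<bar> < \<epsilon>" for q using c(1)[of q] \<epsilon>1(2) by linarith
    qed (simp_all only: G_def[abs_def] G'_def[abs_def] W_def[abs_def] W'_def[abs_def] not_False_eq_True)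
  qed
qed

section \<open>Convergence of orbits and of vector fields\<close>

text \<open>Bootstrapping: if the curves are of class \<open>C^m\<close>, so are their velocities
  g(P), hence the curves are of class \<open>C^(m+1)\<close>, up to one order more than the field.
  This is the gain that turns \<open>C^(r-1)\<close> closeness of fields into \<open>C^r\<close>
  closeness of orbits.\<close>

lemma solution_family_smooth:
  fixes P :: "'c::topological_space \<Rightarrow> real \<Rightarrow> 'a::euclidean_space"
  assumes "open W" and g: "Ck_family k C W g"
    and cP: "continuous_on (C \<times> UNIV) (\<lambda>z. P (fst z) (snd z))"
    and PW: "\<And>c t. c \<in> C \<Longrightarrow> P c t \<in> W"
    and dP: "\<And>c t. c \<in> C \<Longrightarrow> (P c has_vector_derivative g c (P c t)) (at t)"
  shows "Ck_family (Suc k) C UNIV P"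
proof -
  have "Ck_family m C UNIV P" if "m \<le> Suc k" for m
    using that
  proof (induction m)
    case 0 then show ?case using cP by simp
  next
    case (Suc m)
    show ?case
    proof (rule Ck_family_SucI[OF open_UNIV cP])
      show "(P c has_derivative (\<lambda>h. h *\<^sub>R g c (P c t))) (at t)" if "c \<in> C" for c t
        using dP[OF that, of t] by (simp add: has_vector_derivative_def)
      show "Ck_family m C UNIV (\<lambda>c t. i *\<^sub>R g c (P c t))" for i :: real
      proof (rule Ck_family_linear[OF open_UNIV bounded_linear_scaleR_right])
        show "Ck_family m C UNIV (\<lambda>c t. g c (P c t))"
          by (rule Ck_family_compose[where V=W and h=g])
            (use Suc \<open>open W\<close> PW Ck_family_mono[OF g] in auto)
      qed
    qed
  qed
  then show ?thesis by blast
qed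

lemma higher_vector_deriv_Suc:
  "higher_vector_deriv (Suc j) p = higher_vector_deriv j (\<lambda>t. vector_derivative p (at t))"
  by (simp add: higher_vector_deriv_def funpow_Suc_right del: funpow.simps)

lemma continuous_on_higher_vector_deriv_family:
  fixes P :: "'c::topological_space \<Rightarrow> real \<Rightarrow> 'a::real_normed_vector"
  shows "Ck_family m C UNIV P \<Longrightarrow> j \<le> m \<Longrightarrow>
    continuous_on (C \<times> UNIV) (\<lambda>z. higher_vector_deriv j (P (fst z)) (snd z))"
proof (induction j arbitrary: m P)
  case 0
  then show ?case using Ck_family_continuous by (simp add: higher_vector_deriv_def)
next
  case (Suc j)
  obtain n where m: "m = Suc n" "j \<le> n" using Suc.prems(2) by (cases m) auto
  have eq: "frechet_derivative (P c) (at t) 1 = vector_derivative (P c) (at t)" if "c \<in> C" for c t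
  proof -
    have D: "(P c has_derivative frechet_derivative (P c) (at t)) (at t)"
      using Ck_family_has_derivative[OF Suc.prems(1)[unfolded m] that] by simp
    have "frechet_derivative (P c) (at t) = (\<lambda>x. x *\<^sub>R frechet_derivative (P c) (at t) 1)"
    proof
      fix x show "frechet_derivative (P c) (at t) x = x *\<^sub>R frechet_derivative (P c) (at t) 1"
        using linear_scale[OF has_derivative_linear[OF D], of x 1] by simp
    qed
    then have "(P c has_vector_derivative frechet_derivative (P c) (at t) 1) (at t)"
      unfolding has_vector_derivative_def by (rule subst) (rule D)
    then show ?thesis by (simp add: vector_derivative_at)
  qed
  have "Ck_family n C UNIV (\<lambda>c t. frechet_derivative (P c) (at t) 1)"
    using Suc.prems(1) m by simp
  then have "Ck_family n C UNIV (\<lambda>c t. vector_derivative (P c) (at t))"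
    by (rule Ck_family_cong[OF open_UNIV, rotated]) (use eq in auto)
  from Suc.IH[OF this m(2)] show ?case by (simp add: higher_vector_deriv_Suc)
qed

lemma periodic_orbit_dist_family:
  fixes P :: "'c::topological_space \<Rightarrow> real \<Rightarrow> 'a::real_normed_vector"
  assumes P: "Ck_family r C UNIV P" and S: "continuous_on C S" and "c0 \<in> C" "e > 0"
  shows "\<forall>\<^sub>F c in nhds c0. c \<in> C \<longrightarrow> periodic_orbit_dist r (P c0) (S c0) (P c) (S c) < e"
proof -
  define F where "F j c s = higher_vector_deriv j (P c) (s * S c)" for j c s
  have cS: "continuous_on (C \<times> A) (\<lambda>z. S (fst z))" for A :: "real set"
    by (rule continuous_on_compose2[OF S]) (auto intro!: continuous_intros)
  have cF: "continuous_on (C \<times> {0..1}) (\<lambda>z. F j (fst z) (snd z))" if "j \<le> r" for j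
  proof -
    have "continuous_on (C \<times> {0..1}) (\<lambda>z. (\<lambda>w. higher_vector_deriv j (P (fst w)) (snd w)) (fst z, snd z * S (fst z)))"
      by (rule continuous_on_compose2[OF continuous_on_higher_vector_deriv_family[OF P that]])
        (auto intro!: continuous_intros cS)
    then show ?thesis by (simp add: F_def)
  qed
  have "\<forall>\<^sub>F c in nhds c0. \<forall>j\<in>{0..r}. c \<in> C \<longrightarrow> (\<forall>s\<in>{0..1}. dist (F j c s) (F j c0 s) < e/3)"
    by (intro eventually_ball_finite ballI family_eventually_close[OF cF]) (use assms in auto)
  moreover have "\<forall>\<^sub>F c in nhds c0. c \<in> C \<longrightarrow> (\<forall>s\<in>{0::real}. dist (S c) (S c0) < e/3)"
    by (rule family_eventually_close[OF cS]) (use assms in auto)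
  ultimately show ?thesis
  proof eventually_elim
    case (elim c)
    show ?case
    proof
      assume c: "c \<in> C"
      have "(SUP k\<in>{0..r}. SUP s\<in>{0..<1}. norm (F k c0 s - F k c s)) \<le> e/3"
      proof (intro cSUP_least)
        fix k s assume "k \<in> {0..r}" "s \<in> {0..<1::real}"
        then have "dist (F k c s) (F k c0 s) < e/3" using elim(1) c by auto
        then show "norm (F k c0 s - F k c s) \<le> e/3" by (simp add: dist_norm norm_minus_commute)
      qed auto
      moreover have "\<bar>S c0 - S c\<bar> < e/3" using elim(2) c by (simp add: dist_real_def abs_minus_commute)
      ultimately show "periodic_orbit_dist r (P c0) (S c0) (P c) (S c) < e"
        using \<open>e > 0\<close> unfolding periodic_orbit_dist_def F_def by linarith
    qed
  qed
qed

lemma periodic_orbit_dist_self [simp]: "periodic_orbit_dist r p T p T = 0"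
  by (simp add: periodic_orbit_dist_def)

text \<open>The supremum in \<open>periodic_orbit_dist\<close> is taken over reals and is
  informative only for bounded sets, so the triangle inequality needs this condition.\<close>

definition bounded_derivs :: "nat \<Rightarrow> (real \<Rightarrow> 'a::real_normed_vector) \<Rightarrow> real \<Rightarrow> bool" where
  "bounded_derivs r p T \<longleftrightarrow> (\<forall>k\<le>r. bounded ((\<lambda>s. higher_vector_deriv k p (s * T)) ` {0..<1}))"

lemma periodic_orbit_dist_triangle:
  assumes "bounded_derivs r p T" "bounded_derivs r p' T'" "bounded_derivs r p'' T''"
  shows "periodic_orbit_dist r p T p'' T'' \<le> periodic_orbit_dist r p T p' T' + periodic_orbit_dist r p' T' p'' T''"
proof -
  define D where "D p T p' T' k s = norm (higher_vector_deriv k p (s * T) - higher_vector_deriv k p' (s * T'))"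
    for p p' :: "real \<Rightarrow> 'a" and T T' k s
  have bdd: "bdd_above (D p T p' T' k ` {0..<1})" if "bounded_derivs r p T" "bounded_derivs r p' T'" "k \<le> r"
    for p p' :: "real \<Rightarrow> 'a" and T T' k
  proof -
    have "bounded ((\<lambda>s. higher_vector_deriv k p (s * T) - higher_vector_deriv k p' (s * T')) ` {0..<1})"
      using that by (auto simp: bounded_derivs_def intro!: bounded_minus_comp)
    then show ?thesis
      unfolding D_def bdd_above_def bounded_iff by auto
  qed
  have le: "D p T p' T' k s \<le> (SUP k\<in>{0..r}. SUP s\<in>{0..<1}. D p T p' T' k s)"
    if "bounded_derivs r p T" "bounded_derivs r p' T'" "k \<in> {0..r}" "s \<in> {0..<1}"
    for p p' :: "real \<Rightarrow> 'a" and T T' k s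
  proof -
    have "D p T p' T' k s \<le> (SUP s\<in>{0..<1}. D p T p' T' k s)"
      by (rule cSUP_upper[OF that(4) bdd[OF that(1,2)]]) (use that in auto)
    also have "\<dots> \<le> (SUP k\<in>{0..r}. SUP s\<in>{0..<1}. D p T p' T' k s)"
      by (rule cSUP_upper[OF that(3)]) auto
    finally show ?thesis .
  qed
  have "(SUP k\<in>{0..r}. SUP s\<in>{0..<1}. D p T p'' T'' k s) \<le>
      (SUP k\<in>{0..r}. SUP s\<in>{0..<1}. D p T p' T' k s) + (SUP k\<in>{0..r}. SUP s\<in>{0..<1}. D p' T' p'' T'' k s)"
  proof (intro cSUP_least)
    fix k s assume ks: "k \<in> {0..r}" "s \<in> {0..<1::real}"
    have "D p T p'' T'' k s \<le> D p T p' T' k s + D p' T' p'' T'' k s"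
      unfolding D_def by (rule norm_diff_triangle_le[OF order_refl order_refl])
    also have "\<dots> \<le> (SUP k\<in>{0..r}. SUP s\<in>{0..<1}. D p T p' T' k s) + (SUP k\<in>{0..r}. SUP s\<in>{0..<1}. D p' T' p'' T'' k s)"
      by (intro add_mono le assms ks)
    finally show "D p T p'' T'' k s \<le> (SUP k\<in>{0..r}. SUP s\<in>{0..<1}. D p T p' T' k s) + (SUP k\<in>{0..r}. SUP s\<in>{0..<1}. D p' T' p'' T'' k s)" .
  qed auto
  then show ?thesis unfolding periodic_orbit_dist_def D_def by linarith
qed

lemma bounded_derivs_periodic_solution:
  fixes f :: "'a::euclidean_space \<Rightarrow> 'a"
  assumes "open U" "Ck_on k U f" "periodic_solution U f T p"
  shows "bounded_derivs (Suc k) p T"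
  unfolding bounded_derivs_def
proof (intro allI impI)
  fix j assume j: "j \<le> Suc k"
  have dp: "(p has_vector_derivative f (p t)) (at t)" and pU: "p t \<in> U" for t
    using assms(3) by (auto simp: periodic_solution_def)
  have cp: "continuous_on UNIV p"
    by (rule has_vector_derivative_imp_continuous_on[OF dp])
  have "Ck_family (Suc k) {0::real} UNIV (\<lambda>_. p)"
  proof (rule solution_family_smooth[OF assms(1)])
    show "Ck_family k {0::real} U (\<lambda>_. f)" using assms(2) by (simp add: Ck_on_iff_Ck_family[where c="0::real"])
    show "continuous_on ({0::real} \<times> UNIV) (\<lambda>z. p (snd z))"
      by (rule continuous_on_compose2[OF cp]) (auto intro!: continuous_intros)
  qed (use dp pU in auto)
  from continuous_on_higher_vector_deriv_family[OF this j]
  have c: "continuous_on ({0::real} \<times> UNIV) (\<lambda>z. higher_vector_deriv j p (snd z))" by simp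
  have "continuous_on {0..1} (\<lambda>s. (\<lambda>z. higher_vector_deriv j p (snd z)) (0::real, s * T))"
    by (rule continuous_on_compose2[OF c]) (auto intro!: continuous_intros)
  then have "compact ((\<lambda>s. higher_vector_deriv j p (s * T)) ` {0..1})"
    by (intro compact_continuous_image) auto
  then have "bounded ((\<lambda>s. higher_vector_deriv j p (s * T)) ` {0..1})" by (rule compact_imp_bounded)
  then show "bounded ((\<lambda>s. higher_vector_deriv j p (s * T)) ` {0..<1})"
    by (rule bounded_subset) auto
qed

lemma solution_family_converges:
  fixes g :: "'c::topological_space \<Rightarrow> real^'n \<Rightarrow> real^'n"
  assumes W: "open W" "W \<subseteq> U" and g: "Ck_family k C W g" and "k \<ge> 1" and "c0 \<in> C"
    and S: "continuous_on C S" "\<And>c. c \<in> C \<Longrightarrow> S c > 0"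
    and cu: "continuous_on (C \<times> UNIV) (\<lambda>z. u (fst z) (snd z))"
    and uW: "\<And>c s. c \<in> C \<Longrightarrow> u c s \<in> W"
    and per: "\<And>c s. c \<in> C \<Longrightarrow> u c (s + 1) = u c s"
    and du: "\<And>c s. c \<in> C \<Longrightarrow> (u c has_vector_derivative S c *\<^sub>R g c (u c s)) (at s)"
    and hyp: "hyperbolic_periodic_solution U (g c0) (S c0) (\<lambda>t. u c0 (t / S c0))" and "e > 0"
  shows "\<forall>\<^sub>F c in nhds c0. c \<in> C \<longrightarrow> hyperbolic_periodic_solution U (g c) (S c) (\<lambda>t. u c (t / S c)) \<and>
     periodic_orbit_dist (Suc k) (\<lambda>t. u c0 (t / S c0)) (S c0) (\<lambda>t. u c (t / S c)) (S c) < e"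
proof -
  have g1: "Ck_family (Suc 0) C W g" using Ck_family_mono[OF g, of "Suc 0"] \<open>k \<ge> 1\<close> by simp
  define P where "P c t = u c (t / S c)" for c t
  have "continuous_on (C \<times> UNIV) (\<lambda>z. S (fst z))"
    by (rule continuous_on_compose2[OF S(1)]) (auto intro!: continuous_intros)
  then have "continuous_on (C \<times> UNIV) (\<lambda>z. (\<lambda>w. u (fst w) (snd w)) (fst z, snd z / S (fst z)))"
    by (intro continuous_on_compose2[OF cu] continuous_intros) (use S(2) in \<open>auto simp: less_imp_neq[symmetric]\<close>)
  then have cP: "continuous_on (C \<times> UNIV) (\<lambda>z. P (fst z) (snd z))" by (simp add: P_def)
  have "Ck_family (Suc k) C UNIV P"
  proof (rule solution_family_smooth[OF W(1) g cP])
    show "P c t \<in> W" if "c \<in> C" for c t using uW[OF that] by (simp add: P_def)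
    show "(P c has_vector_derivative g c (P c t)) (at t)" if "c \<in> C" for c t
      unfolding P_def by (rule has_vector_derivative_rescale_divide[OF S(2)[OF that] du[OF that]])
  qed
  from periodic_orbit_dist_family[OF this S(1) \<open>c0 \<in> C\<close> \<open>e > 0\<close>]
  have "\<forall>\<^sub>F c in nhds c0. c \<in> C \<longrightarrow> periodic_orbit_dist (Suc k) (P c0) (S c0) (P c) (S c) < e" .
  moreover have "\<forall>\<^sub>F c in nhds c0. c \<in> C \<longrightarrow> hyperbolic_periodic_solution U (g c) (S c) (\<lambda>t. u c (t / S c))"
    by (rule hyperbolic_family[OF W g1 \<open>c0 \<in> C\<close> S cu uW per du hyp])
  ultimately show ?thesis by eventually_elim (simp add: P_def[abs_def])
qed

section \<open>Openness in the \<open>C^k\<close> topology through sequences\<close>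

lemma finite_partial_lists: "finite {vs. set vs \<subseteq> (Basis :: 'a::euclidean_space set) \<and> length vs \<le> k}"
  by (rule finite_lists_length_le) simp

lemma Ck_family_eventually_in_open:
  fixes h :: "'c::topological_space \<Rightarrow> 'a::euclidean_space \<Rightarrow> 'a"
  assumes h: "Ck_family k C U h" "\<And>c. c \<in> C \<Longrightarrow> h c \<in> Ck_fields k U" and "c0 \<in> C"
    and V: "openin (Ck_topology k U) V" "h c0 \<in> V"
  shows "\<forall>\<^sub>F c in nhds c0. c \<in> C \<longrightarrow> h c \<in> V"
proof -
  obtain K \<epsilon> where K: "compact K" "K \<subseteq> U" "\<epsilon> > 0" "Ck_nbhd k U (h c0) K \<epsilon> \<subseteq> V"
    using V unfolding openin_Ck_topology by blast
  have "\<forall>\<^sub>F c in nhds c0. \<forall>vs\<in>{vs. set vs \<subseteq> Basis \<and> length vs \<le> k}.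
      c \<in> C \<longrightarrow> (\<forall>x\<in>K. dist (iter_partial vs (h c) x) (iter_partial vs (h c0) x) < \<epsilon>)"
  proof (rule eventually_ball_finite[OF finite_partial_lists], rule ballI)
    fix vs :: "'a list" assume vs: "vs \<in> {vs. set vs \<subseteq> Basis \<and> length vs \<le> k}"
    have "continuous_on (C \<times> K) (\<lambda>z. iter_partial vs (h (fst z)) (snd z))"
      using h(1) vs K(2) unfolding Ck_family_iff_iter_partial
      by (auto intro: continuous_on_subset[of "C \<times> U"])
    then show "\<forall>\<^sub>F c in nhds c0. c \<in> C \<longrightarrow> (\<forall>x\<in>K. dist (iter_partial vs (h c) x) (iter_partial vs (h c0) x) < \<epsilon>)"
      by (rule family_eventually_close[OF _ K(1) \<open>c0 \<in> C\<close> K(3)])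
  qed
  then show ?thesis
  proof eventually_elim
    case (elim c)
    show ?case
    proof
      assume "c \<in> C"
      then have "h c \<in> Ck_nbhd k U (h c0) K \<epsilon>"
        using elim h(2) unfolding Ck_nbhd_def dist_norm by blast
      then show "h c \<in> V" using K(4) by blast
    qed
  qed
qed

text \<open>A sequence of fields that approach \<open>G 0\<close> on \<open>K\<close> at the rate of
  their parameter is a \<open>C^k\<close> family on \<open>W\<close>, including the limit.\<close>

lemma Ck_family_of_Ck_nbhds:
  fixes G :: "real \<Rightarrow> 'a::euclidean_space \<Rightarrow> 'a"
  assumes G: "\<And>c. c \<in> harmonic_set \<Longrightarrow> c \<noteq> 0 \<Longrightarrow> G c \<in> Ck_nbhd k U (G 0) K c" and G0: "G 0 \<in> Ck_fields k U"
    and "W \<subseteq> K" "K \<subseteq> U"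
  shows "Ck_family k harmonic_set W G"
proof -
  have Gk: "Ck_on k U (G c)" if "c \<in> harmonic_set" for c
    using G[OF that] G0 by (cases "c = 0") (auto simp: Ck_nbhd_def Ck_fields_def)
  have WU: "W \<subseteq> U" using assms by blast
  show ?thesis
    unfolding Ck_family_iff_iter_partial
  proof (intro conjI allI impI ballI)
    show "iter_partial vs (G c) differentiable at x"
      if "set vs \<subseteq> Basis \<and> length vs < k" "c \<in> harmonic_set" "x \<in> W" for vs c x
      using Gk[OF that(2)] that WU unfolding Ck_on_def by blast
    fix vs :: "'a list" assume vs: "set vs \<subseteq> Basis \<and> length vs \<le> k"
    have cont: "continuous_on W (iter_partial vs (G c))" if "c \<in> harmonic_set" for c
      using Gk[OF that] vs WU unfolding Ck_on_def by (blast intro: continuous_on_subset)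
    show "continuous_on (harmonic_set \<times> W) (\<lambda>z. iter_partial vs (G (fst z)) (snd z))"
    proof (rule continuous_on_harmonic_family[OF order_refl cont])
      fix x e assume x: "x \<in> W" and e: "e > (0::real)"
      obtain d where d: "d > 0" "\<And>y. y \<in> W \<Longrightarrow> dist y x < d \<Longrightarrow> dist (iter_partial vs (G 0) y) (iter_partial vs (G 0) x) < e/2"
        using cont[OF zero_in_harmonic_set] x e unfolding continuous_on_iff by (metis half_gt_zero)
      have "dist (iter_partial vs (G c) y) (iter_partial vs (G 0) x) < e"
        if c: "c \<in> harmonic_set" "c \<noteq> 0" "c < min d (e/2)" and y: "y \<in> W" "dist y x < min d (e/2)" for c y
      proof -
        have "dist (iter_partial vs (G c) y) (iter_partial vs (G 0) y) < c"
          using G[OF c(1,2)] vs y(1) \<open>W \<subseteq> K\<close> unfolding Ck_nbhd_def dist_norm by blast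
        then show ?thesis
          using d(2)[OF y(1)] y(2) c(3) dist_triangle[of "iter_partial vs (G c) y" "iter_partial vs (G 0) x" "iter_partial vs (G 0) y"]
          by simp
      qed
      then show "\<exists>d>0. \<forall>c\<in>harmonic_set. \<forall>y\<in>W. c \<noteq> 0 \<longrightarrow> c < d \<longrightarrow> dist y x < d \<longrightarrow>
          dist (iter_partial vs (G c) y) (iter_partial vs (G 0) x) < e"
        using d(1) e by (intro exI[of _ "min d (e/2)"]) auto
    qed
  qed
qed

text \<open>If no \<epsilon> worked, choosing for each \<epsilon> a field outside \<open>X\<close>
  would give a sequence converging to \<open>f\<close> on \<open>K\<close> that never meets
  \<open>X\<close>. A contradiction therefore needs only one nonzero parameter with
  \<open>G c\<close> in \<open>X\<close>.\<close>

lemma openin_Ck_topology_by_families: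
  assumes "X \<subseteq> Ck_fields k U"
    and X: "\<And>f. f \<in> X \<Longrightarrow> \<exists>K. compact K \<and> K \<subseteq> U \<and>
      (\<forall>G. G 0 = f \<and> (\<forall>c\<in>harmonic_set. c \<noteq> 0 \<longrightarrow> G c \<in> Ck_nbhd k U f K c) \<longrightarrow> (\<exists>c\<in>harmonic_set. c \<noteq> 0 \<and> G c \<in> X))"
  shows "openin (Ck_topology k U) X"
  unfolding openin_Ck_topology
proof (intro conjI assms(1) ballI)
  fix f assume "f \<in> X"
  from X[OF this] obtain K where K: "compact K" "K \<subseteq> U"
    "\<forall>G. G 0 = f \<and> (\<forall>c\<in>harmonic_set. c \<noteq> 0 \<longrightarrow> G c \<in> Ck_nbhd k U f K c) \<longrightarrow> (\<exists>c\<in>harmonic_set. c \<noteq> 0 \<and> G c \<in> X)"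
    by (elim exE conjE)
  have "\<exists>\<epsilon>>0. Ck_nbhd k U f K \<epsilon> \<subseteq> X"
  proof (rule ccontr)
    assume "\<not> (\<exists>\<epsilon>>0. Ck_nbhd k U f K \<epsilon> \<subseteq> X)"
    then have "\<exists>g. \<epsilon> > 0 \<longrightarrow> g \<in> Ck_nbhd k U f K \<epsilon> - X" for \<epsilon> by blast
    then obtain g where g: "\<And>\<epsilon>. \<epsilon> > 0 \<Longrightarrow> g \<epsilon> \<in> Ck_nbhd k U f K \<epsilon> - X" by metis
    define G where "G c = (if c = 0 then f else g c)" for c
    have "\<exists>c\<in>harmonic_set. c \<noteq> 0 \<and> G c \<in> X"
    proof (rule K(3)[rule_format], intro conjI ballI impI)
      fix c assume "c \<in> harmonic_set" "c \<noteq> 0"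
      then have "c > 0" using harmonic_set_nonneg[of c] by simp
      then show "G c \<in> Ck_nbhd k U f K c" using g[of c] by (auto simp: G_def)
    qed (simp add: G_def)
    then obtain c where "c \<in> harmonic_set" "c \<noteq> 0" "G c \<in> X" by blast
    then show False using harmonic_set_nonneg[of c] g[of c] by (auto simp: G_def)
  qed
  with K(1,2) show "\<exists>K \<epsilon>. compact K \<and> K \<subseteq> U \<and> \<epsilon> > 0 \<and> Ck_nbhd k U f K \<epsilon> \<subseteq> X" by blast
qed

lemma eventually_harmonic_set:
  assumes "\<forall>\<^sub>F c in nhds (0::real). c \<in> harmonic_set \<longrightarrow> Q c"
  obtains c where "c \<in> harmonic_set" "c \<noteq> 0" "Q c"
proof -
  obtain d where d: "d > 0" "\<And>c. dist c 0 < d \<Longrightarrow> c \<in> harmonic_set \<Longrightarrow> Q c"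
    using assms unfolding eventually_nhds_metric by blast
  obtain n where n: "inverse (real (Suc n)) < d" using reals_Archimedean[OF d(1)] by blast
  have "inverse (real (Suc n)) \<in> harmonic_set" by (auto simp: harmonic_set_def)
  then show thesis using that[of "inverse (real (Suc n))"] d(2)[of "inverse (real (Suc n))"] n by simp
qed

text \<open>Two sets are needed: closeness of fields is measured on the compact \<open>K\<close>,
  while families are differentiated on the open \<open>W\<close> inside it.\<close>

lemma orbit_neighborhood:
  fixes u :: "real \<Rightarrow> 'a::euclidean_space"
  assumes "open U" "continuous_on UNIV u" "\<And>s. u (s + 1) = u s" "\<And>s. u s \<in> U"
  obtains K W where "compact K" "K \<subseteq> U" "open W" "W \<subseteq> K" "\<And>s. u s \<in> W"
proof -
  have R: "compact (range u)" "range u \<subseteq> U" using periodic_orbit_compact[OF assms(2,3)] assms(4) by auto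
  obtain e where e: "e > 0" "(\<Union>x\<in>range u. cball x e) \<subseteq> U"
    using compact_subset_open_imp_cball_epsilon_subset[OF R(1) assms(1) R(2)] by blast
  have "compact {x + y | x y. x \<in> range u \<and> y \<in> cball 0 e}" by (rule compact_sums[OF R(1) compact_cball])
  moreover have "{x + y | x y. x \<in> range u \<and> y \<in> cball 0 e} = (\<Union>x\<in>range u. cball x e)"
  proof (intro equalityI subsetI)
    fix z assume "z \<in> (\<Union>x\<in>range u. cball x e)"
    then obtain x where "x \<in> range u" "dist x z \<le> e" by auto
    then show "z \<in> {x + y | x y. x \<in> range u \<and> y \<in> cball 0 e}"
      by (intro CollectI exI[of _ x] exI[of _ "z - x"]) (auto simp: dist_norm norm_minus_commute)
  next
    fix z assume "z \<in> {x + y | x y. x \<in> range u \<and> y \<in> cball 0 e}"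
    then obtain x y where "x \<in> range u" "y \<in> cball 0 e" "z = x + y" by blast
    then have "z \<in> cball x e" by (simp add: dist_norm)
    with \<open>x \<in> range u\<close> show "z \<in> (\<Union>x\<in>range u. cball x e)" by blast
  qed
  ultimately have "compact (\<Union>x\<in>range u. cball x e)" by simp
  moreover have "(\<Union>x\<in>range u. ball x e) \<subseteq> (\<Union>x\<in>range u. cball x e)" using ball_subset_cball by blast
  moreover have "u s \<in> (\<Union>x\<in>range u. ball x e)" for s using e(1) by (auto intro!: exI[of _ s])
  moreover have "open (\<Union>x\<in>range u. ball x e)" by blast
  ultimately show thesis using that[of "\<Union>x\<in>range u. cball x e" "\<Union>x\<in>range u. ball x e"] e(2) by blast
qed

section \<open>Realizing a perturbation of the observable\<close>

lemma bump_deriv_bound: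
  assumes "snd q > 0" "N \<ge> 2"
  shows "\<bar>bump_deriv N q x v\<bar> \<le> 2 * real N * ((snd q)\<^sup>2) ^ (N - 1) * snd q * norm v"
proof (cases "dist x (fst q) \<ge> snd q")
  case True
  then show ?thesis using bump_outside(2)[OF True assms] assms by simp
next
  case False
  let ?m = "max 0 ((snd q)\<^sup>2 - (x - fst q) \<bullet> (x - fst q))"
  have m: "0 \<le> ?m" "?m \<le> (snd q)\<^sup>2" by auto
  have "\<bar>(x - fst q) \<bullet> v\<bar> \<le> norm (x - fst q) * norm v" by (rule Cauchy_Schwarz_ineq2)
  also have "\<dots> \<le> snd q * norm v" using False by (intro mult_right_mono) (auto simp: dist_norm)
  finally have 1: "\<bar>(x - fst q) \<bullet> v\<bar> \<le> snd q * norm v" .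
  have "\<bar>bump_deriv N q x v\<bar> = real N * ?m ^ (N - 1) * (2 * \<bar>(x - fst q) \<bullet> v\<bar>)"
    by (simp add: bump_deriv_def abs_mult)
  also have "\<dots> \<le> real N * ((snd q)\<^sup>2) ^ (N - 1) * (2 * (snd q * norm v))"
    using 1 m by (intro mult_mono mult_left_mono power_mono) auto
  finally show ?thesis by (simp add: ac_simps)
qed

lemma bump_bound: "0 \<le> bump N q x" "bump N q x \<le> ((snd q)\<^sup>2) ^ N"
  unfolding bump_def by (auto intro!: power_mono)

lemma continuous_on_harmonic_function:
  fixes \<gamma> :: "real \<Rightarrow> real"
  assumes "C \<subseteq> harmonic_set" "\<gamma> 0 = 0" "\<And>c. c \<in> C \<Longrightarrow> \<bar>\<gamma> c\<bar> \<le> c"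
  shows "continuous_on C \<gamma>"
proof -
  have "continuous_on (C \<times> (UNIV :: real set)) (\<lambda>z. \<gamma> (fst z))"
  proof (rule continuous_on_harmonic_family[where h="\<lambda>c _. \<gamma> c", OF assms(1)])
    fix e :: real assume "e > 0"
    then show "\<exists>d>0. \<forall>c\<in>C. \<forall>y\<in>UNIV. c \<noteq> 0 \<longrightarrow> c < d \<longrightarrow> dist y x < d \<longrightarrow> dist (\<gamma> c) (\<gamma> 0) < e" for x :: real
      using assms(2,3) by (intro exI[of _ e]) (force simp: dist_real_def)
  qed simp
  then have "continuous_on C (\<lambda>c. (\<lambda>z. \<gamma> (fst z)) (c, 0::real))"
    by (rule continuous_on_compose2) (auto intro!: continuous_intros)
  then show ?thesis by simp
qed

text \<open>The map x + b(x) ev differs from the identity by a map with Lipschitz constant 1/2,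
  hence it is a bijection of the whole space with a 2-Lipschitz inverse. Smoothness of the inverse
  follows from the formula for its derivative.\<close>

lemma perturbation_inverse:
  fixes b :: "real \<Rightarrow> 'a::euclidean_space \<Rightarrow> real" and ev :: 'a
  assumes C: "C \<subseteq> harmonic_set"
    and b: "Ck_family (Suc k) C UNIV b"
    and db: "\<And>c x. c \<in> C \<Longrightarrow> (b c has_derivative Db c x) (at x)"
    and small: "\<And>c x v. c \<in> C \<Longrightarrow> \<bar>Db c x v\<bar> * norm ev \<le> 1/2 * norm v"
    and b0: "\<And>x. b 0 x = 0" and M: "\<And>c x. c \<in> C \<Longrightarrow> \<bar>b c x\<bar> \<le> c * M"
  obtains \<psi> where "\<And>c x. c \<in> C \<Longrightarrow> \<psi> c (x + b c x *\<^sub>R ev) = x"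
    "\<And>c z. c \<in> C \<Longrightarrow> \<psi> c z + b c (\<psi> c z) *\<^sub>R ev = z" "Ck_family k C UNIV \<psi>"
proof -
  define \<phi> where "\<phi> c x = x + b c x *\<^sub>R ev" for c x
  have lip: "norm (b c x *\<^sub>R ev - b c y *\<^sub>R ev) \<le> 1/2 * norm (x - y)" if c: "c \<in> C" for c x y
  proof (rule differentiable_bound[OF convex_UNIV])
    show "((\<lambda>x. b c x *\<^sub>R ev) has_derivative (\<lambda>v. Db c x v *\<^sub>R ev)) (at x within UNIV)" for x
      using db[OF c, of x] by (auto intro!: derivative_eq_intros)
    show "onorm (\<lambda>v. Db c x v *\<^sub>R ev) \<le> 1/2" for x
      by (rule onorm_le) (use small[OF c] in simp)
  qed auto
  have ex: "\<exists>x. \<phi> c x = z" if c: "c \<in> C" for c z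
  proof -
    have "\<exists>!x. z - b c x *\<^sub>R ev = x"
    proof (rule banach_fix_type[where c="1/2"])
      show "\<forall>x y. dist (z - b c x *\<^sub>R ev) (z - b c y *\<^sub>R ev) \<le> 1/2 * dist x y"
        using lip[OF c] by (simp add: dist_norm norm_minus_commute)
    qed auto
    then obtain x where "z - b c x *\<^sub>R ev = x" by blast
    then have "\<phi> c x = z" by (simp add: \<phi>_def algebra_simps)
    then show ?thesis by blast
  qed
  have bil: "norm (x - y) \<le> 2 * norm (\<phi> c x - \<phi> c y)" if c: "c \<in> C" for c x y
  proof -
    have "x - y = (\<phi> c x - \<phi> c y) - (b c x *\<^sub>R ev - b c y *\<^sub>R ev)" by (simp add: \<phi>_def)
    then have "norm (x - y) \<le> norm (\<phi> c x - \<phi> c y) + norm (b c x *\<^sub>R ev - b c y *\<^sub>R ev)"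
      by (metis norm_triangle_ineq4)
    then show ?thesis using lip[OF c, of x y] by simp
  qed
  define \<psi> where "\<psi> c z = (SOME x. \<phi> c x = z)" for c z
  have \<phi>\<psi>: "\<phi> c (\<psi> c z) = z" if "c \<in> C" for c z
    unfolding \<psi>_def using ex[OF that] by (rule someI_ex)
  have \<psi>\<phi>: "\<psi> c (\<phi> c x) = x" if "c \<in> C" for c x
    using bil[OF that, of "\<psi> c (\<phi> c x)" x] \<phi>\<psi>[OF that] by simp
  have \<psi>lip: "norm (\<psi> c z - \<psi> c w) \<le> 2 * norm (z - w)" if "c \<in> C" for c z w
    using bil[OF that, of "\<psi> c z" "\<psi> c w"] \<phi>\<psi>[OF that] by simp
  have \<psi>cont: "continuous_on UNIV (\<psi> c)" if "c \<in> C" for c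
    unfolding continuous_on_iff
  proof (intro ballI allI impI)
    fix x and e :: real assume "e > 0"
    have "dist (\<psi> c x') (\<psi> c x) < e" if "dist x' x < e / 2" for x'
      using \<psi>lip[OF \<open>c \<in> C\<close>, of x' x] that by (simp add: dist_norm)
    then show "\<exists>d>0. \<forall>x'\<in>UNIV. dist x' x < d \<longrightarrow> dist (\<psi> c x') (\<psi> c x) < e"
      using \<open>e > 0\<close> by (intro exI[of _ "e / 2"]) simp
  qed
  have near: "norm (\<psi> c z - z) \<le> c * (M * norm ev)" if "c \<in> C" for c z
  proof -
    have "z - \<psi> c z = b c (\<psi> c z) *\<^sub>R ev" using \<phi>\<psi>[OF that, of z] by (simp add: \<phi>_def algebra_simps)
    then have "norm (\<psi> c z - z) = \<bar>b c (\<psi> c z)\<bar> * norm ev" by (metis norm_minus_commute norm_scaleR)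
    also have "\<dots> \<le> c * M * norm ev" using M[OF that] by (intro mult_right_mono) auto
    finally show ?thesis by (simp add: ac_simps)
  qed
  have c\<psi>: "continuous_on (C \<times> UNIV) (\<lambda>z. \<psi> (fst z) (snd z))"
  proof (rule continuous_on_harmonic_family[OF C \<psi>cont])
    fix x :: 'a and e :: real assume "e > 0"
    define m where "m = \<bar>M * norm ev\<bar> + 1"
    have m: "m > 0" "M * norm ev \<le> m" by (auto simp: m_def)
    define d where "d = min (e / 2) (e / (2 * m))"
    have d: "d > 0" "d \<le> e / 2" "d * m \<le> e / 2"
    proof -
      show "d > 0" "d \<le> e / 2" using m \<open>e > 0\<close> by (auto simp: d_def)
      have "d * m \<le> e / (2 * m) * m" using m by (intro mult_right_mono) (auto simp: d_def)
      then show "d * m \<le> e / 2" using m by simp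
    qed
    have \<psi>0: "\<psi> 0 x = x"
      unfolding \<psi>_def \<phi>_def by (simp add: b0)
    have "dist (\<psi> c y) (\<psi> 0 x) < e" if "c \<in> C" "c < d" "dist y x < d" for c y
    proof -
      have c0: "0 \<le> c" using that C harmonic_set_nonneg by blast
      have "dist (\<psi> c y) y \<le> c * (M * norm ev)" using near[OF that(1)] by (simp add: dist_norm)
      also have "\<dots> \<le> c * m" using m c0 by (intro mult_left_mono) auto
      also have "\<dots> \<le> d * m" using that m by (intro mult_right_mono) auto
      finally have "dist (\<psi> c y) y \<le> e / 2" using d by simp
      then show ?thesis using dist_triangle[of "\<psi> c y" x y] that d by (simp add: \<psi>0)
    qed
    with d(1) show "\<exists>d>0. \<forall>c\<in>C. \<forall>y\<in>UNIV. c \<noteq> 0 \<longrightarrow> c < d \<longrightarrow> dist y x < d \<longrightarrow> dist (\<psi> c y) (\<psi> 0 x) < e" by blast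
  qed
  have lin: "linear (Db c x)" if "c \<in> C" for c x using db[OF that] by (rule has_derivative_linear)
  have denom: "1 + Db c x ev \<noteq> 0" if "c \<in> C" for c x
  proof
    assume "1 + Db c x ev = 0"
    then have "\<bar>Db c x ev\<bar> = 1" by (simp add: eq_neg_iff_add_eq_0[symmetric] add.commute)
    then have "norm ev \<le> 1/2 * norm ev" using small[OF that, of x ev] by simp
    then have "ev = 0" by simp
    then have "Db c x ev = 0" using lin[OF that] by (simp add: linear_0)
    with \<open>\<bar>Db c x ev\<bar> = 1\<close> show False by simp
  qed
  \<comment> \<open>The Sherman-Morrison formula for the inverse of a rank-one perturbation of the
    identity.\<close>
  define A where "A c x w = w - (Db c x w / (1 + Db c x ev)) *\<^sub>R ev" for c x w
  have d\<psi>: "(\<psi> c has_derivative A c (\<psi> c z)) (at z)" if c: "c \<in> C" for c z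
  proof (rule has_derivative_inverse_basic[where f="\<phi> c" and T=UNIV])
    let ?x = "\<psi> c z"
    show "(\<phi> c has_derivative (\<lambda>v. v + Db c ?x v *\<^sub>R ev)) (at ?x)"
      unfolding \<phi>_def using db[OF c] by (auto intro!: derivative_eq_intros)
    have "bounded_linear (Db c ?x)" using db[OF c] by (rule has_derivative_bounded_linear)
    then have "bounded_linear (\<lambda>w. w - (Db c ?x w * inverse (1 + Db c ?x ev)) *\<^sub>R ev)"
      by (intro bounded_linear_sub bounded_linear_ident bounded_linear_scaleR_const bounded_linear_mult_const)
    then show "bounded_linear (A c ?x)" by (simp add: A_def[abs_def] divide_inverse)
    show "A c ?x \<circ> (\<lambda>v. v + Db c ?x v *\<^sub>R ev) = id"
    proof
      fix v
      have "Db c ?x (v + Db c ?x v *\<^sub>R ev) = Db c ?x v * (1 + Db c ?x ev)"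
        by (simp add: linear_add[OF lin[OF c]] linear_scale[OF lin[OF c]] algebra_simps)
      then show "(A c ?x \<circ> (\<lambda>v. v + Db c ?x v *\<^sub>R ev)) v = id v"
        using denom[OF c, of ?x] by (simp add: A_def)
    qed
    show "continuous (at z) (\<psi> c)" using \<psi>cont[OF c] by (simp add: continuous_on_eq_continuous_at)
  qed (use \<phi>\<psi>[OF c] in auto)
  have Dfam: "Ck_family k C UNIV (\<lambda>c x. Db c x i)" for i
  proof -
    have *: "Ck_family k C UNIV (\<lambda>c x. Db c x i)" if "i \<in> Basis" for i
    proof (rule Ck_family_cong[OF open_UNIV])
      show "Ck_family k C UNIV (\<lambda>c x. frechet_derivative (b c) (at x) i)" using b that by simp
      show "frechet_derivative (b c) (at x) i = Db c x i" if "c \<in> C" for c x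
        using frechet_derivative_at[OF db[OF that]] by simp
    qed
    have "Ck_family k C UNIV (\<lambda>c x. \<Sum>j\<in>Basis. (i \<bullet> j) *\<^sub>R Db c x j)"
      by (intro Ck_family_sum Ck_family_linear[OF open_UNIV bounded_linear_scaleR_right] * open_UNIV)
    then show ?thesis
      by (rule Ck_family_cong[OF open_UNIV, rotated]) (use linear_basis_expansion[OF lin, of _ _ i] in auto)
  qed
  have Afam: "Ck_family k C UNIV (\<lambda>c x. A c x i)" for i
  proof -
    have "Ck_family k C UNIV (\<lambda>c x. i - (Db c x i * inverse (1 + Db c x ev)) *\<^sub>R ev)"
      by (intro Ck_family_diff Ck_family_const Ck_family_scaleR Ck_family_mult Ck_family_inverse Ck_family_add Dfam open_UNIV)
        (use denom in auto)
    then show ?thesis by (simp add: A_def divide_inverse)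
  qed
  \<comment> \<open>The derivative of the inverse is \<open>A\<close> evaluated at the inverse
    itself, so each order of smoothness yields the next.\<close>
  have "Ck_family m C UNIV \<psi>" if "m \<le> k" for m
    using that
  proof (induction m)
    case 0 then show ?case using c\<psi> by simp
  next
    case (Suc m)
    show ?case
    proof (rule Ck_family_SucI[OF open_UNIV c\<psi> d\<psi>])
      show "Ck_family m C UNIV (\<lambda>c z. A c (\<psi> c z) i)" for i
        by (rule Ck_family_compose[where V=UNIV and h="\<lambda>c x. A c x i"])
          (use Suc Ck_family_mono[OF Afam] in auto)
    qed
  qed
  from that[of \<psi>, OF _ _ this[OF order_refl]] \<psi>\<phi> \<phi>\<psi> show thesis by (simp add: \<phi>_def)
qed

text \<open>The field \<open>g\<close> is conjugated by \<open>\<phi> x = x + b x \<cdot> a / (a \<bullet> a)\<close>, so that \<open>a \<bullet> \<phi> x = a \<bullet> x + b x\<close>.\<close>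

lemma realize_perturbation:
  fixes g :: "real^'n \<Rightarrow> real^'n" and a :: "real^'n"
  assumes "open U" "k \<ge> 1" and g: "g \<in> Ck_fields k U" and hyp: "hyperbolic_periodic_solution U g T p"
    and "a \<noteq> 0" and B: "finite B" "\<And>q. q \<in> B \<Longrightarrow> admissible_bump U q" and N: "N > Suc k"
    and V: "openin (Ck_topology k U) V" "g \<in> V" and "e > 0"
  shows "\<exists>\<epsilon>>0. \<forall>c. (\<forall>q. \<bar>c q\<bar> < \<epsilon>) \<longrightarrow> (\<exists>h\<in>V. \<exists>p'. hyperbolic_periodic_solution U h T p' \<and>
     periodic_orbit_dist (Suc k) p T p' T < e \<and> (\<forall>t. a \<bullet> p' t = a \<bullet> p t + (\<Sum>q\<in>B. c q * bump N q (p t))))"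
proof (rule ccontr)
  \<comment> \<open>By contradiction: bad coefficient vectors of size below every \<epsilon> are
    arranged into a family over the harmonic parameters, and the convergence results show that a
    small member is not bad.\<close>
  define bad where "bad c \<longleftrightarrow> \<not> (\<exists>h\<in>V. \<exists>p'. hyperbolic_periodic_solution U h T p' \<and>
     periodic_orbit_dist (Suc k) p T p' T < e \<and> (\<forall>t. a \<bullet> p' t = a \<bullet> p t + (\<Sum>q\<in>B. c q * bump N q (p t))))" for c
  assume "\<not> ?thesis"
  then have "\<exists>c. \<epsilon> > 0 \<longrightarrow> (\<forall>q. \<bar>c q\<bar> < \<epsilon>) \<and> bad c" for \<epsilon> unfolding bad_def by blast
  then obtain cc where cc: "\<And>\<epsilon> q. \<epsilon> > 0 \<Longrightarrow> \<bar>cc \<epsilon> q\<bar> < \<epsilon>" "\<And>\<epsilon>. \<epsilon> > 0 \<Longrightarrow> bad (cc \<epsilon>)" by metis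
  \<comment> \<open>The choice \<open>cc\<close> carries no information at 0; the limit member has
    to be the unperturbed field.\<close>
  define \<gamma> where "\<gamma> \<epsilon> q = (if \<epsilon> = 0 then 0 else cc \<epsilon> q)" for \<epsilon> q
  have \<gamma>: "\<bar>\<gamma> \<epsilon> q\<bar> \<le> \<epsilon>" if "\<epsilon> \<in> harmonic_set" for \<epsilon> q
    using cc(1)[of \<epsilon> q] harmonic_set_nonneg[OF that] by (auto simp: \<gamma>_def intro: less_imp_le)
  have ps: "T > 0" "\<And>t. p t \<in> U" "\<And>t. (p has_vector_derivative g (p t)) (at t)" "\<And>t. p (t + T) = p t"
    using hyp by (auto simp: hyperbolic_periodic_solution_def periodic_solution_def)
  have N2: "N \<ge> 2" using N by simp
  define ev where "ev = a /\<^sub>R (a \<bullet> a)"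
  have ev: "a \<bullet> ev = 1" using \<open>a \<noteq> 0\<close> by (simp add: ev_def)
  define M1 where "M1 = (\<Sum>q\<in>B. 2 * real N * ((snd q)\<^sup>2) ^ (N - 1) * snd q)"
  define M0 where "M0 = (\<Sum>q\<in>B. ((snd q)\<^sup>2) ^ N)"
  have M1: "M1 \<ge> 0" unfolding M1_def using B(2) by (auto intro!: sum_nonneg mult_nonneg_nonneg simp: admissible_bump_def less_imp_le)
  \<comment> \<open>Coefficients below this size give the perturbation Lipschitz constant at most
    1/2, as required for the inverse.\<close>
  define \<epsilon>1 where "\<epsilon>1 = 1 / (2 * (M1 + 1) * (norm ev + 1))"
  have nev: "norm ev \<ge> 0" by simp
  have \<epsilon>1: "\<epsilon>1 > 0" using M1 nev by (simp add: \<epsilon>1_def add_nonneg_pos)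
  have \<epsilon>1': "\<epsilon>1 * M1 * norm ev \<le> 1/2"
  proof -
    have "M1 * norm ev \<le> (M1 + 1) * (norm ev + 1)" using M1 nev by (intro mult_mono) auto
    then have "\<epsilon>1 * (M1 * norm ev) \<le> \<epsilon>1 * ((M1 + 1) * (norm ev + 1))" using \<epsilon>1 by (intro mult_left_mono) auto
    also have "\<dots> = 1/2"
    proof -
      have "M1 + 1 \<noteq> 0" "norm ev + 1 \<noteq> 0" using M1 nev by linarith+
      then show ?thesis by (simp add: \<epsilon>1_def)
    qed
    finally show ?thesis by (simp add: ac_simps)
  qed
  define C where "C = {\<epsilon> \<in> harmonic_set. \<epsilon> < \<epsilon>1}"
  have C: "C \<subseteq> harmonic_set" "0 \<in> C" using \<epsilon>1 by (auto simp: C_def)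
  define b where "b \<epsilon> x = (\<Sum>q\<in>B. \<gamma> \<epsilon> q * bump N q x)" for \<epsilon> x
  define Db where "Db \<epsilon> x v = (\<Sum>q\<in>B. \<gamma> \<epsilon> q * bump_deriv N q x v)" for \<epsilon> x v
  have bfam: "Ck_family (Suc k) C UNIV b"
    unfolding b_def
  proof (intro Ck_family_sum Ck_family_mult open_UNIV)
    fix q
    have "continuous_on C (\<lambda>\<epsilon>. \<gamma> \<epsilon> q)"
    proof (rule continuous_on_harmonic_function[OF C(1)])
      show "\<bar>\<gamma> c q\<bar> \<le> c" if "c \<in> C" for c by (rule \<gamma>) (use that C in blast)
    qed (simp add: \<gamma>_def)
    then show "Ck_family (Suc k) C UNIV (\<lambda>\<epsilon> x. \<gamma> \<epsilon> q)" by (rule Ck_family_param[OF open_UNIV])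
    show "Ck_family (Suc k) C UNIV (\<lambda>\<epsilon> x. bump N q x)" by (rule Ck_family_bump[OF N])
  qed
  have db: "(b \<epsilon> has_derivative Db \<epsilon> x) (at x)" for \<epsilon> x
    unfolding b_def[abs_def] Db_def[abs_def]
    by (intro has_derivative_sum has_derivative_mult_right bump_has_derivative[OF N2])
  have Dbs: "\<bar>Db \<epsilon> x v\<bar> * norm ev \<le> 1/2 * norm v" if \<epsilon>: "\<epsilon> \<in> C" for \<epsilon> x v
  proof -
    have \<epsilon>0: "0 \<le> \<epsilon>" "\<epsilon> \<in> harmonic_set" "\<epsilon> \<le> \<epsilon>1" using \<epsilon> harmonic_set_nonneg by (auto simp: C_def)
    have "\<bar>Db \<epsilon> x v\<bar> \<le> (\<Sum>q\<in>B. \<bar>\<gamma> \<epsilon> q\<bar> * \<bar>bump_deriv N q x v\<bar>)"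
      unfolding Db_def by (rule order_trans[OF sum_abs]) (simp add: abs_mult)
    also have "\<dots> \<le> (\<Sum>q\<in>B. \<epsilon> * (2 * real N * ((snd q)\<^sup>2) ^ (N - 1) * snd q * norm v))"
      using B(2) N2 \<epsilon>0 by (intro sum_mono mult_mono \<gamma> bump_deriv_bound) (auto simp: admissible_bump_def)
    also have "\<dots> = \<epsilon> * M1 * norm v" by (simp add: M1_def sum_distrib_left sum_distrib_right ac_simps)
    also have "\<dots> \<le> \<epsilon>1 * M1 * norm v" using \<epsilon>0 M1 by (intro mult_right_mono) auto
    finally have "\<bar>Db \<epsilon> x v\<bar> * norm ev \<le> \<epsilon>1 * M1 * norm v * norm ev" by (rule mult_right_mono) simp
    also have "\<dots> = (\<epsilon>1 * M1 * norm ev) * norm v" by simp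
    also have "\<dots> \<le> 1/2 * norm v" using \<epsilon>1' by (rule mult_right_mono) simp
    finally show ?thesis .
  qed
  have b0: "b 0 x = 0" for x by (simp add: b_def \<gamma>_def)
  have bM: "\<bar>b \<epsilon> x\<bar> \<le> \<epsilon> * M0" if \<epsilon>: "\<epsilon> \<in> C" for \<epsilon> x
  proof -
    have "\<bar>b \<epsilon> x\<bar> \<le> (\<Sum>q\<in>B. \<bar>\<gamma> \<epsilon> q\<bar> * \<bar>bump N q x\<bar>)"
      unfolding b_def by (rule order_trans[OF sum_abs]) (simp add: abs_mult)
    also have "\<dots> \<le> (\<Sum>q\<in>B. \<epsilon> * ((snd q)\<^sup>2) ^ N)"
    proof (rule sum_mono)
      fix q
      have "\<epsilon> \<in> harmonic_set" using \<epsilon> C(1) by blast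
      moreover have "\<bar>bump N q x\<bar> \<le> ((snd q)\<^sup>2) ^ N"
        using bump_bound(1)[of N q x] bump_bound(2)[of N q x] by linarith
      ultimately show "\<bar>\<gamma> \<epsilon> q\<bar> * \<bar>bump N q x\<bar> \<le> \<epsilon> * ((snd q)\<^sup>2) ^ N"
        by (intro mult_mono \<gamma>) (auto intro: harmonic_set_nonneg)
    qed
    finally show ?thesis by (simp add: M0_def sum_distrib_left)
  qed
  obtain \<psi> where \<psi>: "\<And>c x. c \<in> C \<Longrightarrow> \<psi> c (x + b c x *\<^sub>R ev) = x"
    "\<And>c z. c \<in> C \<Longrightarrow> \<psi> c z + b c (\<psi> c z) *\<^sub>R ev = z" "Ck_family k C UNIV \<psi>"
    by (rule perturbation_inverse[OF C(1) bfam db Dbs b0 bM]) (assumption, assumption, (rule that; assumption))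
  define \<phi> where "\<phi> \<epsilon> x = x + b \<epsilon> x *\<^sub>R ev" for \<epsilon> x
  have bU: "b \<epsilon> x = 0" if "x \<notin> U" for \<epsilon> x
  proof -
    have "bump N q x = 0" if "q \<in> B" for q
    proof (rule bump_outside(1)[OF _ _ N2])
      have "x \<notin> cball (fst q) (snd q)" using B(2)[OF that] \<open>x \<notin> U\<close> by (auto simp: admissible_bump_def)
      then show "snd q \<le> dist x (fst q)" by (simp add: dist_commute)
    qed (use B(2)[OF that] in \<open>simp add: admissible_bump_def\<close>)
    then show ?thesis by (simp add: b_def)
  qed
  \<comment> \<open>The conjugacy is the identity off \<open>U\<close> and injective, so it cannot
    move a point of \<open>U\<close> out of \<open>U\<close>.\<close>
  have \<phi>U: "\<phi> \<epsilon> x \<in> U" if "x \<in> U" "\<epsilon> \<in> C" for \<epsilon> x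
  proof (rule ccontr)
    assume n: "\<phi> \<epsilon> x \<notin> U"
    then have "\<phi> \<epsilon> (\<phi> \<epsilon> x) = \<phi> \<epsilon> x" using bU[of "\<phi> \<epsilon> x"] by (simp add: \<phi>_def[of \<epsilon> "\<phi> \<epsilon> x"])
    then have "\<phi> \<epsilon> x = x" using \<psi>(1)[OF that(2)] unfolding \<phi>_def by metis
    with n that show False by simp
  qed
  have \<psi>U: "\<psi> \<epsilon> z \<in> U" if "z \<in> U" "\<epsilon> \<in> C" for \<epsilon> z
    using \<psi>(2)[OF that(2), of z] bU[of "\<psi> \<epsilon> z" \<epsilon>] that by fastforce
  have gC: "Ck_family k C U (\<lambda>_. g)" using g by (intro Ck_family_constant) (simp add: Ck_fields_def)
  \<comment> \<open>The derivative of the conjugacy applied to \<open>g\<close>; composed with the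
    inverse it becomes the conjugated field. The expansion in the basis matches the form in which
    \<open>Ck_family\<close> controls \<open>Db\<close>.\<close>
  define H where "H \<epsilon> x = g x + (\<Sum>i\<in>Basis. (g x \<bullet> i) *\<^sub>R Db \<epsilon> x i) *\<^sub>R ev" for \<epsilon> x
  have Db_exp: "(\<Sum>i\<in>Basis. (v \<bullet> i) *\<^sub>R Db \<epsilon> x i) = Db \<epsilon> x v" for \<epsilon> x v
    using linear_basis_expansion[OF has_derivative_linear[OF db]] by metis
  have DbC: "Ck_family k C U (\<lambda>\<epsilon> x. Db \<epsilon> x i)" if "i \<in> Basis" for i
  proof (rule Ck_family_cong[OF \<open>open U\<close>])
    show "Ck_family k C U (\<lambda>c x. frechet_derivative (b c) (at x) i)"
      by (rule Ck_family_subset[of k C UNIV]) (use bfam that in auto)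
    show "frechet_derivative (b c) (at x) i = Db c x i" for c x
      using frechet_derivative_at[OF db] by metis
  qed
  have HC: "Ck_family k C U H"
    unfolding H_def
    by (intro Ck_family_add Ck_family_scaleR Ck_family_sum Ck_family_const Ck_family_inner gC DbC \<open>open U\<close>)
  define h where "h \<epsilon> z = (if z \<in> U then H \<epsilon> (\<psi> \<epsilon> z) else undefined)" for \<epsilon> z
  have hC: "Ck_family k C U h"
  proof (rule Ck_family_cong[OF \<open>open U\<close>])
    show "Ck_family k C U (\<lambda>\<epsilon> z. H \<epsilon> (\<psi> \<epsilon> z))"
      by (rule Ck_family_compose[OF \<open>open U\<close> \<open>open U\<close> _ HC]) (use \<psi>U Ck_family_subset[OF \<psi>(3)] in auto)
  qed (simp add: h_def)
  have hf: "h \<epsilon> \<in> Ck_fields k U" if "\<epsilon> \<in> C" for \<epsilon>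
    using Ck_family_imp_Ck_on[OF hC that] by (auto simp: Ck_fields_def h_def extensional_def)
  have h0: "h 0 = g"
  proof
    fix z
    have "\<psi> 0 z = z" using \<psi>(2)[OF C(2), of z] by (simp add: b0)
    moreover have "Db 0 x v = 0" for x v by (simp add: Db_def \<gamma>_def)
    ultimately show "h 0 z = g z" using g by (auto simp: h_def H_def Ck_fields_def extensional_def)
  qed
  have h\<phi>: "h \<epsilon> (\<phi> \<epsilon> x) = g x + Db \<epsilon> x (g x) *\<^sub>R ev" if "\<epsilon> \<in> C" "x \<in> U" for \<epsilon> x
    using \<phi>U[OF that(2,1)] \<psi>(1)[OF that(1), of x] by (simp add: h_def H_def Db_exp[unfolded real_scaleR_def] \<phi>_def)
  \<comment> \<open>The image of the orbit is an exact periodic orbit of the conjugated field with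
    the same period, so the persistence argument is not invoked here.\<close>
  define u where "u \<epsilon> s = \<phi> \<epsilon> (p (s * T))" for \<epsilon> s
  have du: "(u \<epsilon> has_vector_derivative T *\<^sub>R h \<epsilon> (u \<epsilon> s)) (at s)" if \<epsilon>: "\<epsilon> \<in> C" for \<epsilon> s
  proof -
    have "(\<phi> \<epsilon> has_derivative (\<lambda>v. v + Db \<epsilon> x v *\<^sub>R ev)) (at x)" for x
      unfolding \<phi>_def[abs_def] using db by (auto intro!: derivative_eq_intros)
    then have "((\<phi> \<epsilon> \<circ> p) has_vector_derivative g (p t) + Db \<epsilon> (p t) (g (p t)) *\<^sub>R ev) (at t)" for t
      using vector_derivative_diff_chain_within[OF ps(3), of "\<phi> \<epsilon>"] by (auto intro: has_derivative_at_withinI)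
    then have "((\<lambda>t. \<phi> \<epsilon> (p t)) has_vector_derivative h \<epsilon> (\<phi> \<epsilon> (p t))) (at t)" for t
      by (simp add: h\<phi>[OF \<epsilon> ps(2)] o_def)
    from has_vector_derivative_rescale[OF this, of T s] show ?thesis by (simp add: u_def[abs_def])
  qed
  have cu: "continuous_on (C \<times> UNIV) (\<lambda>z. u (fst z) (snd z))"
  proof -
    have cp: "continuous_on UNIV p"
      by (rule has_vector_derivative_imp_continuous_on[OF ps(3)])
    have cps: "continuous_on (C \<times> UNIV) (\<lambda>z. p (snd z * T))"
      by (rule continuous_on_compose2[OF cp]) (auto intro!: continuous_intros)
    have "continuous_on (C \<times> UNIV) (\<lambda>z. (\<lambda>w. b (fst w) (snd w)) (fst z, p (snd z * T)))"
      by (rule continuous_on_compose2[OF Ck_family_continuous[OF bfam]]) (auto intro!: continuous_intros cps)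
    then show ?thesis unfolding u_def \<phi>_def by (intro continuous_intros cps) simp
  qed
  have u0: "(\<lambda>t. u 0 (t / T)) = p" using ps(1) by (simp add: u_def \<phi>_def b0)
  have ev1: "\<forall>\<^sub>F \<epsilon> in nhds 0. \<epsilon> \<in> C \<longrightarrow> hyperbolic_periodic_solution U (h \<epsilon>) T (\<lambda>t. u \<epsilon> (t / T)) \<and>
     periodic_orbit_dist (Suc k) (\<lambda>t. u 0 (t / T)) T (\<lambda>t. u \<epsilon> (t / T)) T < e"
  proof (rule solution_family_converges[OF \<open>open U\<close> order_refl hC \<open>k \<ge> 1\<close> C(2) _ _ cu _ _ du _ \<open>e > 0\<close>])
    show "u \<epsilon> s \<in> U" if "\<epsilon> \<in> C" for \<epsilon> s using \<phi>U[OF ps(2) that] by (simp add: u_def)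
    show "u \<epsilon> (s + 1) = u \<epsilon> s" for \<epsilon> s using ps(4)[of "s * T"] by (simp add: u_def distrib_right)
    show "hyperbolic_periodic_solution U (h 0) T (\<lambda>t. u 0 (t / T))" unfolding h0 u0 by (rule hyp)
  qed (use ps(1) in auto)
  have ev2: "\<forall>\<^sub>F \<epsilon> in nhds 0. \<epsilon> \<in> C \<longrightarrow> h \<epsilon> \<in> V"
    by (rule Ck_family_eventually_in_open[OF hC hf C(2) V(1)]) (use h0 V in auto)
  have ev3: "\<forall>\<^sub>F \<epsilon> in nhds (0::real). \<epsilon> < \<epsilon>1"
    using eventually_nhds_in_open[of "{..<\<epsilon>1}" 0] \<epsilon>1 by simp
  from ev1 ev2 ev3 have "\<forall>\<^sub>F \<epsilon> in nhds 0. \<epsilon> \<in> harmonic_set \<longrightarrow> \<epsilon> \<in> C \<and> h \<epsilon> \<in> V \<and>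
     hyperbolic_periodic_solution U (h \<epsilon>) T (\<lambda>t. u \<epsilon> (t / T)) \<and>
     periodic_orbit_dist (Suc k) p T (\<lambda>t. u \<epsilon> (t / T)) T < e"
    unfolding u0 by eventually_elim (auto simp: C_def)
  then obtain \<epsilon> where \<epsilon>: "\<epsilon> \<in> harmonic_set" "\<epsilon> \<noteq> 0" "\<epsilon> \<in> C" "h \<epsilon> \<in> V"
     "hyperbolic_periodic_solution U (h \<epsilon>) T (\<lambda>t. u \<epsilon> (t / T))"
     "periodic_orbit_dist (Suc k) p T (\<lambda>t. u \<epsilon> (t / T)) T < e"
    by (rule eventually_harmonic_set) blast
  have "\<epsilon> > 0" using harmonic_set_nonneg[OF \<epsilon>(1)] \<epsilon>(2) by simp
  have "a \<bullet> u \<epsilon> (t / T) = a \<bullet> p t + (\<Sum>q\<in>B. cc \<epsilon> q * bump N q (p t))" for t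
    using ps(1) \<epsilon>(2) by (simp add: u_def \<phi>_def inner_add_right ev b_def \<gamma>_def)
  then have "\<not> bad (cc \<epsilon>)" unfolding bad_def using \<epsilon>(4-6) by blast
  with cc(2)[OF \<open>\<epsilon> > 0\<close>] show False by blast
qed

section \<open>Delay embeddings\<close>

lemma delay_map_eq_vec:
  fixes p :: "real \<Rightarrow> 'a::real_inner" and \<theta> :: real
  assumes "T \<noteq> 0"
  shows "delay_map a p (\<theta> * T) (s * T) = (\<chi> i. a \<bullet> p ((s - (vector [0, \<theta>, 2 * \<theta>] :: real^3) $ i) * T))"
  by (simp add: delay_map_def vec_eq_iff forall_3 left_diff_distrib mult.assoc)

lemma circle_embedding_rescaled:
  fixes F :: "real \<Rightarrow> 'a::real_normed_vector"
  assumes T: "T > 0" and per: "\<And>s. F (s + 1) = F s" and inj: "inj_on F {0..<1}"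
    and d: "\<And>s. (F has_vector_derivative F' s) (at s)" "\<And>s. F' s \<noteq> 0"
  shows "circle_embedding T (\<lambda>t. F (t / T))"
  unfolding circle_embedding_iff[OF T]
proof (intro conjI allI)
  show "F ((t + T) / T) = F (t / T)" for t using T per[of "t / T"] by (simp add: add_divide_distrib)
  show "\<exists>D. D \<noteq> 0 \<and> ((\<lambda>t. F (t / T)) has_vector_derivative D) (at t)" for t
    using has_vector_derivative_rescale[of F F' "1 / T" t] d T by (intro exI[of _ "(1 / T) *\<^sub>R F' (t / T)"]) auto
  show "inj_on (\<lambda>t. F (t / T)) {0..<T}"
  proof (rule inj_onI)
    fix x y assume "x \<in> {0..<T}" "y \<in> {0..<T}" "F (x / T) = F (y / T)"
    then have "x / T = y / T" using T by (intro inj_onD[OF inj]) auto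
    then show "x = y" using T by simp
  qed
qed

lemma hyperbolic_curve:
  fixes g :: "real^'n \<Rightarrow> real^'n"
  assumes "open U" "k \<ge> 1" and g: "g \<in> Ck_fields k U" and hyp: "hyperbolic_periodic_solution U g T p"
  obtains u' u'' where "T > 0" "\<And>t. p t \<in> U" "\<And>s. p ((s + 1) * T) = p (s * T)" "\<And>s. u' (s + 1) = u' s"
    "inj_on (\<lambda>s. p (s * T)) {0..<1}" "\<And>s. u' s \<noteq> 0"
    "\<And>s. ((\<lambda>s. p (s * T)) has_vector_derivative u' s) (at s)"
    "\<And>s. (u' has_vector_derivative u'' s) (at s)"
proof -
  have ps: "T > 0" "\<And>t. p t \<in> U" using hyp by (auto simp: hyperbolic_periodic_solution_def periodic_solution_def)
  have gk: "Ck_on k U g" using g by (simp add: Ck_fields_def)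
  have "Ck_family k {0::real} U (\<lambda>_. g)" using gk by (simp add: Ck_on_iff_Ck_family[where c="0::real"])
  then have fam: "Ck_family (Suc 0) {0::real} U (\<lambda>_. g)" by (rule Ck_family_mono) (use \<open>k \<ge> 1\<close> in simp)
  then have g1: "Ck_on 1 U g" by (simp add: Ck_on_iff_Ck_family[where c="0::real"])
  define u where "u s = p (s * T)" for s
  have hyp': "hyperbolic_periodic_solution U g T (\<lambda>t. u (t / T))" using hyp ps(1) by (simp add: u_def)
  have uU: "u s \<in> U" for s by (simp add: u_def ps)
  obtain per: "\<And>s. u (s + 1) = u s" and du: "\<And>s. (u has_vector_derivative T *\<^sub>R g (u s)) (at s)"
    and inj: "inj_on u {0..<1}" and nz: "\<And>s. g (u s) \<noteq> 0"
    by (rule hyperbolic_scaled[OF \<open>open U\<close> g1 ps(1) uU hyp']) (rule that; assumption)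
  define u' where "u' s = T *\<^sub>R g (u s)" for s
  have du': "(u' has_vector_derivative T *\<^sub>R (jacobian g (at (u s)) *v (T *\<^sub>R g (u s)))) (at s)" for s
  proof -
    have "((g \<circ> u) has_vector_derivative jacobian g (at (u s)) *v (T *\<^sub>R g (u s))) (at s)"
      using vector_derivative_diff_chain_within[OF du, of g "\<lambda>v. jacobian g (at (u s)) *v v" s]
        has_derivative_jacobian[OF fam _ uU, of 0 s] by (simp add: has_derivative_at_withinI)
    then show ?thesis unfolding u'_def[abs_def] o_def
      by (rule bounded_linear.has_vector_derivative[OF bounded_linear_scaleR_right])
  qed
  have "u' (s + 1) = u' s" "u' s \<noteq> 0" for s using nz ps(1) by (simp_all add: u'_def per)
  moreover have "(u has_vector_derivative u' s) (at s)" for s using du by (simp add: u'_def)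
  ultimately show thesis
    by (rule that[OF ps per[unfolded u_def] _ inj[unfolded u_def[abs_def]] _ _ du', unfolded u_def[abs_def, symmetric]])
qed

text \<open>The velocity of the delay map with delay T/5, in rescaled time, never vanishes. It is
  stated through the scalar observable, which is all that the perturbation controls.\<close>

definition delay_immersed :: "real^'n \<Rightarrow> real \<Rightarrow> (real \<Rightarrow> real^'n) \<Rightarrow> bool" where
  "delay_immersed a T p \<longleftrightarrow> (\<exists>y'. (\<forall>t. ((\<lambda>s. a \<bullet> p (s * T)) has_real_derivative y' t) (at t)) \<and>
     (\<forall>t. (\<chi> i. y' (t - delay_shift i)) \<noteq> (0 :: real^3)))"

lemma observable_derivative:
  fixes u u' :: "real \<Rightarrow> 'a::real_inner"
  assumes "\<And>s. (u has_vector_derivative u' s) (at s)"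
  shows "((\<lambda>s. a \<bullet> u s) has_real_derivative a \<bullet> u' s) (at s)"
  unfolding has_real_derivative_iff_has_vector_derivative
  by (rule bounded_linear.has_vector_derivative[OF bounded_linear_inner_right assms])

lemma dense_delay_immersed:
  fixes g :: "real^'n \<Rightarrow> real^'n" and a :: "real^'n"
  assumes "open U" "k \<ge> 1" and g: "g \<in> Ck_fields k U" and hyp: "hyperbolic_periodic_solution U g T p"
    and "a \<noteq> 0" and V: "openin (Ck_topology k U) V" "g \<in> V" and "e > 0"
  obtains h p' where "h \<in> V" "hyperbolic_periodic_solution U h T p'"
    "periodic_orbit_dist (Suc k) p T p' T < e" "delay_immersed a T p'"
proof -
  obtain u' u'' where c: "T > 0" "\<And>t. p t \<in> U" "\<And>s. p ((s + 1) * T) = p (s * T)" "\<And>s. u' (s + 1) = u' s"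
    "inj_on (\<lambda>s. p (s * T)) {0..<1}" "\<And>s. u' s \<noteq> 0"
    "\<And>s. ((\<lambda>s. p (s * T)) has_vector_derivative u' s) (at s)"
    "\<And>s. (u' has_vector_derivative u'' s) (at s)"
    by (rule hyperbolic_curve[OF assms(1-4)]) (rule that; assumption)
  \<comment> \<open>The least exponent for which the bumps are of class \<open>C^(k+1)\<close>, so
    that the conjugated field is of class \<open>C^k\<close>.\<close>
  define N where "N = Suc (Suc k)"
  have N: "N \<ge> 3" "N \<ge> 2" "N > Suc k" using \<open>k \<ge> 1\<close> by (auto simp: N_def)
  have per: "a \<bullet> u' (s + 1) = a \<bullet> u' s" for s by (simp add: c)
  obtain B where B: "finite B" "\<And>q. q \<in> B \<Longrightarrow> admissible_bump U q"
    "\<And>\<epsilon>. \<epsilon> > 0 \<Longrightarrow> \<exists>c. (\<forall>q. \<bar>c q\<bar> < \<epsilon>) \<and>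
       (\<forall>t. (\<chi> i. a \<bullet> u' (t - delay_shift i) + (\<Sum>q\<in>B. c q * bump_deriv N q (p ((t - delay_shift i) * T)) (u' (t - delay_shift i)))) \<noteq> (0 :: real^3))"
    by (rule immersion_perturbation[where u="\<lambda>s. p (s * T)" and y'="\<lambda>s. a \<bullet> u' s",
          OF \<open>open U\<close> N(1) c(2) c(3) c(4) per c(5) c(6) c(7) c(8) observable_derivative[OF c(8)]])
       (rule that; assumption)
  obtain \<epsilon> where \<epsilon>: "\<epsilon> > 0" "\<And>c. (\<forall>q. \<bar>c q\<bar> < \<epsilon>) \<Longrightarrow> (\<exists>h\<in>V. \<exists>p'. hyperbolic_periodic_solution U h T p' \<and>
     periodic_orbit_dist (Suc k) p T p' T < e \<and> (\<forall>t. a \<bullet> p' t = a \<bullet> p t + (\<Sum>q\<in>B. c q * bump N q (p t))))"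
    using realize_perturbation[OF assms(1-5) B(1,2) N(3) V \<open>e > 0\<close>] by blast
  obtain d where d: "\<forall>q. \<bar>d q\<bar> < \<epsilon>"
    "\<And>t. (\<chi> i. a \<bullet> u' (t - delay_shift i) + (\<Sum>q\<in>B. d q * bump_deriv N q (p ((t - delay_shift i) * T)) (u' (t - delay_shift i)))) \<noteq> (0 :: real^3)"
    using B(3)[OF \<epsilon>(1)] by blast
  obtain h p' where h: "h \<in> V" "hyperbolic_periodic_solution U h T p'" "periodic_orbit_dist (Suc k) p T p' T < e"
    "\<And>t. a \<bullet> p' t = a \<bullet> p t + (\<Sum>q\<in>B. d q * bump N q (p t))"
    using \<epsilon>(2)[OF d(1)] by blast
  have "delay_immersed a T p'"
    unfolding delay_immersed_def
  proof (intro exI conjI allI)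
    show "((\<lambda>s. a \<bullet> p' (s * T)) has_real_derivative (a \<bullet> u' t + (\<Sum>q\<in>B. d q * bump_deriv N q (p (t * T)) (u' t)))) (at t)" for t
      unfolding h(4) by (intro DERIV_add DERIV_sum DERIV_cmult observable_derivative bump_along_curve[OF N(2)] c(7))
  qed (use d(2) in simp)
  with h that show thesis by blast
qed

lemma dense_delay_embedded:
  fixes g :: "real^'n \<Rightarrow> real^'n" and a :: "real^'n"
  assumes "open U" "k \<ge> 1" and g: "g \<in> Ck_fields k U" and hyp: "hyperbolic_periodic_solution U g T p"
    and "a \<noteq> 0" and V: "openin (Ck_topology k U) V" "g \<in> V" and "e > 0" and imm: "delay_immersed a T p"
  obtains h p' where "h \<in> V" "hyperbolic_periodic_solution U h T p'"
    "periodic_orbit_dist (Suc k) p T p' T < e" "circle_embedding T (delay_map a p' (1/5 * T))"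
proof -
  obtain u' u'' where c: "T > 0" "\<And>t. p t \<in> U" "\<And>s. p ((s + 1) * T) = p (s * T)" "\<And>s. u' (s + 1) = u' s"
    "inj_on (\<lambda>s. p (s * T)) {0..<1}" "\<And>s. u' s \<noteq> 0"
    "\<And>s. ((\<lambda>s. p (s * T)) has_vector_derivative u' s) (at s)"
    "\<And>s. (u' has_vector_derivative u'' s) (at s)"
    by (rule hyperbolic_curve[OF assms(1-4)]) (rule that; assumption)
  define N where "N = Suc (Suc k)"
  have N: "N \<ge> 3" "N \<ge> 2" "N > Suc k" using \<open>k \<ge> 1\<close> by (auto simp: N_def)
  have per: "a \<bullet> p ((s + 1) * T) = a \<bullet> p (s * T)" "a \<bullet> u' (s + 1) = a \<bullet> u' s" for s by (simp_all only: c)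
  have imm': "(\<chi> i. a \<bullet> u' (t - delay_shift i)) \<noteq> (0 :: real^3)" for t
  proof -
    obtain y' where y': "\<And>t. ((\<lambda>s. a \<bullet> p (s * T)) has_real_derivative y' t) (at t)"
      "\<And>t. (\<chi> i. y' (t - delay_shift i)) \<noteq> (0 :: real^3)"
      using imm unfolding delay_immersed_def by blast
    have "y' s = a \<bullet> u' s" for s by (rule DERIV_unique[OF y'(1) observable_derivative[OF c(7)]])
    with y'(2)[of t] show ?thesis by simp
  qed
  obtain B where B: "finite B" "\<And>q. q \<in> B \<Longrightarrow> admissible_bump U q"
    "\<And>\<epsilon>. \<epsilon> > 0 \<Longrightarrow> \<exists>c. (\<forall>q. \<bar>c q\<bar> < \<epsilon>) \<and>
       (\<forall>t. (\<chi> i. a \<bullet> u' (t - delay_shift i) + (\<Sum>q\<in>B. c q * bump_deriv N q (p ((t - delay_shift i) * T)) (u' (t - delay_shift i)))) \<noteq> (0 :: real^3)) \<and>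
       inj_on (\<lambda>t. (\<chi> i. a \<bullet> p ((t - delay_shift i) * T) + (\<Sum>q\<in>B. c q * bump N q (p ((t - delay_shift i) * T)))) :: real^3) {0..<1}"
    by (rule injectivity_perturbation[where u="\<lambda>s. p (s * T)" and y="\<lambda>s. a \<bullet> p (s * T)" and y'="\<lambda>s. a \<bullet> u' s",
          OF \<open>open U\<close> N(1) c(2) c(3) c(4) per c(5) c(7) c(8) observable_derivative[OF c(7)] observable_derivative[OF c(8)] imm'])
       (rule that; assumption)
  obtain \<epsilon> where \<epsilon>: "\<epsilon> > 0" "\<And>c. (\<forall>q. \<bar>c q\<bar> < \<epsilon>) \<Longrightarrow> (\<exists>h\<in>V. \<exists>p'. hyperbolic_periodic_solution U h T p' \<and>
     periodic_orbit_dist (Suc k) p T p' T < e \<and> (\<forall>t. a \<bullet> p' t = a \<bullet> p t + (\<Sum>q\<in>B. c q * bump N q (p t))))"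
    using realize_perturbation[OF assms(1-5) B(1,2) N(3) V \<open>e > 0\<close>] by blast
  obtain d where d: "\<forall>q. \<bar>d q\<bar> < \<epsilon>"
    "\<And>t. (\<chi> i. a \<bullet> u' (t - delay_shift i) + (\<Sum>q\<in>B. d q * bump_deriv N q (p ((t - delay_shift i) * T)) (u' (t - delay_shift i)))) \<noteq> (0 :: real^3)"
    "inj_on (\<lambda>t. (\<chi> i. a \<bullet> p ((t - delay_shift i) * T) + (\<Sum>q\<in>B. d q * bump N q (p ((t - delay_shift i) * T)))) :: real^3) {0..<1}"
    using B(3)[OF \<epsilon>(1)] by blast
  obtain h p' where h: "h \<in> V" "hyperbolic_periodic_solution U h T p'" "periodic_orbit_dist (Suc k) p T p' T < e"
    "\<And>t. a \<bullet> p' t = a \<bullet> p t + (\<Sum>q\<in>B. d q * bump N q (p t))"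
    using \<epsilon>(2)[OF d(1)] by blast
  \<comment> \<open>The observable along the new orbit is the old one plus the bumps, so this is the
    very curve for which the coefficients were chosen.\<close>
  define F :: "real \<Rightarrow> real^3" where "F s = (\<chi> i. a \<bullet> p' ((s - delay_shift i) * T))" for s
  have "circle_embedding T (\<lambda>t. F (t / T))"
  proof (rule circle_embedding_rescaled[OF c(1) _ _ _ d(2)])
    show "F (s + 1) = F s" for s
    proof -
      have "s + 1 - x = (s - x) + 1" for x :: real by simp
      then show ?thesis by (simp only: F_def h(4) c(3))
    qed
    show "inj_on F {0..<1}" using d(3) by (simp add: F_def[abs_def] h(4))
    show "(F has_vector_derivative (\<chi> i. a \<bullet> u' (s - delay_shift i) + (\<Sum>q\<in>B. d q * bump_deriv N q (p ((s - delay_shift i) * T)) (u' (s - delay_shift i))))) (at s)" for s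
      unfolding F_def[abs_def] h(4)
    proof (rule has_vector_derivative_vec)
      fix i :: 3
      have *: "((\<lambda>s. a \<bullet> p (s * T) + (\<Sum>q\<in>B. d q * bump N q (p (s * T)))) has_real_derivative
          a \<bullet> u' t + (\<Sum>q\<in>B. d q * bump_deriv N q (p (t * T)) (u' t))) (at t)" for t
        by (intro DERIV_add DERIV_sum DERIV_cmult observable_derivative bump_along_curve[OF N(2)] c(7))
      show "((\<lambda>t. a \<bullet> p ((t - delay_shift i) * T) + (\<Sum>q\<in>B. d q * bump N q (p ((t - delay_shift i) * T)))) has_real_derivative
          a \<bullet> u' (s - delay_shift i) + (\<Sum>q\<in>B. d q * bump_deriv N q (p ((s - delay_shift i) * T)) (u' (s - delay_shift i)))) (at s)"
        by (rule has_real_derivative_shift[OF *])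
    qed
  qed
  moreover have "F (t / T) = delay_map a p' (1/5 * T) t" for t
    using delay_map_eq_vec[of T a p' "1/5" "t / T"] c(1) by (simp add: F_def delay_shift_def)
  ultimately have "circle_embedding T (delay_map a p' (1/5 * T))" by simp
  with h that show thesis by blast
qed

text \<open>The delay of a nearby orbit is adjusted to its period: with \<theta> = \<tau> / S 0
  fixed and delay \<theta> S c, the shifts in rescaled time do not depend on c, and stability of
  injective immersions applies.\<close>

lemma circle_embedding_stable:
  fixes v v' :: "real \<Rightarrow> real \<Rightarrow> real^'n" and a :: "real^'n"
  assumes "0 \<in> C" and S: "\<And>c. c \<in> C \<Longrightarrow> S c > 0"
    and cv: "continuous_on (C \<times> UNIV) (\<lambda>z. v (fst z) (snd z))" "continuous_on (C \<times> UNIV) (\<lambda>z. v' (fst z) (snd z))"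
    and dv: "\<And>c s. c \<in> C \<Longrightarrow> (v c has_vector_derivative v' c s) (at s)"
    and per: "\<And>c s. c \<in> C \<Longrightarrow> v c (s + 1) = v c s" "\<And>c s. c \<in> C \<Longrightarrow> v' c (s + 1) = v' c s"
    and emb: "\<tau> > 0" "circle_embedding (S 0) (delay_map a (\<lambda>t. v 0 (t / S 0)) \<tau>)"
  shows "\<forall>\<^sub>F c in nhds 0. c \<in> C \<longrightarrow> (\<exists>\<tau>>0. circle_embedding (S c) (delay_map a (\<lambda>t. v c (t / S c)) \<tau>))"
proof -
  define \<theta> where "\<theta> = \<tau> / S 0"
  have \<theta>: "\<theta> > 0" using emb(1) S[OF \<open>0 \<in> C\<close>] by (simp add: \<theta>_def)
  define sh where "sh i = (vector [0, \<theta>, 2 * \<theta>] :: real^3) $ i" for i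
  define F :: "real \<Rightarrow> real \<Rightarrow> real^3" where "F c s = (\<chi> i. a \<bullet> v c (s - sh i))" for c s
  define F' :: "real \<Rightarrow> real \<Rightarrow> real^3" where "F' c s = (\<chi> i. a \<bullet> v' c (s - sh i))" for c s
  have FD: "delay_map a (\<lambda>t. v c (t / S c)) (\<theta> * S c) t = F c (t / S c)" if "c \<in> C" for c t
    using delay_map_eq_vec[of "S c" a "\<lambda>t. v c (t / S c)" \<theta> "t / S c"] S[OF that] by (simp add: F_def sh_def)
  have dF: "(F c has_vector_derivative F' c s) (at s)" if "c \<in> C" for c s
    unfolding F_def[abs_def] F'_def
    by (intro has_vector_derivative_vec has_real_derivative_shift observable_derivative dv that)
  have cont: "continuous_on (C \<times> UNIV) (\<lambda>z. (\<chi> i. a \<bullet> w (fst z) (snd z - sh i)) :: real^3)"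
    if w: "continuous_on (C \<times> UNIV) (\<lambda>z. w (fst z) (snd z))" for w :: "real \<Rightarrow> real \<Rightarrow> real^'n"
  proof (intro continuous_on_vec_lambda continuous_on_inner continuous_on_const)
    fix i
    have "continuous_on (C \<times> UNIV) (\<lambda>z. (\<lambda>y. w (fst y) (snd y)) (fst z, snd z - sh i))"
      by (rule continuous_on_compose2[OF w]) (auto intro!: continuous_intros)
    then show "continuous_on (C \<times> UNIV) (\<lambda>z. w (fst z) (snd z - sh i))" by simp
  qed
  have perF: "F c (s + 1) = F c s" "F' c (s + 1) = F' c s" if "c \<in> C" for c s
  proof -
    have "s + 1 - x = (s - x) + 1" for x :: real by simp
    then show "F c (s + 1) = F c s" "F' c (s + 1) = F' c s" by (simp_all only: F_def F'_def per[OF that])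
  qed
  have S0: "S 0 > 0" by (rule S[OF \<open>0 \<in> C\<close>])
  have "\<theta> * S 0 = \<tau>" using S0 by (simp add: \<theta>_def)
  then have FD0: "delay_map a (\<lambda>t. v 0 (t / S 0)) \<tau> t = F 0 (t / S 0)" for t
    using FD[OF \<open>0 \<in> C\<close>, of t] by simp
  have e0: "\<And>t. \<exists>D. D \<noteq> 0 \<and> (delay_map a (\<lambda>t. v 0 (t / S 0)) \<tau> has_vector_derivative D) (at t)"
    "inj_on (delay_map a (\<lambda>t. v 0 (t / S 0)) \<tau>) {0..<S 0}"
    using emb(2) unfolding circle_embedding_iff[OF S0] by blast+
  have "\<forall>\<^sub>F c in nhds 0. c \<in> C \<longrightarrow> inj_on (F c) {0..<1} \<and> (\<forall>s. F' c s \<noteq> 0)"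
  proof (rule injective_immersion_family[OF dF _ _ perF \<open>0 \<in> C\<close>])
    show "continuous_on (C \<times> UNIV) (\<lambda>z. F (fst z) (snd z))" unfolding F_def by (rule cont[OF cv(1)])
    show "continuous_on (C \<times> UNIV) (\<lambda>z. F' (fst z) (snd z))" unfolding F'_def by (rule cont[OF cv(2)])
    show "F' 0 s \<noteq> 0" for s
    proof
      assume "F' 0 s = 0"
      have "((\<lambda>t. F 0 (t * (1 / S 0))) has_vector_derivative (1 / S 0) *\<^sub>R F' 0 ((s * S 0) * (1 / S 0))) (at (s * S 0))"
        by (rule has_vector_derivative_rescale[OF dF[OF \<open>0 \<in> C\<close>]])
      then have "(delay_map a (\<lambda>t. v 0 (t / S 0)) \<tau> has_vector_derivative 0) (at (s * S 0))"
        using \<open>F' 0 s = 0\<close> S0 by (simp add: FD0[abs_def])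
      moreover obtain D where "D \<noteq> 0" "(delay_map a (\<lambda>t. v 0 (t / S 0)) \<tau> has_vector_derivative D) (at (s * S 0))"
        using e0(1) by blast
      ultimately show False using vector_derivative_unique_at by blast
    qed
    show "inj_on (F 0) {0..<1}"
    proof (rule inj_onI)
      fix x y :: real assume xy: "x \<in> {0..<1}" "y \<in> {0..<1}" "F 0 x = F 0 y"
      have "x * S 0 = y * S 0"
        by (rule inj_onD[OF e0(2)]) (use xy S0 in \<open>auto simp: FD0\<close>)
      then show "x = y" using S0 by simp
    qed
  qed
  then show ?thesis
  proof eventually_elim
    case (elim c)
    show ?case
    proof
      assume c: "c \<in> C"
      have "circle_embedding (S c) (\<lambda>t. F c (t / S c))"
        by (rule circle_embedding_rescaled[OF S[OF c] perF(1)[OF c] _ dF[OF c]]) (use elim c in auto)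
      then have "circle_embedding (S c) (delay_map a (\<lambda>t. v c (t / S c)) (\<theta> * S c))"
        by (simp add: FD[OF c, abs_def])
      moreover have "\<theta> * S c > 0" using \<theta> S[OF c] by simp
      ultimately show "\<exists>\<tau>>0. circle_embedding (S c) (delay_map a (\<lambda>t. v c (t / S c)) \<tau>)" by blast
    qed
  qed
qed

text \<open>Serves for both sets of fields. The property \<open>Q\<close> only has to survive
  convergence of the rescaled curves together with their first derivatives; persistence provides the
  nearby orbits.\<close>

lemma openin_orbit_property:
  fixes U :: "(real^'n) set" and p0 :: "real \<Rightarrow> real^'n" and Q :: "real \<Rightarrow> (real \<Rightarrow> real^'n) \<Rightarrow> bool"
  assumes "open U" "k \<ge> 1" and p0: "bounded_derivs (Suc k) p0 T0"
    and stab: "\<And>C S v v'. 0 \<in> C \<Longrightarrow> (\<And>c. c \<in> C \<Longrightarrow> S c > 0) \<Longrightarrow>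
      continuous_on (C \<times> UNIV) (\<lambda>z. v (fst z) (snd z)) \<Longrightarrow> continuous_on (C \<times> UNIV) (\<lambda>z. v' (fst z) (snd z)) \<Longrightarrow>
      (\<And>c s. c \<in> C \<Longrightarrow> (v c has_vector_derivative v' c s) (at s)) \<Longrightarrow>
      (\<And>c s. c \<in> C \<Longrightarrow> v c (s + 1) = v c s) \<Longrightarrow> (\<And>c s. c \<in> C \<Longrightarrow> v' c (s + 1) = v' c s) \<Longrightarrow>
      Q (S 0) (\<lambda>t. v 0 (t / S 0)) \<Longrightarrow> \<forall>\<^sub>F c in nhds (0::real). c \<in> C \<longrightarrow> Q (S c) (\<lambda>t. v c (t / S c))"
  shows "openin (Ck_topology k U) {g \<in> Ck_fields k U. \<exists>p' T'. hyperbolic_periodic_solution U g T' p' \<and>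
      periodic_orbit_dist (Suc k) p0 T0 p' T' < \<eta> \<and> Q T' p'}" (is "openin _ ?X")
proof (rule openin_Ck_topology_by_families)
  fix f assume "f \<in> ?X"
  then obtain p T where f: "f \<in> Ck_fields k U" "hyperbolic_periodic_solution U f T p"
    "periodic_orbit_dist (Suc k) p0 T0 p T < \<eta>" "Q T p" by blast
  have ps: "periodic_solution U f T p" using f(2) by (simp add: hyperbolic_periodic_solution_def)
  then have T: "T > 0" by (simp add: periodic_solution_def)
  obtain per: "\<And>s. p ((s + 1) * T) = p (s * T)" and pU: "\<And>t. p t \<in> U"
    using ps T by (auto simp: periodic_solution_def distrib_right)
  define u where "u s = p (s * T)" for s
  have up: "(\<lambda>t. u (t / T)) = p" using T by (simp add: u_def)
  have cp: "continuous_on UNIV p"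
    using ps unfolding periodic_solution_def
    by (intro continuous_at_imp_continuous_on ballI) (blast intro: has_vector_derivative_continuous)
  have cu: "continuous_on UNIV u" unfolding u_def
    by (rule continuous_on_compose2[OF cp]) (auto intro!: continuous_intros)
  obtain K W where K: "compact K" "K \<subseteq> U" "open W" "W \<subseteq> K" "\<And>s. u s \<in> W"
    by (rule orbit_neighborhood[OF \<open>open U\<close> cu]) (use per pU in \<open>auto simp: u_def\<close>)
  have WU: "W \<subseteq> U" using K by blast
  show "\<exists>K. compact K \<and> K \<subseteq> U \<and>
      (\<forall>G. G 0 = f \<and> (\<forall>c\<in>harmonic_set. c \<noteq> 0 \<longrightarrow> G c \<in> Ck_nbhd k U f K c) \<longrightarrow> (\<exists>c\<in>harmonic_set. c \<noteq> 0 \<and> G c \<in> ?X))"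
  proof (intro exI[of _ K] conjI allI impI K(1,2))
    fix G assume "G 0 = f \<and> (\<forall>c\<in>harmonic_set. c \<noteq> 0 \<longrightarrow> G c \<in> Ck_nbhd k U f K c)"
    then have G: "G 0 = f" "\<And>c. c \<in> harmonic_set \<Longrightarrow> c \<noteq> 0 \<Longrightarrow> G c \<in> Ck_nbhd k U (G 0) K c" by auto
    have Gf: "G c \<in> Ck_fields k U" if "c \<in> harmonic_set" for c
      using G(2)[OF that] f(1) G(1) by (cases "c = 0") (auto simp: Ck_nbhd_def)
    have fam: "Ck_family k harmonic_set W G"
      by (rule Ck_family_of_Ck_nbhds[OF G(2)]) (use f(1) G(1) K in auto)
    have fam1: "Ck_family (Suc 0) harmonic_set W G"
      by (rule Ck_family_mono[OF fam]) (use \<open>k \<ge> 1\<close> in simp)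
    have hyp0: "hyperbolic_periodic_solution U (G 0) T (\<lambda>t. u (t / T))" unfolding up G(1) by (rule f(2))
    obtain C S v where C: "C \<subseteq> harmonic_set" "0 \<in> C" "\<forall>\<^sub>F c in nhds 0. c \<in> harmonic_set \<longrightarrow> c \<in> C"
      and S0: "S 0 = T" and v0: "v 0 = u" and S: "continuous_on C S" "\<And>c. c \<in> C \<Longrightarrow> S c > 0"
      and cv: "continuous_on (C \<times> UNIV) (\<lambda>z. v (fst z) (snd z))"
      and vW: "\<And>c s. c \<in> C \<Longrightarrow> v c s \<in> W" and vper: "\<And>c s. c \<in> C \<Longrightarrow> v c (s + 1) = v c s"
      and dv: "\<And>c s. c \<in> C \<Longrightarrow> (v c has_vector_derivative S c *\<^sub>R G c (v c s)) (at s)"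
      by (rule periodic_solution_persists[OF order_refl zero_in_harmonic_set K(3) fam1 T K(5) hyp0]) (rule that; assumption)
    have famC: "Ck_family k C W G" by (rule Ck_family_subset[OF fam C(1) order_refl])
    have cv': "continuous_on (C \<times> UNIV) (\<lambda>z. S (fst z) *\<^sub>R G (fst z) (v (fst z) (snd z)))"
    proof (intro continuous_on_scaleR)
      show "continuous_on (C \<times> UNIV) (\<lambda>z. S (fst z))"
        by (rule continuous_on_compose2[OF S(1)]) (auto intro!: continuous_intros)
      have "continuous_on (C \<times> UNIV) (\<lambda>z. (\<lambda>w. G (fst w) (snd w)) (fst z, v (fst z) (snd z)))"
        by (rule continuous_on_compose2[OF Ck_family_continuous[OF famC]]) (use vW in \<open>auto intro!: continuous_intros cv\<close>)
      then show "continuous_on (C \<times> UNIV) (\<lambda>z. G (fst z) (v (fst z) (snd z)))" by simp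
    qed
    have Q: "\<forall>\<^sub>F c in nhds 0. c \<in> C \<longrightarrow> Q (S c) (\<lambda>t. v c (t / S c))"
      by (rule stab[OF C(2) S(2) cv cv' dv vper]) (use vper f(4) in \<open>auto simp: S0 v0 up\<close>)
    \<comment> \<open>The slack in the strict inequality is what the triangle inequality may spend
      on the new orbit.\<close>
    have e: "\<eta> - periodic_orbit_dist (Suc k) p0 T0 p T > 0" using f(3) by simp
    have "\<forall>\<^sub>F c in nhds 0. c \<in> C \<longrightarrow> hyperbolic_periodic_solution U (G c) (S c) (\<lambda>t. v c (t / S c)) \<and>
       periodic_orbit_dist (Suc k) (\<lambda>t. v 0 (t / S 0)) (S 0) (\<lambda>t. v c (t / S c)) (S c) < \<eta> - periodic_orbit_dist (Suc k) p0 T0 p T"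
      by (rule solution_family_converges[OF K(3) WU famC \<open>k \<ge> 1\<close> C(2) S cv vW vper dv _ e])
        (simp_all add: S0 v0 hyp0)
    with Q C(3) have "\<forall>\<^sub>F c in nhds 0. c \<in> harmonic_set \<longrightarrow> G c \<in> ?X"
    proof eventually_elim
      case (elim c)
      show ?case
      proof
        assume c: "c \<in> harmonic_set"
        then have cC: "c \<in> C" using elim by blast
        have hc: "hyperbolic_periodic_solution U (G c) (S c) (\<lambda>t. v c (t / S c))"
          and dist: "periodic_orbit_dist (Suc k) p T (\<lambda>t. v c (t / S c)) (S c) < \<eta> - periodic_orbit_dist (Suc k) p0 T0 p T"
          using elim cC by (auto simp: S0 v0 up)
        have "bounded_derivs (Suc k) (\<lambda>t. v c (t / S c)) (S c)"
          by (rule bounded_derivs_periodic_solution[OF \<open>open U\<close>])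
            (use Gf[OF c] hc in \<open>auto simp: Ck_fields_def hyperbolic_periodic_solution_def\<close>)
        moreover have "bounded_derivs (Suc k) p T"
          by (rule bounded_derivs_periodic_solution[OF \<open>open U\<close> _ ps]) (use f(1) in \<open>simp add: Ck_fields_def\<close>)
        ultimately have "periodic_orbit_dist (Suc k) p0 T0 (\<lambda>t. v c (t / S c)) (S c) < \<eta>"
          using periodic_orbit_dist_triangle[OF p0, of p T "\<lambda>t. v c (t / S c)" "S c"] dist by simp
        then show "G c \<in> ?X" using Gf[OF c] hc elim cC by blast
      qed
    qed
    then show "\<exists>c\<in>harmonic_set. c \<noteq> 0 \<and> G c \<in> ?X"
      by (rule eventually_harmonic_set) blast
  qed
qed blast

theorem theorem15:
  fixes r :: nat
    and U :: "(real^'n) set"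
    and f :: "real^'n \<Rightarrow> real^'n"
    and a :: "real^'n"
    and T :: real
    and p :: "real \<Rightarrow> real^'n"
  assumes "r \<ge> 2"
    and "open U"
    and "f \<in> Ck_fields r U"
    and "a \<noteq> 0"
    and "hyperbolic_periodic_solution U f T p"
  shows "\<forall>\<eta>>0. \<exists>\<N> \<G>.
    openin (Ck_topology (r - 1) U) \<N> \<and> f \<in> \<N> \<and>
    openin (subtopology (Ck_topology (r - 1) U) \<N>) \<G> \<and>
    (subtopology (Ck_topology (r - 1) U) \<N>) closure_of \<G> = \<N> \<and>
    (\<forall>g\<in>\<G>. \<exists>p' T' \<tau>'.
      hyperbolic_periodic_solution U g T' p' \<and>
      periodic_orbit_dist r p T p' T' < \<eta> \<and>
      \<tau>' > 0 \<and>
      circle_embedding T' (delay_map a p' \<tau>'))"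
proof (intro allI impI)
  fix \<eta> :: real assume "\<eta> > 0"
  define k where "k = r - 1"
  have k: "r = Suc k" "k \<ge> 1" using \<open>r \<ge> 2\<close> by (auto simp: k_def)
  have fk: "f \<in> Ck_fields k U"
    using \<open>f \<in> Ck_fields r U\<close> Ck_family_mono[of r "{0::real}" U "\<lambda>_. f" k]
    by (auto simp: Ck_fields_def Ck_on_iff_Ck_family[where c="0::real"] k)
  have bd: "bounded_derivs r q S" if "g \<in> Ck_fields k U" "hyperbolic_periodic_solution U g S q" for g S q
    unfolding k(1) using that
    by (intro bounded_derivs_periodic_solution[OF \<open>open U\<close>, of k g]) (auto simp: Ck_fields_def hyperbolic_periodic_solution_def)
  have bp: "bounded_derivs (Suc k) p T" using bd[OF fk \<open>hyperbolic_periodic_solution U f T p\<close>] by (simp add: k)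
  \<comment> \<open>Both sets are defined through the existence of an orbit close to
    \<open>p\<close>, not through closeness to \<open>f\<close>; this makes \<open>\<N>\<close> open
    and lets every member start its own perturbation.\<close>
  define X where "X Q = {g \<in> Ck_fields k U. \<exists>p' T'. hyperbolic_periodic_solution U g T' p' \<and>
      periodic_orbit_dist (Suc k) p T p' T' < \<eta> \<and> Q T' p'}" for Q
  define \<N> where "\<N> = X (\<lambda>_ _. True)"
  define \<G> where "\<G> = X (\<lambda>T' p'. \<exists>\<tau>>0. circle_embedding T' (delay_map a p' \<tau>))"
  have oN: "openin (Ck_topology k U) \<N>"
    unfolding \<N>_def X_def by (rule openin_orbit_property[OF \<open>open U\<close> k(2) bp]) simp
  have oG: "openin (Ck_topology k U) \<G>"
    unfolding \<G>_def X_def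
  proof (rule openin_orbit_property[OF \<open>open U\<close> k(2) bp])
    fix C S and v v' :: "real \<Rightarrow> real \<Rightarrow> real^'n"
    assume A: "0 \<in> C" "\<And>c. c \<in> C \<Longrightarrow> S c > 0" "continuous_on (C \<times> UNIV) (\<lambda>z. v (fst z) (snd z))"
      "continuous_on (C \<times> UNIV) (\<lambda>z. v' (fst z) (snd z))" "\<And>c s. c \<in> C \<Longrightarrow> (v c has_vector_derivative v' c s) (at s)"
      "\<And>c s. c \<in> C \<Longrightarrow> v c (s + 1) = v c s" "\<And>c s. c \<in> C \<Longrightarrow> v' c (s + 1) = v' c s"
      "\<exists>\<tau>>0. circle_embedding (S 0) (delay_map a (\<lambda>t. v 0 (t / S 0)) \<tau>)"
    then obtain \<tau> where \<tau>: "\<tau> > 0" "circle_embedding (S 0) (delay_map a (\<lambda>t. v 0 (t / S 0)) \<tau>)" by blast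
    show "\<forall>\<^sub>F c in nhds 0. c \<in> C \<longrightarrow> (\<exists>\<tau>>0. circle_embedding (S c) (delay_map a (\<lambda>t. v c (t / S c)) \<tau>))"
      by (rule circle_embedding_stable[where C=C and S=S and v=v and v'=v' and a=a and \<tau>=\<tau>, OF A(1-7) \<tau>])
  qed
  have GN: "\<G> \<subseteq> \<N>" unfolding \<G>_def \<N>_def X_def by blast
  have fN: "f \<in> \<N>"
    unfolding \<N>_def X_def using fk assms(5) \<open>\<eta> > 0\<close> by (auto intro!: exI[of _ p] exI[of _ T])
  have dense: "\<exists>h. h \<in> \<G> \<and> h \<in> V" if V: "openin (Ck_topology k U) V" "g \<in> V" and g: "g \<in> \<N>" for V g
  proof -
    obtain q S where q: "g \<in> Ck_fields k U" "hyperbolic_periodic_solution U g S q" "periodic_orbit_dist (Suc k) p T q S < \<eta>"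
      using g unfolding \<N>_def X_def by blast
    \<comment> \<open>Half of the slack for each of the two perturbations, the one that makes the
      delay map immersed and the one that makes it injective.\<close>
    define e where "e = (\<eta> - periodic_orbit_dist (Suc k) p T q S) / 2"
    have e: "e > 0" using q(3) by (simp add: e_def)
    have Vf: "V \<subseteq> Ck_fields k U" using V(1) by (simp add: openin_Ck_topology)
    obtain h1 q1 where h1: "h1 \<in> V" "hyperbolic_periodic_solution U h1 S q1"
      "periodic_orbit_dist (Suc k) q S q1 S < e" "delay_immersed a S q1"
      by (rule dense_delay_immersed[OF \<open>open U\<close> k(2) q(1,2) \<open>a \<noteq> 0\<close> V e])
    have h1f: "h1 \<in> Ck_fields k U" using h1(1) Vf by blast
    obtain h2 q2 where h2: "h2 \<in> V" "hyperbolic_periodic_solution U h2 S q2"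
      "periodic_orbit_dist (Suc k) q1 S q2 S < e" "circle_embedding S (delay_map a q2 (1/5 * S))"
      by (rule dense_delay_embedded[OF \<open>open U\<close> k(2) h1f h1(2) \<open>a \<noteq> 0\<close> V(1) h1(1) e h1(4)])
    have h2f: "h2 \<in> Ck_fields k U" using h2(1) Vf by blast
    note b = bd[OF q(1,2), unfolded k] bd[OF h1f h1(2), unfolded k] bd[OF h2f h2(2), unfolded k]
    have "periodic_orbit_dist (Suc k) p T q2 S < \<eta>"
      using periodic_orbit_dist_triangle[OF bp b(1,2)] periodic_orbit_dist_triangle[OF bp b(2,3)] h1(3) h2(3)
      by (simp add: e_def field_simps)
    moreover have "1/5 * S > 0" using h2(2) by (simp add: hyperbolic_periodic_solution_def periodic_solution_def)
    ultimately have "h2 \<in> \<G>" unfolding \<G>_def X_def using h2f h2(2,4) by blast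
    with h2(1) show ?thesis by blast
  qed
  have cl: "subtopology (Ck_topology k U) \<N> closure_of \<G> = \<N>"
  proof
    show "subtopology (Ck_topology k U) \<N> closure_of \<G> \<subseteq> \<N>"
      using closure_of_subset_topspace[of "subtopology (Ck_topology k U) \<N>" \<G>] by auto
    show "\<N> \<subseteq> subtopology (Ck_topology k U) \<N> closure_of \<G>"
    proof
      fix g assume g: "g \<in> \<N>"
      have "g \<in> topspace (subtopology (Ck_topology k U) \<N>)"
        using g openin_subset[OF oN] by (auto simp: topspace_subtopology)
      moreover have "\<exists>y. y \<in> \<G> \<and> y \<in> V" if "g \<in> V \<and> openin (subtopology (Ck_topology k U) \<N>) V" for V
        using dense[of V g] that g openin_open_subtopology[OF oN] by blast
      ultimately show "g \<in> subtopology (Ck_topology k U) \<N> closure_of \<G>"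
        by (simp add: in_closure_of)
    qed
  qed
  have "openin (subtopology (Ck_topology k U) \<N>) \<G>"
    using openin_open_subtopology[OF oN] oG GN by blast
  moreover have "\<exists>p' T' \<tau>'. hyperbolic_periodic_solution U g T' p' \<and> periodic_orbit_dist r p T p' T' < \<eta> \<and>
      \<tau>' > 0 \<and> circle_embedding T' (delay_map a p' \<tau>')" if "g \<in> \<G>" for g
    using that unfolding \<G>_def X_def k(1) by blast
  ultimately show "\<exists>\<N> \<G>. openin (Ck_topology (r - 1) U) \<N> \<and> f \<in> \<N> \<and>
    openin (subtopology (Ck_topology (r - 1) U) \<N>) \<G> \<and>
    (subtopology (Ck_topology (r - 1) U) \<N>) closure_of \<G> = \<N> \<and>
    (\<forall>g\<in>\<G>. \<exists>p' T' \<tau>'. hyperbolic_periodic_solution U g T' p' \<and> periodic_orbit_dist r p T p' T' < \<eta> \<and>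
      \<tau>' > 0 \<and> circle_embedding T' (delay_map a p' \<tau>'))"
    unfolding k_def[symmetric] using oN fN cl by blast
qed

end
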